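(* Let $X$ be a continuum with compact universal cover $\widehat{\phi}:\widehat{X}\to X=\widehat{X}/\pi_P(X)$. If $f:Y\to X=Y/G$ is a generalized regular covering map with $Y$ a continuum, then $f$ is equivalent to the induced quotient $\pi:\widehat{X}/K\to(\widehat{X}/K)/(\pi_P(X)/K)$ for some closed normal subgroup $K$ of $\pi_P(X)$. Conversely, any such induced quotient for a closed normal subgroup $K$ of $\pi_P(X)$ is a generalized regular covering map of $X$ by a continuum.
   Context: A continuum is a compact, connected, metrizable space. A regular covering map $f:Y\to X=Y/G$ between topological spaces is a covering map that is also the quotient map of a free action of a group $G$ of homeomorphisms of $Y$. A cover of $X$ by a continuum is a regular covering map $f:Y\to X$ with $Y$ a continuum. Uniform spaces: a uniform space is a topological space with a compatible uniformity, whose entourages are taken to be symmetric; a compact space carries its unique compatible uniformity. For a map $g$ and $E\subset Y\times Y$, $g(E)$ means $(g\times g)(E)$. A group $G$ of bijections of a uniform space $Y$ acts isomorphically if $Y$ has a basis of entourages $E$ with $g(E)=E$ for all $g\in G$; $Y/G$ then has the quotient uniformity, consisting of the images of entourages. For an entourage $E$ let $U_E(G)=\{g\in G:(y,g(y))\in E\ \forall y\in Y\}$, $S_E(G)=\{g\in G:(y,g(y))\in E\text{ for some }y\in Y\}$, and $N_E(G)$ the subgroup generated by $S_E(G)$. $G$ acts prodiscretely if for every entourage $E$ there is an entourage $F$ with $N_F(G)\subset U_E(G)$. $G$ has the topology (and uniformity) of uniform convergence, for which the $U_E(G)$ form a basis at the identity. A generalized regular covering map $f:Y\to X=Y/G$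 with deck group $G$ is the quotient map of an isomorphic and prodiscrete action of a complete group $G$ on $Y$ (with $X$ identified with $Y/G$). Equivalence: quotient maps $f_i:Y_i\to X=Y_i/G_i$ ($i=1,2$) of isomorphic actions are equivalent if there are a uniform homeomorphism $h:Y_1\to Y_2$ and an isomorphism $\theta:G_1\to G_2$ with $h\circ g=\theta(g)\circ h$ for all $g\in G_1$ and $f_2\circ h=f_1$. Compact universal cover: let $\{f_i:X_i\to X=X_i/G_i\}$ be the family of all covers of $X$ by continua, one from each equivalence class, with basepoints $*$ in $X$ and the $X_i$ such that $f_i( * )=*$. Write $f_i\leq f_j$ if there is a continuous surjection $f_{ij}:X_j\to X_i$ with $f_j=f_i\circ f_{ij}$; this is a directed order, the basepoint preserving $f_{ij}$ is unique, and there are homomorphisms $\theta_{ij}:G_j\to G_i$ with $\theta_{ij}(g)\circ f_{ij}=f_{ij}\circ g$. Put $\widehat{X}=\varprojlim X_i$ and $\pi_P(X)=\varprojlim G_i$ (profinite fundamental group), acting coordinatewise on $\widehat{X}$; $\widehat{\phi}:\widehat{X}\to X=\widehat{X}/\pi_P(X)$ is the projection, a generalized regular covering map. For a normal subgroup $K$ of a group $\Gamma$ acting isomorphically on $Z$, $\Gamma/K$ acts isomorphically on $Z/K$, and the induced quotient is $Z/K\to(Z/K)/(\Gamma/K)=Z/\Gamma$. *)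

theory Defs
  imports "HOL-Analysis.Analysis" "HOL-Algebra.Group_Action" "HOL-Algebra.Generated_Groups"
    "HOL-Algebra.Product_Groups"
begin

section \<open>Uniform structures on a carrier\<close>

text \<open>
  A uniform structure is the set of its entourages, all of them symmetric.  As with
  topologies and their \<open>topspace\<close>, the underlying set is recovered from the structure.
\<close>

definition ucarrier :: "('a \<times> 'a) set set \<Rightarrow> 'a set" where
  "ucarrier \<U> = Field (\<Union>\<U>)"

definition uniform_structure :: "('a \<times> 'a) set set \<Rightarrow> bool" where
  "uniform_structure \<U> \<longleftrightarrow>
     \<U> \<noteq> {} \<and>
     (\<forall>E\<in>\<U>. Id_on (ucarrier \<U>) \<subseteq> E \<and> sym E \<and> (\<exists>F\<in>\<U>. F O F \<subseteq> E)) \<and>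
     (\<forall>E\<in>\<U>. \<forall>F\<in>\<U>. E \<inter> F \<in> \<U>) \<and>
     (\<forall>E\<in>\<U>. \<forall>F. E \<subseteq> F \<and> F \<subseteq> ucarrier \<U> \<times> ucarrier \<U> \<and> sym F \<longrightarrow> F \<in> \<U>)"

definition utopology :: "('a \<times> 'a) set set \<Rightarrow> 'a topology" where
  "utopology \<U> = topology (\<lambda>V. V \<subseteq> ucarrier \<U> \<and> (\<forall>x\<in>V. \<exists>E\<in>\<U>. E `` {x} \<subseteq> V))"

lemma openin_utopology:
  assumes "uniform_structure \<U>"
  shows "openin (utopology \<U>) V \<longleftrightarrow> V \<subseteq> ucarrier \<U> \<and> (\<forall>x\<in>V. \<exists>E\<in>\<U>. E `` {x} \<subseteq> V)"
proof -
  have "istopology (\<lambda>V. V \<subseteq> ucarrier \<U> \<and> (\<forall>x\<in>V. \<exists>E\<in>\<U>. E `` {x} \<subseteq> V))"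
    unfolding istopology_def
  proof (intro conjI allI impI)
    fix S T
    assume S: "S \<subseteq> ucarrier \<U> \<and> (\<forall>x\<in>S. \<exists>E\<in>\<U>. E `` {x} \<subseteq> S)"
      and T: "T \<subseteq> ucarrier \<U> \<and> (\<forall>x\<in>T. \<exists>E\<in>\<U>. E `` {x} \<subseteq> T)"
    show "S \<inter> T \<subseteq> ucarrier \<U>" using S by blast
    show "\<forall>x\<in>S \<inter> T. \<exists>E\<in>\<U>. E `` {x} \<subseteq> S \<inter> T"
    proof
      fix x assume "x \<in> S \<inter> T"
      then obtain E F where "E \<in> \<U>" "F \<in> \<U>" "E `` {x} \<subseteq> S" "F `` {x} \<subseteq> T"
        using S T by blast
      moreover have "E \<inter> F \<in> \<U>"
        using assms \<open>E \<in> \<U>\<close> \<open>F \<in> \<U>\<close> unfolding uniform_structure_def by blast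
      ultimately show "\<exists>E\<in>\<U>. E `` {x} \<subseteq> S \<inter> T" by blast
    qed
  next
    fix \<K>
    assume *: "\<forall>K\<in>\<K>. K \<subseteq> ucarrier \<U> \<and> (\<forall>x\<in>K. \<exists>E\<in>\<U>. E `` {x} \<subseteq> K)"
    then show "\<Union>\<K> \<subseteq> ucarrier \<U>" by blast
    show "\<forall>x\<in>\<Union>\<K>. \<exists>E\<in>\<U>. E `` {x} \<subseteq> \<Union>\<K>"
      using * by (meson Union_iff Union_upper subset_trans)
  qed
  then show ?thesis by (simp add: utopology_def topology_inverse')
qed

text \<open>Meaningful for compact Hausdorff spaces, where existence and uniqueness hold.\<close>

definition compact_uniformity :: "'a topology \<Rightarrow> ('a \<times> 'a) set set" where
  "compact_uniformity X = (THE \<U>. uniform_structure \<U> \<and> utopology \<U> = X)"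

definition uniformly_continuous_map ::
    "('a \<times> 'a) set set \<Rightarrow> ('b \<times> 'b) set set \<Rightarrow> ('a \<Rightarrow> 'b) \<Rightarrow> bool" where
  "uniformly_continuous_map \<U> \<V> h \<longleftrightarrow>
     h \<in> ucarrier \<U> \<rightarrow> ucarrier \<V> \<and>
     (\<forall>F\<in>\<V>. {(x, y) \<in> ucarrier \<U> \<times> ucarrier \<U>. (h x, h y) \<in> F} \<in> \<U>)"

definition uniform_homeomorphism ::
    "('a \<times> 'a) set set \<Rightarrow> ('b \<times> 'b) set set \<Rightarrow> ('a \<Rightarrow> 'b) \<Rightarrow> bool" where
  "uniform_homeomorphism \<U> \<V> h \<longleftrightarrow>
     bij_betw h (ucarrier \<U>) (ucarrier \<V>) \<and>
     uniformly_continuous_map \<U> \<V> h \<and>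
     uniformly_continuous_map \<V> \<U> (inv_into (ucarrier \<U>) h)"

definition complete_uniformity :: "('a \<times> 'a) set set \<Rightarrow> bool" where
  "complete_uniformity \<U> \<longleftrightarrow>
     (\<forall>F. F \<noteq> bot \<and> F \<le> principal (ucarrier \<U>) \<and>
          (\<forall>E\<in>\<U>. eventually (\<lambda>p. p \<in> E) (F \<times>\<^sub>F F)) \<longrightarrow>
          (\<exists>x\<in>ucarrier \<U>. \<forall>E\<in>\<U>. eventually (\<lambda>y. (x, y) \<in> E) F))"

definition image_uniformity ::
    "('y \<Rightarrow> 'x) \<Rightarrow> ('y \<times> 'y) set set \<Rightarrow> ('x \<times> 'x) set set" where
  "image_uniformity f \<U> = (\<lambda>E. map_prod f f ` E) ` \<U>"


section \<open>Isomorphic and prodiscrete actions\<close>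

text \<open>
  A group of bijections of a set is rendered as a group with a faithful action, so that
  inverse limits and quotients of groups of bijections are covered without conversion.
\<close>

definition acts_isomorphically ::
    "('y \<times> 'y) set set \<Rightarrow> 'g monoid \<Rightarrow> ('g \<Rightarrow> 'y \<Rightarrow> 'y) \<Rightarrow> bool" where
  "acts_isomorphically \<U> G \<phi> \<longleftrightarrow>
     uniform_structure \<U> \<and> faithful_action G (ucarrier \<U>) \<phi> \<and>
     (\<forall>E\<in>\<U>. \<exists>F\<in>\<U>. F \<subseteq> E \<and> (\<forall>g\<in>carrier G. map_prod (\<phi> g) (\<phi> g) ` F = F))"

definition U_set ::
    "('y \<times> 'y) set set \<Rightarrow> 'g monoid \<Rightarrow> ('g \<Rightarrow> 'y \<Rightarrow> 'y) \<Rightarrow> ('y \<times> 'y) set \<Rightarrow> 'g set" where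
  "U_set \<U> G \<phi> E = {g \<in> carrier G. \<forall>y\<in>ucarrier \<U>. (y, \<phi> g y) \<in> E}"

definition S_set ::
    "('y \<times> 'y) set set \<Rightarrow> 'g monoid \<Rightarrow> ('g \<Rightarrow> 'y \<Rightarrow> 'y) \<Rightarrow> ('y \<times> 'y) set \<Rightarrow> 'g set" where
  "S_set \<U> G \<phi> E = {g \<in> carrier G. \<exists>y\<in>ucarrier \<U>. (y, \<phi> g y) \<in> E}"

definition N_subgroup ::
    "('y \<times> 'y) set set \<Rightarrow> 'g monoid \<Rightarrow> ('g \<Rightarrow> 'y \<Rightarrow> 'y) \<Rightarrow> ('y \<times> 'y) set \<Rightarrow> 'g set" where
  "N_subgroup \<U> G \<phi> E = generate G (S_set \<U> G \<phi> E)"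

definition acts_prodiscretely ::
    "('y \<times> 'y) set set \<Rightarrow> 'g monoid \<Rightarrow> ('g \<Rightarrow> 'y \<Rightarrow> 'y) \<Rightarrow> bool" where
  "acts_prodiscretely \<U> G \<phi> \<longleftrightarrow>
     (\<forall>E\<in>\<U>. \<exists>F\<in>\<U>. N_subgroup \<U> G \<phi> F \<subseteq> U_set \<U> G \<phi> E)"

text \<open>
  The uniformity of uniform convergence.  For an isomorphic action the sets
  \<open>U_set \<U> G \<phi> E\<close> form a basis at the identity of its topology.
\<close>

definition uniform_convergence ::
    "('y \<times> 'y) set set \<Rightarrow> 'g monoid \<Rightarrow> ('g \<Rightarrow> 'y \<Rightarrow> 'y) \<Rightarrow> ('g \<times> 'g) set set" where
  "uniform_convergence \<U> G \<phi> =
     {W. W \<subseteq> carrier G \<times> carrier G \<and> sym W \<and>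
         (\<exists>E\<in>\<U>. {(g, h) \<in> carrier G \<times> carrier G.
                    \<forall>y\<in>ucarrier \<U>. (\<phi> g y, \<phi> h y) \<in> E} \<subseteq> W)}"

text \<open>
  The identification of \<open>X\<close> with the orbit space \<open>Y/G\<close> is expressed by requiring that the
  fibres of \<open>f\<close> are the orbits and that \<open>X\<close> carries the quotient structure.
\<close>

definition fibres_are_orbits ::
    "'y set \<Rightarrow> 'g monoid \<Rightarrow> ('g \<Rightarrow> 'y \<Rightarrow> 'y) \<Rightarrow> ('y \<Rightarrow> 'x) \<Rightarrow> bool" where
  "fibres_are_orbits S G \<phi> f \<longleftrightarrow> (\<forall>y\<in>S. \<forall>z\<in>S. f y = f z \<longleftrightarrow> z \<in> orbit G \<phi> y)"

definition isomorphic_quotient_map ::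
    "('y \<times> 'y) set set \<Rightarrow> 'g monoid \<Rightarrow> ('g \<Rightarrow> 'y \<Rightarrow> 'y) \<Rightarrow>
     ('x \<times> 'x) set set \<Rightarrow> ('y \<Rightarrow> 'x) \<Rightarrow> bool" where
  "isomorphic_quotient_map \<U> G \<phi> \<V> f \<longleftrightarrow>
     acts_isomorphically \<U> G \<phi> \<and>
     f ` ucarrier \<U> = ucarrier \<V> \<and>
     fibres_are_orbits (ucarrier \<U>) G \<phi> f \<and>
     \<V> = image_uniformity f \<U>"

definition generalized_regular_covering ::
    "('y \<times> 'y) set set \<Rightarrow> 'g monoid \<Rightarrow> ('g \<Rightarrow> 'y \<Rightarrow> 'y) \<Rightarrow>
     ('x \<times> 'x) set set \<Rightarrow> ('y \<Rightarrow> 'x) \<Rightarrow> bool" where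
  "generalized_regular_covering \<U> G \<phi> \<V> f \<longleftrightarrow>
     isomorphic_quotient_map \<U> G \<phi> \<V> f \<and>
     acts_prodiscretely \<U> G \<phi> \<and>
     complete_uniformity (uniform_convergence \<U> G \<phi>)"

definition equivalent_quotients ::
    "('y \<times> 'y) set set \<Rightarrow> 'g monoid \<Rightarrow> ('g \<Rightarrow> 'y \<Rightarrow> 'y) \<Rightarrow> ('y \<Rightarrow> 'x) \<Rightarrow>
     ('z \<times> 'z) set set \<Rightarrow> 'h monoid \<Rightarrow> ('h \<Rightarrow> 'z \<Rightarrow> 'z) \<Rightarrow> ('z \<Rightarrow> 'x) \<Rightarrow> bool" where
  "equivalent_quotients \<U>\<^sub>1 G\<^sub>1 \<phi>\<^sub>1 f\<^sub>1 \<U>\<^sub>2 G\<^sub>2 \<phi>\<^sub>2 f\<^sub>2 \<longleftrightarrow>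
     (\<exists>h \<theta>. uniform_homeomorphism \<U>\<^sub>1 \<U>\<^sub>2 h \<and> \<theta> \<in> iso G\<^sub>1 G\<^sub>2 \<and>
        (\<forall>g\<in>carrier G\<^sub>1. \<forall>y\<in>ucarrier \<U>\<^sub>1. h (\<phi>\<^sub>1 g y) = \<phi>\<^sub>2 (\<theta> g) (h y)) \<and>
        (\<forall>y\<in>ucarrier \<U>\<^sub>1. f\<^sub>2 (h y) = f\<^sub>1 y))"


section \<open>Induced quotients\<close>

text \<open>
  For a normal subgroup \<open>K\<close> of \<open>\<Gamma>\<close> acting on \<open>Z\<close> via \<open>\<phi>\<close>: the orbit space \<open>Z/K\<close> with its
  quotient uniformity, the action of \<open>\<Gamma> Mod K\<close> on it, and the map on \<open>Z/K\<close> induced by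
  the quotient map \<open>f : Z \<rightarrow> Z/\<Gamma>\<close> (constant on \<open>K\<close>-orbits).
\<close>

definition quotient_uniformity ::
    "('z \<times> 'z) set set \<Rightarrow> 'g monoid \<Rightarrow> ('g \<Rightarrow> 'z \<Rightarrow> 'z) \<Rightarrow> 'g set \<Rightarrow>
     ('z set \<times> 'z set) set set" where
  "quotient_uniformity \<U> \<Gamma> \<phi> K = image_uniformity (orbit (\<Gamma>\<lparr>carrier := K\<rparr>) \<phi>) \<U>"

definition quotient_action ::
    "'z set \<Rightarrow> 'g monoid \<Rightarrow> ('g \<Rightarrow> 'z \<Rightarrow> 'z) \<Rightarrow> 'g set \<Rightarrow> 'g set \<Rightarrow> 'z set \<Rightarrow> 'z set" where
  "quotient_action Z \<Gamma> \<phi> K C = (\<lambda>O\<^sub>K \<in> orbits (\<Gamma>\<lparr>carrier := K\<rparr>) Z \<phi>. \<Union>g\<in>C. \<phi> g ` O\<^sub>K)"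

definition quotient_projection :: "('z \<Rightarrow> 'x) \<Rightarrow> 'z set \<Rightarrow> 'x" where
  "quotient_projection f O\<^sub>K = the_elem (f ` O\<^sub>K)"


section \<open>Covers by continua\<close>

definition continuum :: "'a topology \<Rightarrow> bool" where
  "continuum X \<longleftrightarrow> compact_space X \<and> connected_space X \<and> metrizable_space X"

text \<open>The counterpart of \<^const>\<open>covering_space\<close> for abstract topologies.\<close>

definition covering_map :: "'y topology \<Rightarrow> 'x topology \<Rightarrow> ('y \<Rightarrow> 'x) \<Rightarrow> bool" where
  "covering_map Y X f \<longleftrightarrow>
     continuous_map Y X f \<and> f ` topspace Y = topspace X \<and>
     (\<forall>x\<in>topspace X. \<exists>T. x \<in> T \<and> openin X T \<and>
        (\<exists>\<V>. \<Union>\<V> = {y \<in> topspace Y. f y \<in> T} \<and>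
             (\<forall>V\<in>\<V>. openin Y V) \<and>
             pairwise disjnt \<V> \<and>
             (\<forall>V\<in>\<V>. homeomorphic_map (subtopology Y V) (subtopology X T) f)))"

definition regular_covering_map ::
    "'y topology \<Rightarrow> 'g monoid \<Rightarrow> ('g \<Rightarrow> 'y \<Rightarrow> 'y) \<Rightarrow> 'x topology \<Rightarrow> ('y \<Rightarrow> 'x) \<Rightarrow> bool" where
  "regular_covering_map Y G \<phi> X f \<longleftrightarrow>
     covering_map Y X f \<and>
     faithful_action G (topspace Y) \<phi> \<and>
     (\<forall>g\<in>carrier G. homeomorphic_map Y Y (\<phi> g)) \<and>
     (\<forall>g\<in>carrier G. \<forall>y\<in>topspace Y. \<phi> g y = y \<longrightarrow> g = \<one>\<^bsub>G\<^esub>) \<and>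
     quotient_map Y X f \<and>
     fibres_are_orbits (topspace Y) G \<phi> f"

record ('y, 'g, 'x) pointed_cover =
  cov_space :: "'y topology"
  cov_group :: "'g monoid"
  cov_act :: "'g \<Rightarrow> 'y \<Rightarrow> 'y"
  cov_map :: "'y \<Rightarrow> 'x"
  cov_base :: 'y

definition cover_by_continuum :: "'x topology \<Rightarrow> ('y, 'g, 'x) pointed_cover \<Rightarrow> bool" where
  "cover_by_continuum X C \<longleftrightarrow>
     continuum (cov_space C) \<and>
     regular_covering_map (cov_space C) (cov_group C) (cov_act C) X (cov_map C)"

definition equivalent_covers ::
    "('y, 'g, 'x) pointed_cover \<Rightarrow> ('z, 'h, 'x) pointed_cover \<Rightarrow> bool" where
  "equivalent_covers C D \<longleftrightarrow>
     equivalent_quotients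
       (compact_uniformity (cov_space C)) (cov_group C) (cov_act C) (cov_map C)
       (compact_uniformity (cov_space D)) (cov_group D) (cov_act D) (cov_map D)"

text \<open>
  \<open>(C i)\<close> for \<open>i \<in> I\<close> represents every equivalence class of covers of \<open>X\<close> by continua
  exactly once.  In the last clause covers range over one type only.  This loses nothing:
  a covering of \<open>X\<close> by a compact space has finite fibres, so its total space injects into
  \<open>'x \<times> nat\<close>, and a group of bijections of that space is a set of functions on it.
\<close>

definition all_covers_by_continua ::
    "'x topology \<Rightarrow> 'x \<Rightarrow> 'i set \<Rightarrow> ('i \<Rightarrow> ('y, 'g, 'x) pointed_cover) \<Rightarrow> bool" where
  "all_covers_by_continua X x\<^sub>0 I C \<longleftrightarrow>
     x\<^sub>0 \<in> topspace X \<and>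
     (\<forall>i\<in>I. cover_by_continuum X (C i) \<and>
            cov_base (C i) \<in> topspace (cov_space (C i)) \<and>
            cov_map (C i) (cov_base (C i)) = x\<^sub>0) \<and>
     (\<forall>i\<in>I. \<forall>j\<in>I. equivalent_covers (C i) (C j) \<longrightarrow> i = j) \<and>
     (\<forall>D :: ('x \<times> nat, 'x \<times> nat \<Rightarrow> 'x \<times> nat, 'x) pointed_cover.
        cover_by_continuum X D \<longrightarrow> (\<exists>i\<in>I. equivalent_covers (C i) D))"


section \<open>The compact universal cover\<close>

definition cover_morphism ::
    "('y, 'g, 'x) pointed_cover \<Rightarrow> ('z, 'h, 'x) pointed_cover \<Rightarrow> ('y \<Rightarrow> 'z) \<Rightarrow> bool" where
  "cover_morphism D C h \<longleftrightarrow>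
     continuous_map (cov_space D) (cov_space C) h \<and>
     h ` topspace (cov_space D) = topspace (cov_space C) \<and>
     (\<forall>y\<in>topspace (cov_space D). cov_map C (h y) = cov_map D y)"

definition cover_le ::
    "('y, 'g, 'x) pointed_cover \<Rightarrow> ('z, 'h, 'x) pointed_cover \<Rightarrow> bool" where
  "cover_le C D \<longleftrightarrow> (\<exists>h. cover_morphism D C h)"

text \<open>
  \<open>bonding_map C D\<close> goes from \<open>D\<close> to \<open>C\<close> when \<open>cover_le C D\<close>; extensionality makes the
  basepoint preserving morphism unique as a HOL function.
\<close>

definition bonding_map ::
    "('y, 'g, 'x) pointed_cover \<Rightarrow> ('z, 'h, 'x) pointed_cover \<Rightarrow> 'z \<Rightarrow> 'y" where
  "bonding_map C D =
     (THE h. h \<in> extensional (topspace (cov_space D)) \<and> cover_morphism D C h \<and>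
             h (cov_base D) = cov_base C)"

definition bonding_hom ::
    "('y, 'g, 'x) pointed_cover \<Rightarrow> ('z, 'h, 'x) pointed_cover \<Rightarrow> 'h \<Rightarrow> 'g" where
  "bonding_hom C D g =
     (THE g'. g' \<in> carrier (cov_group C) \<and>
        (\<forall>y\<in>topspace (cov_space D).
           cov_act C g' (bonding_map C D y) = bonding_map C D (cov_act D g y)))"

definition universal_space ::
    "'i set \<Rightarrow> ('i \<Rightarrow> ('y, 'g, 'x) pointed_cover) \<Rightarrow> ('i \<Rightarrow> 'y) topology" where
  "universal_space I C =
     subtopology (product_topology (\<lambda>i. cov_space (C i)) I)
       {x. \<forall>i\<in>I. \<forall>j\<in>I. cover_le (C i) (C j) \<longrightarrow> bonding_map (C i) (C j) (x j) = x i}"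

definition profinite_group ::
    "'i set \<Rightarrow> ('i \<Rightarrow> ('y, 'g, 'x) pointed_cover) \<Rightarrow> ('i \<Rightarrow> 'g) monoid" where
  "profinite_group I C =
     (product_group I (\<lambda>i. cov_group (C i)))
       \<lparr>carrier := {g \<in> (\<Pi>\<^sub>E i\<in>I. carrier (cov_group (C i))).
          \<forall>i\<in>I. \<forall>j\<in>I. cover_le (C i) (C j) \<longrightarrow> bonding_hom (C i) (C j) (g j) = g i}\<rparr>"

text \<open>The inverse limit topology, the (finite) deck groups being discrete.\<close>

definition profinite_topology ::
    "'i set \<Rightarrow> ('i \<Rightarrow> ('y, 'g, 'x) pointed_cover) \<Rightarrow> ('i \<Rightarrow> 'g) topology" where
  "profinite_topology I C =
     subtopology (product_topology (\<lambda>i. discrete_topology (carrier (cov_group (C i)))) I)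
       (carrier (profinite_group I C))"

definition universal_action ::
    "'i set \<Rightarrow> ('i \<Rightarrow> ('y, 'g, 'x) pointed_cover) \<Rightarrow> ('i \<Rightarrow> 'g) \<Rightarrow> ('i \<Rightarrow> 'y) \<Rightarrow> ('i \<Rightarrow> 'y)" where
  "universal_action I C g =
     (\<lambda>x \<in> topspace (universal_space I C). \<lambda>i\<in>I. cov_act (C i) (g i) (x i))"

text \<open>The value is the same for all \<open>i\<close>, as the order is directed.\<close>

definition universal_projection ::
    "'i set \<Rightarrow> ('i \<Rightarrow> ('y, 'g, 'x) pointed_cover) \<Rightarrow> ('i \<Rightarrow> 'y) \<Rightarrow> 'x" where
  "universal_projection I C x = (THE p. \<forall>i\<in>I. cov_map (C i) (x i) = p)"

definition universal_uniformity ::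
    "'i set \<Rightarrow> ('i \<Rightarrow> ('y, 'g, 'x) pointed_cover) \<Rightarrow> (('i \<Rightarrow> 'y) \<times> ('i \<Rightarrow> 'y)) set set" where
  "universal_uniformity I C = compact_uniformity (universal_space I C)"

abbreviation universal_quotient_uniformity where
  "universal_quotient_uniformity I C K \<equiv>
     quotient_uniformity (universal_uniformity I C) (profinite_group I C)
       (universal_action I C) K"

abbreviation universal_quotient_group where
  "universal_quotient_group I C K \<equiv> profinite_group I C Mod K"

abbreviation universal_quotient_action where
  "universal_quotient_action I C K \<equiv>
     quotient_action (topspace (universal_space I C)) (profinite_group I C)
       (universal_action I C) K"

abbreviation universal_quotient_projection where
  "universal_quotient_projection I C \<equiv> quotient_projection (universal_projection I C)"

end

theory Submission
  imports Defs
begin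


text \<open>
  On a compact metrizable space the entourages are just the symmetric neighbourhoods of
  the diagonal (\<open>uniform_structure_eq_diag_nhds\<close>).  So all uniform notions become
  topological ones, and a generalized regular covering \<open>Y \<rightarrow> X\<close> of
  continua is handled like an inverse limit of finite covers.

  Quotients.  If \<open>K\<close> is a normal subgroup of the deck group \<open>G\<close> whose
  orbits in \<open>Y\<close> are closed, then \<open>Y/K \<rightarrow> X\<close> is again a
  generalized regular covering by a compact metrizable space
  (\<open>quotient_prodiscrete_quotient\<close>).  Invariant entourages let chains in
  \<open>Y/K\<close> be lifted to \<open>Y\<close>, so the images of entourages form a
  uniformity; distances to the orbits give a metric on \<open>Y/K\<close>
  (\<open>metrizable_image_uniformity\<close>).  Completeness of the group follows from
  compactness and prodiscreteness (\<open>complete\<close>).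

  The universal cover.  Two covers of \<open>X\<close> by continua are dominated by a component
  of their fibre product (\<open>common_cover\<close>), and up to equivalence there are only
  countably many covers, because each of them is determined by finitely many members of a
  countable base together with the pattern in which their sheets meet
  (\<open>countable_covers\<close>).  Hence the inverse limit \<open>Z\<close> of all covers is
  a compact, connected, metrizable space, and its projection to \<open>X\<close> is a generalized
  regular covering (\<open>universal_prodiscrete_quotient\<close>).  A closed subgroup of the
  profinite fundamental group is compact and so has closed orbits; the result on quotients
  gives the converse half of the theorem.

  Coverings as quotients of \<open>Z\<close>.  For an invariant entourage \<open>F\<close> of
  \<open>Y\<close> let \<open>N\<^bsub>F\<^esub>(G)\<close> be the subgroup generated by
  the elements that move some point by less than \<open>F\<close>.  In
  \<open>Y/N\<^bsub>F\<^esub>(G)\<close> distinct points of one fibre are no longer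
  \<open>F\<close>-close, so \<open>Y/N\<^bsub>F\<^esub>(G) \<rightarrow> X\<close> is an
  ordinary cover by a continuum (\<open>N_quotient_cover\<close>) and therefore one of those in
  the definition of \<open>Z\<close>, up to equivalence (\<open>equivalent_cover_exists\<close>).
  This gives maps from \<open>Z\<close> to all \<open>Y/N\<^bsub>F\<^esub>(G)\<close>, which
  unique lifting makes compatible.  By prodiscreteness these quotients converge to
  \<open>Y\<close> as \<open>F\<close> shrinks, so the maps have a limit \<open>Z \<rightarrow>
  Y\<close>, a continuous surjection over \<open>X\<close> (\<open>limit_exists\<close>,
  \<open>limit_continuous\<close>, \<open>limit_onto\<close>).  It induces a surjection of the
  profinite fundamental group onto \<open>G\<close>.  The fibres of the limit map are the
  orbits of the kernel \<open>K\<close> of this homomorphism, so \<open>Y\<close> is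
  \<open>Z/K\<close> and \<open>G\<close> is the quotient group
  (\<open>equivalent_to_quotient\<close>).
\<close>

section \<open>The uniformity of a compact metrizable space\<close>

text \<open>
  The symmetric neighbourhoods of the diagonal in the product topology of \<open>X \<times>
  X\<close>.
\<close>

definition diag_nhds :: "'a topology \<Rightarrow> ('a \<times> 'a) set set" where
  "diag_nhds X = {E. E \<subseteq> topspace X \<times> topspace X \<and> sym E \<and>
     (\<forall>x\<in>topspace X. \<exists>V. openin X V \<and> x \<in> V \<and> V \<times> V \<subseteq> E)}"

lemma compact_space_finite_subcover:
  assumes "compact_space X" "\<And>x. x \<in> topspace X \<Longrightarrow> openin X (W x) \<and> x \<in> W x"
  obtains A where "A \<subseteq> topspace X" "finite A" "topspace X \<subseteq> (\<Union>x\<in>A. W x)"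
proof -
  have W: "openin X (W x)" "x \<in> W x" if "x \<in> topspace X" for x using assms(2)[OF that] by simp_all
  have 1: "\<forall>B\<in>W ` topspace X. openin X B" using W(1) by simp
  have 2: "\<Union>(W ` topspace X) = topspace X" using W openin_subset by fast
  obtain \<F> where F: "finite \<F>" "\<F> \<subseteq> W ` topspace X" "\<Union>\<F> = topspace X"
    using assms(1)[unfolded compact_space] 1 2 by metis
  obtain A where "A \<subseteq> topspace X" "finite A" "\<F> = W ` A"
    using finite_subset_image[OF F(1,2)] by metis
  then show ?thesis using that[of A] F(3) by simp
qed

lemma diag_nhdsI:
  assumes "E \<subseteq> topspace X \<times> topspace X" "sym E"
    and "\<And>x. x \<in> topspace X \<Longrightarrow> \<exists>V. openin X V \<and> x \<in> V \<and> V \<times> V \<subseteq> E"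
  shows "E \<in> diag_nhds X"
  using assms by (simp add: diag_nhds_def)

lemma diag_nhds_D:
  assumes "E \<in> diag_nhds X"
  shows "E \<subseteq> topspace X \<times> topspace X" "sym E"
    "x \<in> topspace X \<Longrightarrow> \<exists>V. openin X V \<and> x \<in> V \<and> V \<times> V \<subseteq> E"
    "x \<in> topspace X \<Longrightarrow> (x, x) \<in> E"
proof -
  have *: "E \<subseteq> topspace X \<times> topspace X \<and> sym E \<and>
     (\<forall>x\<in>topspace X. \<exists>V. openin X V \<and> x \<in> V \<and> V \<times> V \<subseteq> E)"
    using assms unfolding diag_nhds_def by (rule CollectD)
  show "E \<subseteq> topspace X \<times> topspace X" "sym E" using * by metis+
  show nhd: "\<exists>V. openin X V \<and> x \<in> V \<and> V \<times> V \<subseteq> E" if "x \<in> topspace X"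
    using * that by metis
  show "(x, x) \<in> E" if "x \<in> topspace X"
    using nhd[OF that] by blast
qed

lemma diag_nhds_Int: "E \<in> diag_nhds X \<Longrightarrow> F \<in> diag_nhds X \<Longrightarrow> E \<inter> F \<in> diag_nhds X"
proof -
  assume E: "E \<in> diag_nhds X" and F: "F \<in> diag_nhds X"
  have "\<exists>V. openin X V \<and> x \<in> V \<and> V \<times> V \<subseteq> E \<inter> F" if x: "x \<in> topspace X" for x
  proof -
    obtain V W where "openin X V" "x \<in> V" "V \<times> V \<subseteq> E" "openin X W" "x \<in> W" "W \<times> W \<subseteq> F"
      using diag_nhds_D(3)[OF E x] diag_nhds_D(3)[OF F x] by blast
    then show ?thesis by (intro exI[of _ "V \<inter> W"]) auto
  qed
  then show ?thesis
    using diag_nhds_D(1,2)[OF E] diag_nhds_D(1,2)[OF F]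
    unfolding diag_nhds_def by (auto intro: sym_Int)
qed

lemma diag_nhds_mono:
  "E \<in> diag_nhds X \<Longrightarrow> E \<subseteq> F \<Longrightarrow> F \<subseteq> topspace X \<times> topspace X \<Longrightarrow> sym F \<Longrightarrow> F \<in> diag_nhds X"
proof (rule diag_nhdsI)
  fix x assume E: "E \<in> diag_nhds X" "E \<subseteq> F" and x: "x \<in> topspace X"
  obtain V where "openin X V" "x \<in> V" "V \<times> V \<subseteq> E" using diag_nhds_D(3)[OF E(1) x] by blast
  then show "\<exists>V. openin X V \<and> x \<in> V \<and> V \<times> V \<subseteq> F" using E(2) by (intro exI[of _ V]) simp
qed

text \<open>
  The number \<open>e\<close> is a Lebesgue number of the cover by those open sets whose
  square lies in the neighbourhood.
\<close>

lemma compact_metrizable_diag_nhds: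
  assumes "compact_space (Metric_space.mtopology M d)" "Metric_space M d"
    and E: "E \<in> diag_nhds (Metric_space.mtopology M d)"
  shows "\<exists>e>0. \<forall>x\<in>M. \<exists>V. openin (Metric_space.mtopology M d) V \<and> V \<times> V \<subseteq> E \<and> Metric_space.mball M d x e \<subseteq> V"
proof -
  interpret Metric_space M d by fact
  have "\<forall>x\<in>M. \<exists>V r. openin mtopology V \<and> V \<times> V \<subseteq> E \<and> r > 0 \<and> mball x (2*r) \<subseteq> V"
  proof
    fix x assume "x \<in> M"
    then obtain V where V: "openin mtopology V" "x \<in> V" "V \<times> V \<subseteq> E"
      using diag_nhds_D(3)[OF E, of x] by auto
    then obtain r where "r > 0" "mball x r \<subseteq> V"
      unfolding openin_mtopology by blast
    then have "r / 2 > 0" "mball x (2 * (r/2)) \<subseteq> V" by simp_all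
    then show "\<exists>V r. openin mtopology V \<and> V \<times> V \<subseteq> E \<and> r > 0 \<and> mball x (2*r) \<subseteq> V"
      using V by blast
  qed
  then obtain V r where Vr: "\<And>x. x \<in> M \<Longrightarrow> openin mtopology (V x) \<and> V x \<times> V x \<subseteq> E \<and> r x > 0 \<and> mball x (2 * r x) \<subseteq> V x"
    by metis
  obtain A where A: "A \<subseteq> M" "finite A" "M \<subseteq> (\<Union>x\<in>A. mball x (r x))"
  proof (rule compact_space_finite_subcover[OF assms(1), of "\<lambda>x. mball x (r x)"])
    fix x assume "x \<in> topspace mtopology"
    then show "openin mtopology (mball x (r x)) \<and> x \<in> mball x (r x)" using Vr[of x] by simp
  qed simp
  \<comment> \<open>The \<open>1\<close> keeps the minimum meaningful if \<open>A\<close> is empty.\<close>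
  define e where "e = Min (insert 1 (r ` A))"
  have e: "e > 0" "\<And>x. x \<in> A \<Longrightarrow> e \<le> r x"
    using A Vr unfolding e_def by (auto simp: Min_gr_iff)
  have "\<exists>V. openin mtopology V \<and> V \<times> V \<subseteq> E \<and> mball y e \<subseteq> V" if y: "y \<in> M" for y
  proof -
    obtain x where x: "x \<in> A" "y \<in> mball x (r x)" using A(3) y by blast
    have "mball y e \<subseteq> mball x (2 * r x)"
    proof
      fix z assume "z \<in> mball y e"
      then have "d x z \<le> d x y + d y z" "d x y < r x" "d y z < e" "z \<in> M" "x \<in> M"
        using x triangle by auto
      then show "z \<in> mball x (2 * r x)" using e(2)[OF x(1)] by auto
    qed
    then show ?thesis using Vr[of x] x A by blast
  qed
  then show ?thesis using e by blast
qed

lemma metric_entourage: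
  assumes "Metric_space M d" "e > 0"
  shows "{(x, y). x \<in> M \<and> y \<in> M \<and> d x y < e} \<in> diag_nhds (Metric_space.mtopology M d)"
proof -
  interpret Metric_space M d by fact
  have "\<exists>V. openin mtopology V \<and> x \<in> V \<and> V \<times> V \<subseteq> {(x, y). x \<in> M \<and> y \<in> M \<and> d x y < e}" if "x \<in> M" for x
  proof (intro exI conjI)
    show "openin mtopology (mball x (e/2))" by simp
    show "x \<in> mball x (e/2)" using that assms by simp
    show "mball x (e/2) \<times> mball x (e/2) \<subseteq> {(x, y). x \<in> M \<and> y \<in> M \<and> d x y < e}"
    proof clarify
      fix a b assume "a \<in> mball x (e/2)" "b \<in> mball x (e/2)"
      then have "a \<in> M" "b \<in> M" "d x a < e/2" "d x b < e/2" by auto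
      then show "a \<in> M \<and> b \<in> M \<and> d a b < e" using triangle[of a x b] commute[of x a] that by simp
    qed
  qed
  then show ?thesis by (intro diag_nhdsI) (auto simp: sym_def commute)
qed

text \<open>
  Two points that are closer than a Lebesgue number to a third one lie with it in one set
  \<open>V\<close> of the cover, hence the pair they form lies in \<open>V \<times>
  V\<close>.
\<close>

lemma diag_nhds_half:
  assumes "compact_space X" "metrizable_space X" "E \<in> diag_nhds X"
  shows "\<exists>F\<in>diag_nhds X. F O F \<subseteq> E"
proof -
  obtain M d where M: "Metric_space M d" and X: "X = Metric_space.mtopology M d"
    using assms(2) unfolding metrizable_space_def by blast
  interpret Metric_space M d by fact
  obtain e where e: "e > 0" "\<And>x. x \<in> M \<Longrightarrow> \<exists>V. openin mtopology V \<and> V \<times> V \<subseteq> E \<and> mball x e \<subseteq> V"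
    using compact_metrizable_diag_nhds[of M d E] assms X M by metis
  define F where "F = {(x, y). x \<in> M \<and> y \<in> M \<and> d x y < e}"
  have "F \<in> diag_nhds X"
    unfolding F_def X by (rule metric_entourage) (use e M in auto)
  moreover have "F O F \<subseteq> E"
  proof clarify
    fix a b c assume "(a, b) \<in> F" "(b, c) \<in> F"
    then have "b \<in> M" "a \<in> mball b e" "c \<in> mball b e" by (auto simp: F_def commute)
    then show "(a, c) \<in> E" using e(2)[of b] by blast
  qed
  ultimately show ?thesis by blast
qed

lemma diag_nhds_third:
  assumes "compact_space X" "metrizable_space X" "E \<in> diag_nhds X"
  shows "\<exists>F\<in>diag_nhds X. F O F O F \<subseteq> E"
proof -
  obtain F G where F: "F \<in> diag_nhds X" "F O F \<subseteq> E" and G: "G \<in> diag_nhds X" "G O G \<subseteq> F"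
    using diag_nhds_half[OF assms(1,2)] assms(3) by metis
  have "G \<subseteq> G O G" using diag_nhds_D(4)[OF G(1)] diag_nhds_D(1)[OF G(1)] by fastforce
  then show ?thesis using F G by (intro bexI[of _ G]) blast
qed

lemma diag_nhds_total: "topspace X \<times> topspace X \<in> diag_nhds X"
  by (rule diag_nhdsI) (auto simp: sym_def)

lemma ucarrier_diag_nhds: "ucarrier (diag_nhds X) = topspace X"
proof -
  have "topspace X \<times> topspace X \<in> diag_nhds X" by (rule diag_nhds_total)
  then have "topspace X \<subseteq> ucarrier (diag_nhds X)" by (auto simp: ucarrier_def Field_def)
  moreover have "ucarrier (diag_nhds X) \<subseteq> topspace X"
    using diag_nhds_D(1) by (fastforce simp: ucarrier_def Field_def)
  ultimately show ?thesis by blast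
qed

lemma uniform_structure_diag_nhds:
  assumes "compact_space X" "metrizable_space X"
  shows "uniform_structure (diag_nhds X)"
  unfolding uniform_structure_def ucarrier_diag_nhds
proof (intro conjI ballI allI impI)
  show "diag_nhds X \<noteq> {}"
    using diag_nhds_total by blast
  fix E assume E: "E \<in> diag_nhds X"
  show "Id_on (topspace X) \<subseteq> E" "sym E" using diag_nhds_D[OF E] by auto
  show "\<exists>F\<in>diag_nhds X. F O F \<subseteq> E" by (rule diag_nhds_half) fact+
  show "E \<inter> F \<in> diag_nhds X" if "F \<in> diag_nhds X" for F using diag_nhds_Int E that by blast
  show "F \<in> diag_nhds X" if "E \<subseteq> F \<and> F \<subseteq> topspace X \<times> topspace X \<and> sym F" for F
    using that by (intro diag_nhds_mono[OF E]) simp_all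
qed

lemma utopology_diag_nhds:
  assumes "compact_space X" "metrizable_space X"
  shows "utopology (diag_nhds X) = X"
proof -
  note op = openin_utopology[OF uniform_structure_diag_nhds[OF assms], unfolded ucarrier_diag_nhds]
  have "openin X V" if V: "openin (utopology (diag_nhds X)) V" for V
  proof (subst openin_subopen, intro ballI)
    fix x assume x: "x \<in> V"
    then obtain E where E: "E \<in> diag_nhds X" "E `` {x} \<subseteq> V" and xX: "x \<in> topspace X"
      using V unfolding op by blast
    obtain W where "openin X W" "x \<in> W" "W \<times> W \<subseteq> E"
      using diag_nhds_D(3)[OF E(1) xX] by blast
    then show "\<exists>T. openin X T \<and> x \<in> T \<and> T \<subseteq> V" using E(2) by blast
  qed
  moreover have "openin (utopology (diag_nhds X)) V" if V: "openin X V" for V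
    unfolding op
  proof (intro conjI ballI)
    show "V \<subseteq> topspace X" using V openin_subset by blast
    fix x assume x: "x \<in> V"
    have t1: "openin X (topspace X - {x})"
      using assms(2) metrizable_imp_t1_space t1_space_openin_delete_alt openin_topspace by metis
    define E where "E = V \<times> V \<union> (topspace X - {x}) \<times> (topspace X - {x})"
    have "\<exists>W. openin X W \<and> y \<in> W \<and> W \<times> W \<subseteq> E" if y: "y \<in> topspace X" for y
    proof (cases "y = x")
      case True then show ?thesis using V x by (intro exI[of _ V]) (auto simp: E_def)
    next
      case False then show ?thesis using t1 y by (intro exI[of _ "topspace X - {x}"]) (auto simp: E_def)
    qed
    then have "E \<in> diag_nhds X"
      using openin_subset[OF V] by (intro diag_nhdsI) (auto simp: E_def sym_def)
    moreover have "E `` {x} \<subseteq> V" by (auto simp: E_def)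
    ultimately show "\<exists>E\<in>diag_nhds X. E `` {x} \<subseteq> V" by blast
  qed
  ultimately show ?thesis unfolding topology_eq by blast
qed

lemma uniform_structure_D:
  assumes "uniform_structure U" "E \<in> U"
  shows "x \<in> ucarrier U \<Longrightarrow> (x, x) \<in> E" "sym E" "\<exists>F\<in>U. F O F \<subseteq> E"
    "F \<in> U \<Longrightarrow> E \<inter> F \<in> U" "E \<subseteq> F \<Longrightarrow> F \<subseteq> ucarrier U \<times> ucarrier U \<Longrightarrow> sym F \<Longrightarrow> F \<in> U"
    "E \<subseteq> ucarrier U \<times> ucarrier U"
  using assms unfolding uniform_structure_def by (blast, blast, blast, blast, blast)
    (use assms in \<open>fastforce simp: ucarrier_def Field_def\<close>)

lemma topspace_utopology:
  assumes "uniform_structure U" shows "topspace (utopology U) = ucarrier U"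
proof -
  obtain E where "E \<in> U" using assms by (auto simp: uniform_structure_def)
  then have "openin (utopology U) (ucarrier U)"
    using uniform_structure_D(6)[OF assms] by (auto simp: openin_utopology[OF assms])
  then show ?thesis by (metis openin_utopology[OF assms] openin_subset openin_topspace subset_antisym)
qed

lemma utopology_nhd:
  assumes U: "uniform_structure U" and E: "E \<in> U" and x: "x \<in> ucarrier U"
  shows "\<exists>V. openin (utopology U) V \<and> x \<in> V \<and> V \<subseteq> E `` {x}"
proof (intro exI conjI)
  let ?V = "{y \<in> ucarrier U. \<exists>F\<in>U. F `` {y} \<subseteq> E `` {x}}"
  show "openin (utopology U) ?V"
    unfolding openin_utopology[OF U]
  proof (intro conjI ballI)
    fix y assume "y \<in> ?V"
    then obtain F where F: "F \<in> U" "F `` {y} \<subseteq> E `` {x}" by blast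
    obtain H where H: "H \<in> U" "H O H \<subseteq> F" using uniform_structure_D(3)[OF U F(1)] by blast
    have "H `` {y} \<subseteq> ?V"
      using H F uniform_structure_D(6)[OF U H(1)] by blast
    then show "\<exists>E\<in>U. E `` {y} \<subseteq> ?V" using H by blast
  qed auto
  show "x \<in> ?V" using E x by blast
  show "?V \<subseteq> E `` {x}" using uniform_structure_D(1)[OF U] by blast
qed

text \<open>
  A compact space has only one uniformity.  Entourages are neighbourhoods of the diagonal
  because \<open>F\<^bsub>x\<^esub> \<times> F\<^bsub>x\<^esub> \<subseteq> E\<close> when
  \<open>F \<circ> F \<subseteq> E\<close>.  Conversely, a neighbourhood of the diagonal
  contains, over each member of a finite open cover, an entourage; the intersection of these
  finitely many entourages lies in it.
\<close>

lemma uniform_structure_eq_diag_nhds: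
  assumes U: "uniform_structure U" and comp: "compact_space (utopology U)"
  shows "U = diag_nhds (utopology U)"
proof (rule equalityI; rule subsetI)
  note ts = topspace_utopology[OF U]
  fix E assume E: "E \<in> U"
  have "\<exists>V. openin (utopology U) V \<and> x \<in> V \<and> V \<times> V \<subseteq> E" if x: "x \<in> ucarrier U" for x
  proof -
    obtain F where F: "F \<in> U" "F O F \<subseteq> E" using uniform_structure_D(3)[OF U E] by blast
    obtain V where V: "openin (utopology U) V" "x \<in> V" "V \<subseteq> F `` {x}"
      using utopology_nhd[OF U F(1) x] by blast
    have "V \<times> V \<subseteq> E"
    proof clarify
      fix a b assume "a \<in> V" "b \<in> V"
      then have "(a, x) \<in> F" "(x, b) \<in> F" using V uniform_structure_D(2)[OF U F(1)] by (auto dest: symD)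
      then show "(a, b) \<in> E" using F by blast
    qed
    then show ?thesis using V by blast
  qed
  then show "E \<in> diag_nhds (utopology U)"
    using uniform_structure_D(2,6)[OF U E] by (intro diag_nhdsI) (simp_all add: ts)
next
  note ts = topspace_utopology[OF U]
  fix E assume E: "E \<in> diag_nhds (utopology U)"
  have "\<exists>F W. F \<in> U \<and> openin (utopology U) W \<and> x \<in> W \<and> (\<forall>a\<in>W. \<forall>b. (a, b) \<in> F \<longrightarrow> (a, b) \<in> E)" if x: "x \<in> ucarrier U" for x
  proof -
    obtain V where V: "openin (utopology U) V" "x \<in> V" "V \<times> V \<subseteq> E"
      using diag_nhds_D(3)[OF E] x ts by metis
    obtain F where F: "F \<in> U" "F `` {x} \<subseteq> V" using V openin_utopology[OF U] by metis
    obtain H where H: "H \<in> U" "H O H \<subseteq> F" using uniform_structure_D(3)[OF U F(1)] by blast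
    obtain W where W: "openin (utopology U) W" "x \<in> W" "W \<subseteq> H `` {x}"
      using utopology_nhd[OF U H(1) x] by blast
    have "(a, b) \<in> E" if "a \<in> W" "(a, b) \<in> H" for a b
    proof -
      have "(x, a) \<in> H" "a \<in> ucarrier U" using W that uniform_structure_D(6)[OF U H(1)] by auto
      then have "(x, b) \<in> F" "(x, a) \<in> F"
        using that(2) H(2) uniform_structure_D(1)[OF U H(1)] by blast+
      then show ?thesis using F V by blast
    qed
    then show ?thesis using H W by blast
  qed
  then obtain F W where FW: "\<And>x. x \<in> ucarrier U \<Longrightarrow> F x \<in> U \<and> openin (utopology U) (W x) \<and> x \<in> W x \<and> (\<forall>a\<in>W x. \<forall>b. (a, b) \<in> F x \<longrightarrow> (a, b) \<in> E)"
    by metis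
  obtain A where A: "A \<subseteq> ucarrier U" "finite A" "ucarrier U \<subseteq> (\<Union>x\<in>A. W x)"
    using compact_space_finite_subcover[OF comp, of W] FW unfolding ts by blast
  obtain E0 where E0: "E0 \<in> U" using U by (auto simp: uniform_structure_def)
  have "A' \<subseteq> A \<Longrightarrow> E0 \<inter> (\<Inter>x\<in>A'. F x) \<in> U" if "finite A'" for A' using that
  proof (induction A')
    case empty then show ?case using E0 by simp
  next
    case (insert x A')
    then have "E0 \<inter> (\<Inter>x\<in>A'. F x) \<in> U" "F x \<in> U" using FW A by auto
    then have "(E0 \<inter> (\<Inter>x\<in>A'. F x)) \<inter> F x \<in> U" using uniform_structure_D(4)[OF U] by blast
    then show ?case by (simp add: Int_ac)
  qed
  then have G: "E0 \<inter> (\<Inter>x\<in>A. F x) \<in> U" using A by blast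
  have "E0 \<inter> (\<Inter>x\<in>A. F x) \<subseteq> E"
  proof clarify
    fix a b assume ab: "(a, b) \<in> E0" "(a, b) \<in> (\<Inter>x\<in>A. F x)"
    then have "a \<in> ucarrier U" using uniform_structure_D(6)[OF U E0] by blast
    then obtain x where "x \<in> A" "a \<in> W x" using A by blast
    then show "(a, b) \<in> E" using FW[of x] A ab by blast
  qed
  then show "E \<in> U" using uniform_structure_D(5)[OF U G, of E] diag_nhds_D(1,2)[OF E] ts by auto
qed

lemma compact_uniformity_eq:
  assumes "compact_space X" "metrizable_space X"
  shows "compact_uniformity X = diag_nhds X"
  unfolding compact_uniformity_def
proof (rule the_equality)
  show "uniform_structure (diag_nhds X) \<and> utopology (diag_nhds X) = X"
    using uniform_structure_diag_nhds[OF assms] utopology_diag_nhds[OF assms] by simp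
  fix U assume U: "uniform_structure U \<and> utopology U = X"
  then show "U = diag_nhds X" using uniform_structure_eq_diag_nhds[of U] assms(1) by metis
qed

lemma preimage_diag_nhds:
  assumes "continuous_map X Y h" "F \<in> diag_nhds Y"
  shows "{(x, y) \<in> topspace X \<times> topspace X. (h x, h y) \<in> F} \<in> diag_nhds X"
proof -
  have "\<exists>V. openin X V \<and> x \<in> V \<and> V \<times> V \<subseteq> {(x, y) \<in> topspace X \<times> topspace X. (h x, h y) \<in> F}"
    if x: "x \<in> topspace X" for x
  proof -
    have "h x \<in> topspace Y" using x assms(1) continuous_map_image_subset_topspace by blast
    then obtain V where V: "openin Y V" "h x \<in> V" "V \<times> V \<subseteq> F" using diag_nhds_D(3)[OF assms(2)] by metis
    have "openin X {x \<in> topspace X. h x \<in> V}" using assms(1) V openin_continuous_map_preimage by blast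
    then show ?thesis using V x by (intro exI[of _ "{x \<in> topspace X. h x \<in> V}"]) auto
  qed
  moreover have "sym {(x, y) \<in> topspace X \<times> topspace X. (h x, h y) \<in> F}"
    using diag_nhds_D(2)[OF assms(2)] by (auto simp: sym_def)
  ultimately show ?thesis by (intro diag_nhdsI) auto
qed

lemma continuous_imp_uniformly_continuous_map:
  assumes "compact_space X" "metrizable_space X" "compact_space Y" "metrizable_space Y" "continuous_map X Y h"
  shows "uniformly_continuous_map (compact_uniformity X) (compact_uniformity Y) h"
  using preimage_diag_nhds[OF assms(5)] continuous_map_funspace[OF assms(5)]
  unfolding Defs.uniformly_continuous_map_def compact_uniformity_eq[OF assms(1,2)] compact_uniformity_eq[OF assms(3,4)]
    ucarrier_diag_nhds by simp

lemma uniformly_continuous_imp_continuous_map: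
  assumes "uniform_structure U" "uniform_structure V" "uniformly_continuous_map U V h"
  shows "continuous_map (utopology U) (utopology V) h"
  unfolding continuous_map_def topspace_utopology[OF assms(1)] topspace_utopology[OF assms(2)]
proof (intro conjI allI impI)
  show "h \<in> ucarrier U \<rightarrow> ucarrier V" using assms(3) by (auto simp: uniformly_continuous_map_def)
  fix W assume W: "openin (utopology V) W"
  show "openin (utopology U) {x \<in> ucarrier U. h x \<in> W}"
    unfolding openin_utopology[OF assms(1)]
  proof (intro conjI ballI)
    fix x assume "x \<in> {x \<in> ucarrier U. h x \<in> W}"
    then obtain F where F: "F \<in> V" "F `` {h x} \<subseteq> W" using W openin_utopology[OF assms(2)] by auto
    let ?E = "{(x, y) \<in> ucarrier U \<times> ucarrier U. (h x, h y) \<in> F}"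
    have "?E \<in> U" using assms(3) F by (auto simp: uniformly_continuous_map_def)
    moreover have "?E `` {x} \<subseteq> {x \<in> ucarrier U. h x \<in> W}" using F by auto
    ultimately show "\<exists>E\<in>U. E `` {x} \<subseteq> {x \<in> ucarrier U. h x \<in> W}" by blast
  qed auto
qed

lemma uniform_homeomorphism_iff:
  assumes X: "compact_space X" "metrizable_space X" and Y: "compact_space Y" "metrizable_space Y"
  shows "uniform_homeomorphism (compact_uniformity X) (compact_uniformity Y) h \<longleftrightarrow> homeomorphic_map X Y h"
proof
  note uX = uniform_structure_diag_nhds[OF X] and uY = uniform_structure_diag_nhds[OF Y]
  assume h: "uniform_homeomorphism (compact_uniformity X) (compact_uniformity Y) h"
  have c: "continuous_map X Y h"
    using uniformly_continuous_imp_continuous_map[OF uX uY, of h] h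
    unfolding uniform_homeomorphism_def compact_uniformity_eq[OF X] compact_uniformity_eq[OF Y]
      utopology_diag_nhds[OF X] utopology_diag_nhds[OF Y] by blast
  have "h ` topspace X = topspace Y" "inj_on h (topspace X)"
    using h unfolding uniform_homeomorphism_def compact_uniformity_eq[OF X] compact_uniformity_eq[OF Y]
      ucarrier_diag_nhds bij_betw_def by auto
  then show "homeomorphic_map X Y h"
    using c continuous_imp_homeomorphic_map X Y metrizable_imp_Hausdorff_space by blast
next
  assume h: "homeomorphic_map X Y h"
  have bij: "bij_betw h (topspace X) (topspace Y)"
    using h by (metis bij_betw_def homeomorphic_imp_injective_map homeomorphic_imp_surjective_map)
  obtain g where g: "homeomorphic_maps X Y h g" using h homeomorphic_map_maps by blast
  then have "continuous_map Y X g" "\<And>y. y \<in> topspace Y \<Longrightarrow> h (g y) = y \<and> g y \<in> topspace X"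
    by (auto simp: homeomorphic_maps_def continuous_map_def)
  moreover have "inv_into (topspace X) h y = g y" if "y \<in> topspace Y" for y
    using that calculation(2) bij by (metis bij_betw_def inv_into_f_f)
  ultimately have "continuous_map Y X (inv_into (topspace X) h)"
    by (metis continuous_map_eq)
  then show "uniform_homeomorphism (compact_uniformity X) (compact_uniformity Y) h"
    unfolding uniform_homeomorphism_def
    using continuous_imp_uniformly_continuous_map[OF X Y] continuous_imp_uniformly_continuous_map[OF Y X]
      homeomorphic_imp_continuous_map[OF h] bij compact_uniformity_eq[OF X] compact_uniformity_eq[OF Y]
    by (simp add: ucarrier_diag_nhds)
qed


section \<open>Quotients of compact metrizable spaces by isomorphic actions\<close>

lemma compact_space_image:
  assumes "compact_space X" "continuous_map X Y f" "f ` topspace X = topspace Y"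
  shows "compact_space Y"
  using image_compactin[of X "topspace X" Y f] assms by (simp add: compact_space_def)

lemma connected_space_image:
  assumes "connected_space X" "continuous_map X Y f" "f ` topspace X = topspace Y"
  shows "connected_space Y"
  using connectedin_continuous_map_image[of X Y f "topspace X"] assms
  by (simp add: connectedin_topspace)

text \<open>
  Membership in the image uniformity can be tested on preimages, since an entourage may be
  enlarged to the full preimage of its image.
\<close>

lemma image_uniformity_iff:
  "W \<in> image_uniformity f (diag_nhds Y) \<longleftrightarrow>
     W \<subseteq> f ` topspace Y \<times> f ` topspace Y \<and> sym W \<and>
     {(x, y) \<in> topspace Y \<times> topspace Y. (f x, f y) \<in> W} \<in> diag_nhds Y" (is "_ \<longleftrightarrow> _ \<and> _ \<and> ?P W \<in> _")
proof
  assume "W \<in> image_uniformity f (diag_nhds Y)"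
  then obtain E where E: "E \<in> diag_nhds Y" and W: "W = map_prod f f ` E"
    by (auto simp: image_uniformity_def)
  note D = diag_nhds_D(1,2)[OF E]
  have 1: "W \<subseteq> f ` topspace Y \<times> f ` topspace Y" using W D(1) by auto
  have 2: "sym W"
  proof (rule symI)
    fix a b assume "(a, b) \<in> W"
    then obtain x y where "(x, y) \<in> E" "a = f x" "b = f y" using W by auto
    then have "(y, x) \<in> E" using D(2) by (meson symD)
    then show "(b, a) \<in> W" using W \<open>a = f x\<close> \<open>b = f y\<close> by (auto intro!: image_eqI[of _ _ "(y, x)"])
  qed
  have "E \<subseteq> ?P W" using D(1) W by auto
  moreover have "sym (?P W)" using 2 by (auto simp: sym_def)
  ultimately have "?P W \<in> diag_nhds Y" by (intro diag_nhds_mono[OF E]) auto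
  then show "W \<subseteq> f ` topspace Y \<times> f ` topspace Y \<and> sym W \<and> ?P W \<in> diag_nhds Y" using 1 2 by simp
next
  assume *: "W \<subseteq> f ` topspace Y \<times> f ` topspace Y \<and> sym W \<and> ?P W \<in> diag_nhds Y"
  have "W = map_prod f f ` ?P W"
  proof (rule equalityI; rule subsetI)
    fix p assume p: "p \<in> W"
    then obtain x y where "x \<in> topspace Y" "y \<in> topspace Y" "p = (f x, f y)" using * by auto
    then show "p \<in> map_prod f f ` ?P W" using p by (intro image_eqI[of _ _ "(x, y)"]) auto
  qed auto
  then show "W \<in> image_uniformity f (diag_nhds Y)" using * unfolding image_uniformity_def by blast
qed

lemma ucarrier_image_uniformity: "ucarrier (image_uniformity f (diag_nhds Y)) = f ` topspace Y"
proof
  have "map_prod f f ` (topspace Y \<times> topspace Y) \<in> image_uniformity f (diag_nhds Y)"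
    unfolding image_uniformity_def by (rule imageI) (rule diag_nhds_total)
  moreover have "map_prod f f ` (topspace Y \<times> topspace Y) = f ` topspace Y \<times> f ` topspace Y"
    by (rule map_prod_surj_on) auto
  ultimately show "f ` topspace Y \<subseteq> ucarrier (image_uniformity f (diag_nhds Y))"
    by (auto simp: ucarrier_def Field_def)
  show "ucarrier (image_uniformity f (diag_nhds Y)) \<subseteq> f ` topspace Y"
  proof
    fix x assume "x \<in> ucarrier (image_uniformity f (diag_nhds Y))"
    then obtain W y where "W \<in> image_uniformity f (diag_nhds Y)" "(x, y) \<in> W \<or> (y, x) \<in> W"
      unfolding ucarrier_def Field_def by blast
    then show "x \<in> f ` topspace Y" using image_uniformity_iff[of W f Y] by blast
  qed
qed

text \<open>
  The existence of half-size entourages is the only axiom that a quotient may violate; the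
  others pass to images through preimages.
\<close>

lemma uniform_structure_image_uniformity:
  assumes "\<And>E. E \<in> diag_nhds Y \<Longrightarrow> \<exists>F\<in>diag_nhds Y. map_prod f f ` F O map_prod f f ` F \<subseteq> map_prod f f ` E"
  shows "uniform_structure (image_uniformity f (diag_nhds Y))"
  unfolding uniform_structure_def ucarrier_image_uniformity
proof (intro conjI ballI allI impI)
  let ?U = "image_uniformity f (diag_nhds Y)"
  show "?U \<noteq> {}" using diag_nhds_total[of Y] unfolding image_uniformity_def by auto
  fix W assume W: "W \<in> ?U"
  note D = W[unfolded image_uniformity_iff]
  show "Id_on (f ` topspace Y) \<subseteq> W"
  proof
    fix p assume "p \<in> Id_on (f ` topspace Y)"
    then obtain y where "y \<in> topspace Y" "p = (f y, f y)" by auto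
    moreover have "(y, y) \<in> {(x, y) \<in> topspace Y \<times> topspace Y. (f x, f y) \<in> W}"
      using D calculation by (intro diag_nhds_D(4)[of _ Y]) simp_all
    ultimately show "p \<in> W" by simp
  qed
  show "sym W" using D by simp
  show "\<exists>F\<in>?U. F O F \<subseteq> W"
  proof -
    obtain E where E: "E \<in> diag_nhds Y" "W = map_prod f f ` E" using W by (auto simp: image_uniformity_def)
    obtain F where "F \<in> diag_nhds Y" "map_prod f f ` F O map_prod f f ` F \<subseteq> W" using assms[OF E(1)] E(2) by blast
    then show ?thesis unfolding image_uniformity_def by (intro bexI[of _ "map_prod f f ` F"] imageI)
  qed
  show "W \<inter> W' \<in> ?U" if W': "W' \<in> ?U" for W'
  proof -
    note D' = W'[unfolded image_uniformity_iff]
    have "{(x, y) \<in> topspace Y \<times> topspace Y. (f x, f y) \<in> W \<inter> W'} =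
      {(x, y) \<in> topspace Y \<times> topspace Y. (f x, f y) \<in> W} \<inter> {(x, y) \<in> topspace Y \<times> topspace Y. (f x, f y) \<in> W'}" by auto
    then show ?thesis unfolding image_uniformity_iff using D D' diag_nhds_Int by (auto intro: sym_Int)
  qed
  show "W' \<in> ?U" if "W \<subseteq> W' \<and> W' \<subseteq> f ` topspace Y \<times> f ` topspace Y \<and> sym W'" for W'
    unfolding image_uniformity_iff
  proof (intro conjI)
    show "{(x, y) \<in> topspace Y \<times> topspace Y. (f x, f y) \<in> W'} \<in> diag_nhds Y"
      using that by (intro diag_nhds_mono[OF D[THEN conjunct2, THEN conjunct2]]) (auto simp: sym_def)
  qed (use that in auto)
qed

lemma continuous_map_image_uniformity:
  assumes "compact_space Y" "metrizable_space Y" "uniform_structure (image_uniformity f (diag_nhds Y))"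
  shows "continuous_map Y (utopology (image_uniformity f (diag_nhds Y))) f"
proof -
  have "Defs.uniformly_continuous_map (diag_nhds Y) (image_uniformity f (diag_nhds Y)) f"
    unfolding Defs.uniformly_continuous_map_def ucarrier_diag_nhds ucarrier_image_uniformity
    using image_uniformity_iff[of _ f Y] by auto
  then have "continuous_map (utopology (diag_nhds Y)) (utopology (image_uniformity f (diag_nhds Y))) f"
    using uniformly_continuous_imp_continuous_map uniform_structure_diag_nhds[OF assms(1,2)] assms(3) by blast
  then show ?thesis using utopology_diag_nhds[OF assms(1,2)] by simp
qed

text \<open>
  A partition of a compact metric space into closed sets \<open>A, B, \<dots>\<close>
  carries the metric \<open>sup \<bar>d(x,A) - d(x,B)\<bar>\<close> over all points
  \<open>x\<close>; it separates the members of the partition because they are closed.  The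
  last hypothesis bounds this metric on images of small entourages, so the identity from the
  quotient to the metric topology is continuous, and therefore a homeomorphism by
  compactness.
\<close>

lemma metrizable_image_uniformity:
  assumes "compact_space Y" "metrizable_space Y"
    and U: "uniform_structure (image_uniformity q (diag_nhds Y))"
    and self: "\<And>y. y \<in> topspace Y \<Longrightarrow> y \<in> q y"
    and disj: "\<And>y z. y \<in> topspace Y \<Longrightarrow> z \<in> q y \<Longrightarrow> q z = q y"
    and closed: "\<And>y. y \<in> topspace Y \<Longrightarrow> closedin Y (q y)"
    and inv: "\<And>E. E \<in> diag_nhds Y \<Longrightarrow> \<exists>F\<in>diag_nhds Y. \<forall>a b a'. (a, b) \<in> F \<longrightarrow> a' \<in> q a \<longrightarrow> (\<exists>b'\<in>q b. (a', b') \<in> E)"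
  shows "metrizable_space (utopology (image_uniformity q (diag_nhds Y)))"
proof -
  let ?Q = "utopology (image_uniformity q (diag_nhds Y))"
  obtain M d where M: "Metric_space M d" and Y: "Y = Metric_space.mtopology M d"
    using assms(2) unfolding metrizable_space_def by blast
  interpret Metric_space M d by fact
  have tY: "topspace Y = M" by (simp add: Y)
  have tQ: "topspace ?Q = q ` M"
    using topspace_utopology[OF U] ucarrier_image_uniformity[of q Y] tY by simp
  have qM: "q y \<subseteq> M" if "y \<in> M" for y using closedin_subset[OF closed] that tY by simp
  obtain B where B: "\<And>x y. x \<in> M \<Longrightarrow> y \<in> M \<Longrightarrow> d x y \<le> B"
    using compactin_imp_mbounded[of M] assms(1) unfolding Y compact_space_def mbounded_alt by auto
  \<comment> \<open>The distance from a point to a set.\<close>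
  define D where "D x A = Inf (d x ` A)" for x A
  have D_le: "D x A \<le> d x a" if "a \<in> A" for x a A
    unfolding D_def using that by (intro cInf_lower bdd_belowI[of _ 0]) auto
  have D_ge: "c \<le> D x A" if "A \<noteq> {}" "\<And>a. a \<in> A \<Longrightarrow> c \<le> d x a" for x A c
    unfolding D_def using that by (intro cInf_greatest) auto
  have D0: "0 \<le> D x A" if "A \<noteq> {}" for x A using D_ge[OF that] by simp
  have DB: "D x A \<le> B" if "A \<in> q ` M" "x \<in> M" for x A
  proof -
    obtain a where a: "a \<in> M" "A = q a" using \<open>A \<in> q ` M\<close> by blast
    then have "D x A \<le> d x a" using self[of a] tY by (intro D_le) simp
    then show ?thesis using B[of x a] a \<open>x \<in> M\<close> by simp
  qed
  have ne: "A \<noteq> {}" if "A \<in> q ` M" for A using that self tY by blast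
  \<comment> \<open>The value off the carrier makes \<open>r\<close> symmetric and nonnegative everywhere.\<close>
  define r where "r A C = (if A \<in> q ` M \<and> C \<in> q ` M then SUP x\<in>M. \<bar>D x A - D x C\<bar> else 0)" for A C
  have bdd: "bdd_above ((\<lambda>x. \<bar>D x A - D x C\<bar>) ` M)" if "A \<in> q ` M" "C \<in> q ` M" for A C
  proof (rule bdd_aboveI2)
    fix x assume "x \<in> M"
    then show "\<bar>D x A - D x C\<bar> \<le> B"
      using DB[OF that(1)] DB[OF that(2)] D0[OF ne[OF that(1)]] D0[OF ne[OF that(2)]] by (smt (verit))
  qed
  have r_ge: "\<bar>D x A - D x C\<bar> \<le> r A C" if "A \<in> q ` M" "C \<in> q ` M" "x \<in> M" for A C x
    unfolding r_def using that cSUP_upper[OF that(3) bdd[OF that(1,2)]] by simp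
  have r_le: "r A C \<le> c" if "A \<in> q ` M" "C \<in> q ` M" "\<And>x. x \<in> M \<Longrightarrow> \<bar>D x A - D x C\<bar> \<le> c" for A C c
    unfolding r_def using that by (auto intro!: cSUP_least)
  have rM: "Metric_space (q ` M) r"
  proof
    show "0 \<le> r A C" for A C
    proof (cases "A \<in> q ` M \<and> C \<in> q ` M")
      case True
      then obtain x where "x \<in> M" by blast
      then show ?thesis using r_ge[of A C x] True by simp
    qed (auto simp: r_def)
    show "r A C = r C A" for A C unfolding r_def by (simp add: abs_minus_commute)
    fix A C assume A: "A \<in> q ` M" and C: "C \<in> q ` M"
    show "r A C = 0 \<longleftrightarrow> A = C"
    proof
      assume r0: "r A C = 0"
      obtain a c where a: "a \<in> M" "A = q a" and c: "c \<in> M" "C = q c" using A C by blast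
      have aA: "a \<in> A" using self a tY by simp
      have "D a A = 0" using D_le[OF aA, of a] D0[OF ne[OF A], of a] a by simp
      then have Da: "D a C = 0" using r_ge[OF A C a(1)] r0 by simp
      have "a \<in> C"
      proof (rule ccontr)
        assume "a \<notin> C"
        then obtain e where e: "e > 0" "disjnt C (mball a e)"
          using closed[of c] c a unfolding Y closedin_metric by auto
        have "e \<le> D a C"
        proof (rule D_ge[OF ne[OF C]])
          fix x assume x: "x \<in> C"
          then have "x \<in> M" using qM c by blast
          then show "e \<le> d a x" using e(2) x a unfolding disjnt_iff by (meson in_mball not_le)
        qed
        then show False using Da e by simp
      qed
      then show "A = C" using disj[of c a] c a tY by simp
    next
      assume "A = C"
      obtain x where "x \<in> M" using A by blast
      then have "r A C \<ge> 0" using r_ge[OF A C] by (meson abs_ge_zero order_trans)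
      moreover have "r A C \<le> 0" by (rule r_le[OF A C]) (simp add: \<open>A = C\<close>)
      ultimately show "r A C = 0" by simp
    qed
    fix E assume E: "E \<in> q ` M"
    show "r A E \<le> r A C + r C E"
    proof (rule r_le[OF A E])
      fix x assume x: "x \<in> M"
      show "\<bar>D x A - D x E\<bar> \<le> r A C + r C E" using r_ge[OF A C x] r_ge[OF C E x] by linarith
    qed
  qed
  interpret R: Metric_space "q ` M" r by fact
  have small: "\<exists>F\<in>diag_nhds Y. \<forall>(a, b)\<in>F. r (q a) (q b) < e" if e: "e > 0" for e
  proof -
    have "{(x, y). x \<in> M \<and> y \<in> M \<and> d x y < e/2} \<in> diag_nhds Y"
      unfolding Y using M e by (intro metric_entourage) simp_all
    from inv[OF this] obtain F where F: "F \<in> diag_nhds Y"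
      and Fi: "\<And>a b a'. (a, b) \<in> F \<Longrightarrow> a' \<in> q a \<Longrightarrow> \<exists>b'\<in>q b. d a' b' < e/2" by fast
    have FM: "a \<in> M" "b \<in> M" "(b, a) \<in> F" if "(a, b) \<in> F" for a b
      using diag_nhds_D(1,2)[OF F] that tY by (auto dest: symD)
    have half: "D x (q b) \<le> D x (q a) + e/2" if ab: "(a, b) \<in> F" and x: "x \<in> M" for a b x
    proof -
      have "D x (q b) - e/2 \<le> D x (q a)"
      proof (rule D_ge)
        show "q a \<noteq> {}" using self FM[OF ab] tY by blast
        fix a' assume a': "a' \<in> q a"
        obtain b' where b': "b' \<in> q b" "d a' b' < e/2" using Fi[OF ab a'] by blast
        have "a' \<in> M" "b' \<in> M" using a' b' qM FM[OF ab] by blast+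
        then have "d x b' \<le> d x a' + d a' b'" using triangle x by simp
        then show "D x (q b) - e/2 \<le> d x a'" using D_le[OF b'(1), of x] b'(2) by simp
      qed
      then show ?thesis by simp
    qed
    have "r (q a) (q b) < e" if ab: "(a, b) \<in> F" for a b
    proof -
      have "r (q a) (q b) \<le> e/2"
      proof (rule r_le)
        fix x assume x: "x \<in> M"
        show "\<bar>D x (q a) - D x (q b)\<bar> \<le> e/2"
          using half[OF ab x] half[OF FM(3)[OF ab] x] by linarith
      qed (use FM[OF ab] in auto)
      then show ?thesis using e by simp
    qed
    then show ?thesis using F by blast
  qed
  have cont: "continuous_map ?Q R.mtopology id"
    unfolding continuous_map_def
  proof (intro conjI allI impI)
    show "id \<in> topspace ?Q \<rightarrow> topspace R.mtopology" by (simp add: tQ)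
    fix W assume W: "openin R.mtopology W"
    have WM: "W \<subseteq> q ` M" using openin_subset[OF W] by simp
    have "openin ?Q W"
      unfolding openin_utopology[OF U] ucarrier_image_uniformity tY
    proof (intro conjI ballI)
      show "W \<subseteq> q ` M" by (rule WM)
      fix A assume A: "A \<in> W"
      then obtain e where e: "e > 0" "R.mball A e \<subseteq> W" using W unfolding R.openin_mtopology by blast
      obtain F where F: "F \<in> diag_nhds Y" "\<And>a b. (a, b) \<in> F \<Longrightarrow> r (q a) (q b) < e"
        using small[OF e(1)] by blast
      define E where "E = {(A, C). A \<in> q ` M \<and> C \<in> q ` M \<and> r A C < e}"
      have "E \<in> image_uniformity q (diag_nhds Y)"
        unfolding image_uniformity_iff
      proof (intro conjI)
        show "E \<subseteq> q ` topspace Y \<times> q ` topspace Y" by (auto simp: E_def tY)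
        show "sym E" by (auto simp: E_def sym_def R.commute)
        show "{(x, y) \<in> topspace Y \<times> topspace Y. (q x, q y) \<in> E} \<in> diag_nhds Y"
        proof (rule diag_nhds_mono[OF F(1)])
          show "F \<subseteq> {(x, y) \<in> topspace Y \<times> topspace Y. (q x, q y) \<in> E}"
            using diag_nhds_D(1)[OF F(1)] F(2) by (fastforce simp: E_def tY)
          show "sym {(x, y) \<in> topspace Y \<times> topspace Y. (q x, q y) \<in> E}"
            by (auto simp: E_def sym_def R.commute)
        qed auto
      qed
      moreover have "E `` {A} \<subseteq> W" using e(2) by (auto simp: E_def)
      ultimately show "\<exists>E\<in>image_uniformity q (diag_nhds Y). E `` {A} \<subseteq> W" by blast
    qed
    moreover have "{x \<in> topspace ?Q. id x \<in> W} = W" using WM tQ by auto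
    ultimately show "openin ?Q {x \<in> topspace ?Q. id x \<in> W}" by simp
  qed
  have "compact_space ?Q"
    using compact_space_image[OF assms(1) continuous_map_image_uniformity[OF assms(1,2) U]] tQ tY by simp
  then have "homeomorphic_map ?Q R.mtopology id"
    using cont R.Hausdorff_space_mtopology tQ by (intro continuous_imp_homeomorphic_map) auto
  then show ?thesis
    using homeomorphic_metrizable_space R.metrizable_space_mtopology homeomorphic_map_imp_homeomorphic_space by blast
qed


text \<open>
  The action laws already give bijectivity of each \<open>\<phi> g\<close> and make
  \<open>\<phi>\<close> a homomorphism into the group of bijections.
\<close>

lemma faithful_actionI:
  assumes G: "group G"
    and ext: "\<And>g. g \<in> carrier G \<Longrightarrow> \<phi> g \<in> extensional S"
    and closed: "\<And>g x. g \<in> carrier G \<Longrightarrow> x \<in> S \<Longrightarrow> \<phi> g x \<in> S"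
    and one: "\<And>x. x \<in> S \<Longrightarrow> \<phi> \<one>\<^bsub>G\<^esub> x = x"
    and mult: "\<And>g h x. g \<in> carrier G \<Longrightarrow> h \<in> carrier G \<Longrightarrow> x \<in> S \<Longrightarrow> \<phi> (g \<otimes>\<^bsub>G\<^esub> h) x = \<phi> g (\<phi> h x)"
    and faith: "\<And>g. g \<in> carrier G \<Longrightarrow> (\<And>x. x \<in> S \<Longrightarrow> \<phi> g x = x) \<Longrightarrow> g = \<one>\<^bsub>G\<^esub>"
  shows "faithful_action G S \<phi>"
proof -
  interpret group G by fact
  have inv: "\<phi> (inv\<^bsub>G\<^esub> g) (\<phi> g x) = x" "\<phi> g (\<phi> (inv\<^bsub>G\<^esub> g) x) = x" if "g \<in> carrier G" "x \<in> S" for g x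
    using mult[of "inv\<^bsub>G\<^esub> g" g x] mult[of g "inv\<^bsub>G\<^esub> g" x] one that by simp_all
  have bij: "\<phi> g \<in> Bij S" if g: "g \<in> carrier G" for g
  proof -
    have "bij_betw (\<phi> g) S S"
      by (rule bij_betw_byWitness[of S "\<phi> (inv\<^bsub>G\<^esub> g)"]) (use inv closed g in auto)
    then show ?thesis using ext[OF g] by (simp add: Bij_def)
  qed
  have hom: "\<phi> \<in> hom G (BijGroup S)"
  proof (rule homI)
    show "\<phi> g \<in> carrier (BijGroup S)" if "g \<in> carrier G" for g using bij[OF that] by (simp add: BijGroup_def)
    fix g h assume gh: "g \<in> carrier G" "h \<in> carrier G"
    have "\<phi> (g \<otimes>\<^bsub>G\<^esub> h) = compose S (\<phi> g) (\<phi> h)"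
      by (rule extensionalityI[of _ S]) (use gh ext mult in \<open>auto simp: compose_def\<close>)
    then show "\<phi> (g \<otimes>\<^bsub>G\<^esub> h) = \<phi> g \<otimes>\<^bsub>BijGroup S\<^esub> \<phi> h"
      using bij gh by (simp add: BijGroup_def)
  qed
  have "inj_on \<phi> (carrier G)"
  proof (rule inj_onI)
    fix g h assume gh: "g \<in> carrier G" "h \<in> carrier G" "\<phi> g = \<phi> h"
    have "inv\<^bsub>G\<^esub> h \<otimes>\<^bsub>G\<^esub> g = \<one>\<^bsub>G\<^esub>"
    proof (rule faith)
      show "\<phi> (inv\<^bsub>G\<^esub> h \<otimes>\<^bsub>G\<^esub> g) x = x" if "x \<in> S" for x using mult inv gh that by simp
    qed (use gh in simp)
    then show "g = h" using gh by (metis inv_equality inv_inv inv_closed)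
  qed
  then show ?thesis
    using G group_BijGroup hom
    by (simp add: faithful_action_def faithful_action_axioms_def group_action_def group_hom_def group_hom_axioms_def)
qed

context group_action
begin

lemma is_group: "group G"
  using group_hom group_hom.axioms(1) by blast

lemma act_closed: "g \<in> carrier G \<Longrightarrow> x \<in> E \<Longrightarrow> \<phi> g x \<in> E"
  using element_image by blast

lemma act_one: "x \<in> E \<Longrightarrow> \<phi> \<one> x = x"
  using id_eq_one by (metis restrict_apply')

lemma act_inv: "g \<in> carrier G \<Longrightarrow> x \<in> E \<Longrightarrow> \<phi> (inv g) (\<phi> g x) = x"
  "g \<in> carrier G \<Longrightarrow> x \<in> E \<Longrightarrow> \<phi> g (\<phi> (inv g) x) = x"
  using is_group composition_rule[of x "inv g" g] composition_rule[of x g "inv g"] act_one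
  by (simp_all add: group.l_inv group.r_inv)

lemma act_eq_imp_eq:
  assumes g: "g \<in> carrier G" and h: "h \<in> carrier G" and x: "x \<in> E" and eq: "\<phi> g x = \<phi> h x"
    and free: "\<And>k. k \<in> carrier G \<Longrightarrow> \<phi> k x = x \<Longrightarrow> k = \<one>"
  shows "g = h"
proof -
  interpret group G by (rule is_group)
  have "\<phi> (inv h \<otimes> g) x = x"
    using composition_rule[OF x inv_closed[OF h] g] eq act_inv(1)[OF h x] by simp
  then have "inv h \<otimes> g = \<one>" using free g h by simp
  then show ?thesis using g h by (metis inv_equality inv_inv inv_closed)
qed

lemma act_extensional: "g \<in> carrier G \<Longrightarrow> \<phi> g \<in> extensional E"
  using bij_prop0 by (simp add: Bij_def)

lemma mem_orbit_subgroup: "z \<in> orbit (G\<lparr>carrier := K\<rparr>) \<phi> y \<longleftrightarrow> (\<exists>k\<in>K. z = \<phi> k y)"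
  by (auto simp: orbit_def)

lemma orbit_subgroup_self: "subgroup K G \<Longrightarrow> y \<in> E \<Longrightarrow> y \<in> orbit (G\<lparr>carrier := K\<rparr>) \<phi> y"
  using act_one[of y] subgroup.one_closed[of K G] unfolding mem_orbit_subgroup by metis

lemma orbit_subgroup_act:
  assumes K: "subgroup K G" and k: "k \<in> K" and y: "y \<in> E"
  shows "orbit (G\<lparr>carrier := K\<rparr>) \<phi> (\<phi> k y) = orbit (G\<lparr>carrier := K\<rparr>) \<phi> y"
proof -
  have KG: "h \<in> carrier G" if "h \<in> K" for h using subgroup.mem_carrier[OF K that] .
  have "\<exists>h'\<in>K. \<phi> h (\<phi> k y) = \<phi> h' y" if h: "h \<in> K" for h
    using composition_rule[OF y KG[OF h] KG[OF k]] subgroup.m_closed[OF K h k] by metis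
  moreover have "\<exists>h'\<in>K. \<phi> h y = \<phi> h' (\<phi> k y)" if h: "h \<in> K" for h
  proof -
    have ik: "inv k \<in> K" using subgroup.m_inv_closed[OF K k] .
    have "\<phi> (h \<otimes> inv k) (\<phi> k y) = \<phi> h (\<phi> (inv k) (\<phi> k y))"
      using composition_rule[OF act_closed[OF KG[OF k] y] KG[OF h] KG[OF ik]] .
    then show ?thesis using act_inv(1)[OF KG[OF k] y] subgroup.m_closed[OF K h ik] by metis
  qed
  ultimately show ?thesis unfolding set_eq_iff mem_orbit_subgroup by metis
qed

lemma orbit_subgroup_eq_iff:
  assumes K: "subgroup K G" and y: "y \<in> E" and z: "z \<in> E"
  shows "orbit (G\<lparr>carrier := K\<rparr>) \<phi> y = orbit (G\<lparr>carrier := K\<rparr>) \<phi> z \<longleftrightarrow> (\<exists>k\<in>K. z = \<phi> k y)"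
  using orbit_subgroup_self[OF K z] orbit_subgroup_act[OF K _ y] mem_orbit_subgroup by metis

end

locale isomorphic_action =
  fixes Y :: "'y topology" and G :: "'g monoid" (structure) and \<phi> :: "'g \<Rightarrow> 'y \<Rightarrow> 'y"
  assumes compact: "compact_space Y" and metrizable: "metrizable_space Y"
    and isomorphic: "acts_isomorphically (compact_uniformity Y) G \<phi>"
begin

lemma uniformity: "compact_uniformity Y = diag_nhds Y"
  using compact_uniformity_eq[OF compact metrizable] .

sublocale faithful_action G "topspace Y" \<phi>
  using isomorphic by (simp add: acts_isomorphically_def uniformity ucarrier_diag_nhds)

lemma invariant_entourage:
  assumes "E \<in> diag_nhds Y"
  obtains F where "F \<in> diag_nhds Y" "F \<subseteq> E" "\<And>g x y. g \<in> carrier G \<Longrightarrow> (x, y) \<in> F \<Longrightarrow> (\<phi> g x, \<phi> g y) \<in> F"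
proof -
  obtain F where F: "F \<in> diag_nhds Y" "F \<subseteq> E" "\<forall>g\<in>carrier G. map_prod (\<phi> g) (\<phi> g) ` F = F"
    using isomorphic assms unfolding acts_isomorphically_def uniformity by blast
  have "(\<phi> g x, \<phi> g y) \<in> F" if "g \<in> carrier G" "(x, y) \<in> F" for g x y
  proof -
    have "map_prod (\<phi> g) (\<phi> g) (x, y) \<in> map_prod (\<phi> g) (\<phi> g) ` F" using that(2) by (rule imageI)
    then show ?thesis using F(3) that(1) by simp
  qed
  then show ?thesis using that F(1,2) by blast
qed

text \<open>
  An invariant entourage below a given one is its own preimage under every group element.
\<close>

lemma act_continuous:
  assumes g: "g \<in> carrier G" shows "continuous_map Y Y (\<phi> g)"
proof -
  have "{(x, y) \<in> topspace Y \<times> topspace Y. (\<phi> g x, \<phi> g y) \<in> E} \<in> diag_nhds Y" if E: "E \<in> diag_nhds Y" for E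
  proof -
    obtain F where F: "F \<in> diag_nhds Y" "F \<subseteq> E" "\<And>g x y. g \<in> carrier G \<Longrightarrow> (x, y) \<in> F \<Longrightarrow> (\<phi> g x, \<phi> g y) \<in> F"
      using invariant_entourage[OF E] by metis
    show ?thesis
    proof (rule diag_nhds_mono[OF F(1)])
      show "F \<subseteq> {(x, y) \<in> topspace Y \<times> topspace Y. (\<phi> g x, \<phi> g y) \<in> E}"
        using F(2) F(3)[OF g] diag_nhds_D(1)[OF F(1)] by fast
      show "sym {(x, y) \<in> topspace Y \<times> topspace Y. (\<phi> g x, \<phi> g y) \<in> E}"
        using diag_nhds_D(2)[OF E] by (auto simp: sym_def)
    qed auto
  qed
  then have "Defs.uniformly_continuous_map (diag_nhds Y) (diag_nhds Y) (\<phi> g)"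
    unfolding Defs.uniformly_continuous_map_def ucarrier_diag_nhds using act_closed[OF g] by auto
  then have "continuous_map (utopology (diag_nhds Y)) (utopology (diag_nhds Y)) (\<phi> g)"
    using uniformly_continuous_imp_continuous_map uniform_structure_diag_nhds[OF compact metrizable] by blast
  then show ?thesis by (simp add: utopology_diag_nhds[OF compact metrizable])
qed

lemma act_homeomorphic_map:
  assumes g: "g \<in> carrier G" shows "homeomorphic_map Y Y (\<phi> g)"
proof (rule homeomorphic_maps_imp_map[of _ _ _ "\<phi> (inv g)"])
  show "homeomorphic_maps Y Y (\<phi> g) (\<phi> (inv g))"
    using act_continuous g group.inv_closed[OF is_group g] act_inv[OF g] by (simp add: homeomorphic_maps_def)
qed

end

locale isomorphic_action_subgroup = isomorphic_action +
  fixes K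
  assumes subgroup_K: "subgroup K G"
    and closed_orbit: "\<And>y. y \<in> topspace Y \<Longrightarrow> closedin Y (orbit (G\<lparr>carrier := K\<rparr>) \<phi> y)"
begin

abbreviation "q \<equiv> orbit (G\<lparr>carrier := K\<rparr>) \<phi>"
abbreviation "UQ \<equiv> quotient_uniformity (compact_uniformity Y) G \<phi> K"

lemma UQ_eq: "UQ = image_uniformity q (diag_nhds Y)"
  by (simp add: quotient_uniformity_def uniformity)

lemma K_carrier: "k \<in> K \<Longrightarrow> k \<in> carrier G"
  using subgroup.mem_carrier[OF subgroup_K] .

text \<open>
  If \<open>b\<close> and \<open>b' = kb\<close> represent the same orbit, then an invariant
  entourage containing \<open>(a, b)\<close> also contains \<open>(ka, b')\<close>; so
  chains of two steps in the quotient lift to chains of two steps.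
\<close>

lemma uniform_structure_UQ: "uniform_structure UQ"
  unfolding UQ_eq
proof (rule uniform_structure_image_uniformity)
  fix E assume E: "E \<in> diag_nhds Y"
  obtain E' where E': "E' \<in> diag_nhds Y" "E' O E' \<subseteq> E" using diag_nhds_half[OF compact metrizable E] by blast
  obtain F where F: "F \<in> diag_nhds Y" "F \<subseteq> E'" "\<And>g x y. g \<in> carrier G \<Longrightarrow> (x, y) \<in> F \<Longrightarrow> (\<phi> g x, \<phi> g y) \<in> F"
    using invariant_entourage[OF E'(1)] by metis
  have "(A, C) \<in> map_prod q q ` E" if AB: "(A, B) \<in> map_prod q q ` F" and BC: "(B, C) \<in> map_prod q q ` F" for A B C
  proof -
    obtain a b where ab: "(a, b) \<in> F" "A = q a" "B = q b" using AB by auto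
    obtain b' c where bc: "(b', c) \<in> F" "B = q b'" "C = q c" using BC by auto
    have Y: "a \<in> topspace Y" "b \<in> topspace Y" "b' \<in> topspace Y" using diag_nhds_D(1)[OF F(1)] ab bc by auto
    obtain k where k: "k \<in> K" "b' = \<phi> k b" using orbit_subgroup_eq_iff[OF subgroup_K Y(2,3)] ab bc by metis
    have "(\<phi> k a, b') \<in> F" using F(3)[OF K_carrier[OF k(1)] ab(1)] k by simp
    then have "(\<phi> k a, c) \<in> E" using bc F(2) E'(2) by blast
    moreover have "q (\<phi> k a) = A" using orbit_subgroup_act[OF subgroup_K k(1) Y(1)] ab by simp
    ultimately show ?thesis using bc(3) by (intro image_eqI[of _ _ "(\<phi> k a, c)"]) simp_all
  qed
  then have "map_prod q q ` F O map_prod q q ` F \<subseteq> map_prod q q ` E" by (intro subrelI) (erule relcompEpair)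
  then show "\<exists>F\<in>diag_nhds Y. map_prod q q ` F O map_prod q q ` F \<subseteq> map_prod q q ` E" using F(1) by blast
qed

lemma topspace_UQ: "topspace (utopology UQ) = q ` topspace Y"
  using topspace_utopology[OF uniform_structure_UQ] unfolding UQ_eq ucarrier_image_uniformity .

lemma continuous_q: "continuous_map Y (utopology UQ) q"
  using continuous_map_image_uniformity[OF compact metrizable, of q] uniform_structure_UQ unfolding UQ_eq .

lemma compact_UQ: "compact_space (utopology UQ)"
  using compact_space_image[OF compact continuous_q] topspace_UQ by simp

lemma metrizable_UQ: "metrizable_space (utopology UQ)"
  unfolding UQ_eq
proof (rule metrizable_image_uniformity[OF compact metrizable uniform_structure_UQ[unfolded UQ_eq]])
  fix y assume y: "y \<in> topspace Y"
  show "y \<in> q y" using orbit_subgroup_self[OF subgroup_K y] .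
  show "closedin Y (q y)" using closed_orbit[OF y] .
  show "q z = q y" if "z \<in> q y" for z
    using that orbit_subgroup_act[OF subgroup_K _ y] unfolding mem_orbit_subgroup by auto
next
  fix E assume E: "E \<in> diag_nhds Y"
  obtain F where F: "F \<in> diag_nhds Y" "F \<subseteq> E" "\<And>g x y. g \<in> carrier G \<Longrightarrow> (x, y) \<in> F \<Longrightarrow> (\<phi> g x, \<phi> g y) \<in> F"
    using invariant_entourage[OF E] by metis
  have "\<exists>b'\<in>q b. (a', b') \<in> E" if ab: "(a, b) \<in> F" and a': "a' \<in> q a" for a b a'
  proof -
    obtain k where k: "k \<in> K" "a' = \<phi> k a" using a' unfolding mem_orbit_subgroup by blast
    have "(a', \<phi> k b) \<in> E" using F(3)[OF K_carrier[OF k(1)] ab] F(2) k(2) by blast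
    moreover have "\<phi> k b \<in> q b" unfolding mem_orbit_subgroup using k(1) by blast
    ultimately show ?thesis by blast
  qed
  then show "\<exists>F\<in>diag_nhds Y. \<forall>a b a'. (a, b) \<in> F \<longrightarrow> a' \<in> q a \<longrightarrow> (\<exists>b'\<in>q b. (a', b') \<in> E)"
    using F(1) by blast
qed

lemma UQ_diag_nhds: "UQ = diag_nhds (utopology UQ)"
  using uniform_structure_eq_diag_nhds[OF uniform_structure_UQ compact_UQ] .

lemma UQ_compact_uniformity: "UQ = compact_uniformity (utopology UQ)"
  using UQ_diag_nhds compact_uniformity_eq[OF compact_UQ metrizable_UQ] by simp

lemma UQ_iff: "W \<in> UQ \<longleftrightarrow> W \<subseteq> q ` topspace Y \<times> q ` topspace Y \<and> sym W \<and>
     {(x, y) \<in> topspace Y \<times> topspace Y. (q x, q y) \<in> W} \<in> diag_nhds Y"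
  unfolding UQ_eq image_uniformity_iff ..

end

locale isomorphic_action_normal = isomorphic_action_subgroup +
  assumes normal_K: "K \<lhd> G"
begin

abbreviation "act_Q \<equiv> quotient_action (topspace Y) G \<phi> K"

lemma normal_commute:
  assumes "g \<in> carrier G" "k \<in> K" shows "\<exists>k'\<in>K. g \<otimes> k = k' \<otimes> g"
proof -
  interpret group G by (rule is_group)
  have "g \<otimes> k \<otimes> inv g \<in> K" using normal.inv_op_closed2[OF normal_K assms] .
  moreover have "g \<otimes> k = (g \<otimes> k \<otimes> inv g) \<otimes> g" using assms K_carrier by (simp add: m_assoc)
  ultimately show ?thesis by blast
qed

text \<open>
  By normality a coset moves a \<open>K\<close>-orbit as any of its representatives does.
\<close>

lemma act_Q_coset:
  assumes g: "g \<in> carrier G" and y: "y \<in> topspace Y"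
  shows "act_Q (K #> g) (q y) = q (\<phi> g y)"
proof -
  interpret group G by (rule is_group)
  have gy: "\<phi> g y \<in> topspace Y" using act_closed[OF g y] .
  have "q y \<in> orbits (G\<lparr>carrier := K\<rparr>) (topspace Y) \<phi>" using y by (auto simp: orbits_def)
  then have "act_Q (K #> g) (q y) = (\<Union>h\<in>K #> g. \<phi> h ` q y)" by (simp add: quotient_action_def)
  also have "\<dots> = q (\<phi> g y)"
  proof (rule equalityI; rule subsetI)
    fix z assume "z \<in> (\<Union>h\<in>K #> g. \<phi> h ` q y)"
    then obtain k k' where k: "k \<in> K" "k' \<in> K" "z = \<phi> (k \<otimes> g) (\<phi> k' y)"
      unfolding r_coset_def by (auto simp: mem_orbit_subgroup)
    obtain k'' where k'': "k'' \<in> K" "g \<otimes> k' = k'' \<otimes> g" using normal_commute[OF g k(2)] by blast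
    have c: "k \<in> carrier G" "k' \<in> carrier G" "k'' \<in> carrier G" using k k'' K_carrier by auto
    have "z = \<phi> (k \<otimes> g \<otimes> k') y" using composition_rule[OF y _ c(2)] k c g by simp
    also have "k \<otimes> g \<otimes> k' = k \<otimes> k'' \<otimes> g" using k''(2) c g by (simp add: m_assoc)
    also have "\<phi> (k \<otimes> k'' \<otimes> g) y = \<phi> (k \<otimes> k'') (\<phi> g y)" using composition_rule[OF y _ g] c by simp
    finally show "z \<in> q (\<phi> g y)"
      unfolding mem_orbit_subgroup using subgroup.m_closed[OF subgroup_K k(1) k''(1)] by blast
  next
    fix z assume "z \<in> q (\<phi> g y)"
    then obtain k where k: "k \<in> K" "z = \<phi> k (\<phi> g y)" unfolding mem_orbit_subgroup by blast
    have "z = \<phi> (k \<otimes> g) y" using composition_rule[OF y K_carrier[OF k(1)] g] k by simp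
    moreover have "k \<otimes> g \<in> K #> g" unfolding r_coset_def using k(1) by blast
    ultimately show "z \<in> (\<Union>h\<in>K #> g. \<phi> h ` q y)" using orbit_subgroup_self[OF subgroup_K y] by blast
  qed
  finally show ?thesis .
qed

lemma carrier_Mod: "carrier (G Mod K) = (\<lambda>g. K #> g) ` carrier G"
  by (auto simp: FactGroup_def RCOSETS_def)

lemma coset_group_hom: "group_hom G (G Mod K) (\<lambda>g. K #> g)"
  using is_group normal.factorgroup_is_group[OF normal_K] normal.r_coset_hom_Mod[OF normal_K]
  by (simp add: group_hom_def group_hom_axioms_def)

lemma faithful_action_Q:
  assumes free: "\<And>g y. g \<in> carrier G \<Longrightarrow> y \<in> topspace Y \<Longrightarrow> \<phi> g y = y \<Longrightarrow> g = \<one>"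
    and ne: "topspace Y \<noteq> {}"
  shows "faithful_action (G Mod K) (q ` topspace Y) act_Q"
proof (rule faithful_actionI)
  interpret group G by (rule is_group)
  interpret h: group_hom G "G Mod K" "\<lambda>g. K #> g" by (rule coset_group_hom)
  show "group (G Mod K)" using normal.factorgroup_is_group[OF normal_K] .
  fix C assume "C \<in> carrier (G Mod K)"
  then obtain g where g: "g \<in> carrier G" "C = K #> g" unfolding carrier_Mod by blast
  show "act_Q C \<in> extensional (q ` topspace Y)"
    by (auto simp: quotient_action_def orbits_def extensional_def)
  show "act_Q C x \<in> q ` topspace Y" if "x \<in> q ` topspace Y" for x
    using that act_Q_coset[OF g(1)] act_closed[OF g(1)] g(2) by auto
  show "act_Q (C \<otimes>\<^bsub>G Mod K\<^esub> D) x = act_Q C (act_Q D x)" if D: "D \<in> carrier (G Mod K)" "x \<in> q ` topspace Y" for D x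
  proof -
    obtain d y where d: "d \<in> carrier G" "D = K #> d" "y \<in> topspace Y" "x = q y"
      using D unfolding carrier_Mod by blast
    have "act_Q (C \<otimes>\<^bsub>G Mod K\<^esub> D) x = act_Q (K #> (g \<otimes> d)) (q y)"
      unfolding g(2) d(2,4) by (subst h.hom_mult[OF g(1) d(1)]) (rule refl)
    also have "\<dots> = q (\<phi> g (\<phi> d y))"
      unfolding act_Q_coset[OF m_closed[OF g(1) d(1)] d(3)] composition_rule[OF d(3) g(1) d(1)] ..
    also have "\<dots> = act_Q C (act_Q D x)"
      unfolding g(2) d(2,4) act_Q_coset[OF d(1,3)] act_Q_coset[OF g(1) act_closed[OF d(1,3)]] ..
    finally show ?thesis .
  qed
  show "C = \<one>\<^bsub>G Mod K\<^esub>" if *: "\<And>x. x \<in> q ` topspace Y \<Longrightarrow> act_Q C x = x"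
  proof -
    obtain y where y: "y \<in> topspace Y" using ne by blast
    have "q y = q (\<phi> g y)" using *[of "q y"] act_Q_coset[OF g(1) y] g(2) y by simp
    then obtain k where k: "k \<in> K" "\<phi> g y = \<phi> k y"
      using orbit_subgroup_eq_iff[OF subgroup_K y act_closed[OF g(1) y]] by blast
    have kc: "k \<in> carrier G" using K_carrier[OF k(1)] .
    have "g = k" using act_eq_imp_eq[OF g(1) kc y k(2)] free y by blast
    then show ?thesis using g(2) k(1) coset_join2[OF kc subgroup_K] by (simp add: FactGroup_def)
  qed
next
  show "act_Q \<one>\<^bsub>G Mod K\<^esub> x = x" if "x \<in> q ` topspace Y" for x
  proof -
    interpret group G by (rule is_group)
    have "\<one>\<^bsub>G Mod K\<^esub> = K #> \<one>"
      using coset_mult_one[OF subgroup.subset[OF subgroup_K]] by (simp add: FactGroup_def)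
    then show ?thesis using that act_Q_coset[OF one_closed] act_one by auto
  qed
qed

lemma acts_isomorphically_Q:
  assumes free: "\<And>g y. g \<in> carrier G \<Longrightarrow> y \<in> topspace Y \<Longrightarrow> \<phi> g y = y \<Longrightarrow> g = \<one>"
    and ne: "topspace Y \<noteq> {}"
  shows "acts_isomorphically UQ (G Mod K) act_Q"
  unfolding acts_isomorphically_def
proof (intro conjI ballI)
  show "uniform_structure UQ" by (rule uniform_structure_UQ)
  have car: "ucarrier UQ = q ` topspace Y" unfolding UQ_eq ucarrier_image_uniformity ..
  show fa: "faithful_action (G Mod K) (ucarrier UQ) act_Q"
    unfolding car using faithful_action_Q[OF assms] .
  interpret Q: faithful_action "G Mod K" "q ` topspace Y" act_Q using fa unfolding car .
  fix W assume W: "W \<in> UQ"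
  have pW: "{(x, y) \<in> topspace Y \<times> topspace Y. (q x, q y) \<in> W} \<in> diag_nhds Y" using W unfolding UQ_iff by blast
  obtain F where F: "F \<in> diag_nhds Y" "F \<subseteq> {(x, y) \<in> topspace Y \<times> topspace Y. (q x, q y) \<in> W}"
    "\<And>g x y. g \<in> carrier G \<Longrightarrow> (x, y) \<in> F \<Longrightarrow> (\<phi> g x, \<phi> g y) \<in> F"
    by (rule invariant_entourage[OF pW]) (rule that)
  let ?V = "map_prod q q ` F"
  have VUQ: "?V \<in> UQ" unfolding UQ_eq image_uniformity_def using F(1) by (rule imageI)
  have V1: "map_prod (act_Q C) (act_Q C) ` ?V \<subseteq> ?V" if C: "C \<in> carrier (G Mod K)" for C
  proof -
    obtain g where g: "g \<in> carrier G" "C = K #> g" using C unfolding carrier_Mod by blast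
    have m: "map_prod (act_Q C) (act_Q C) (map_prod q q p) \<in> ?V" if p: "p \<in> F" for p
    proof -
      obtain x y where xy: "p = (x, y)" by (cases p)
      then have "x \<in> topspace Y" "y \<in> topspace Y" using diag_nhds_D(1)[OF F(1)] p by auto
      then have eq: "map_prod (act_Q C) (act_Q C) (map_prod q q p) = map_prod q q (\<phi> g x, \<phi> g y)"
        using act_Q_coset[OF g(1)] g(2) xy by simp
      have "(\<phi> g x, \<phi> g y) \<in> F" using F(3)[OF g(1)] p xy by simp
      then have "map_prod q q (\<phi> g x, \<phi> g y) \<in> ?V" by (rule imageI)
      then show ?thesis unfolding eq .
    qed
    show ?thesis unfolding image_image by (rule image_subsetI) (rule m)
  qed
  have "map_prod (act_Q C) (act_Q C) ` ?V = ?V" if C: "C \<in> carrier (G Mod K)" for C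
  proof (rule equalityI[OF V1[OF C]], rule subsetI)
    fix p assume p: "p \<in> ?V"
    have IC: "inv\<^bsub>G Mod K\<^esub> C \<in> carrier (G Mod K)" using group.inv_closed[OF Q.is_group C] .
    obtain a b where ab: "p = (a, b)" by (cases p)
    have abQ: "a \<in> q ` topspace Y" "b \<in> q ` topspace Y" using p VUQ ab unfolding UQ_iff by auto
    have "map_prod (act_Q (inv\<^bsub>G Mod K\<^esub> C)) (act_Q (inv\<^bsub>G Mod K\<^esub> C)) p \<in> ?V" using V1[OF IC] imageI[OF p] by (rule subsetD)
    moreover have "map_prod (act_Q C) (act_Q C) (map_prod (act_Q (inv\<^bsub>G Mod K\<^esub> C)) (act_Q (inv\<^bsub>G Mod K\<^esub> C)) p) = p"
      using Q.act_inv(2)[OF C] abQ ab by simp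
    ultimately show "p \<in> map_prod (act_Q C) (act_Q C) ` ?V" by (rule rev_image_eqI[OF _ sym])
  qed
  moreover have "?V \<subseteq> W" using F(2) by auto
  ultimately show "\<exists>F\<in>UQ. F \<subseteq> W \<and> (\<forall>g\<in>carrier (G Mod K). map_prod (act_Q g) (act_Q g) ` F = F)"
    using VUQ by (intro bexI[of _ ?V] conjI ballI) assumption+
qed

end


section \<open>Generalized regular coverings by compact metrizable spaces\<close>

locale prodiscrete_quotient = isomorphic_action Y G \<phi>
  for Y :: "'y topology" and G :: "'g monoid" (structure) and \<phi> +
  fixes X :: "'x topology" and f :: "'y \<Rightarrow> 'x"
  assumes compact_X: "compact_space X" and metrizable_X: "metrizable_space X"
    and nonempty: "topspace Y \<noteq> {}"
    and quotient: "isomorphic_quotient_map (compact_uniformity Y) G \<phi> (compact_uniformity X) f"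
    and prodiscrete: "acts_prodiscretely (compact_uniformity Y) G \<phi>"
begin

lemma uniformity_X: "compact_uniformity X = diag_nhds X"
  using compact_uniformity_eq[OF compact_X metrizable_X] .

lemma f_image: "f ` topspace Y = topspace X"
  using quotient by (simp add: isomorphic_quotient_map_def uniformity uniformity_X ucarrier_diag_nhds)

lemma f_fibre: "y \<in> topspace Y \<Longrightarrow> z \<in> topspace Y \<Longrightarrow> f y = f z \<longleftrightarrow> (\<exists>g\<in>carrier G. z = \<phi> g y)"
  using quotient by (auto simp: isomorphic_quotient_map_def uniformity ucarrier_diag_nhds fibres_are_orbits_def orbit_def)

lemma f_act: "g \<in> carrier G \<Longrightarrow> y \<in> topspace Y \<Longrightarrow> f (\<phi> g y) = f y"
  using f_fibre[of y "\<phi> g y"] act_closed[of g y] by metis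

lemma diag_nhds_X: "diag_nhds X = image_uniformity f (diag_nhds Y)"
  using quotient by (simp add: isomorphic_quotient_map_def uniformity uniformity_X)

lemma f_continuous: "continuous_map Y X f"
  using continuous_map_image_uniformity[OF compact metrizable, of f]
  unfolding diag_nhds_X[symmetric] utopology_diag_nhds[OF compact_X metrizable_X]
  using uniform_structure_diag_nhds[OF compact_X metrizable_X] by blast

lemma carrier_uniformity: "ucarrier (compact_uniformity Y) = topspace Y"
  by (simp add: uniformity ucarrier_diag_nhds)

lemma prodiscrete_entourage:
  assumes "E \<in> diag_nhds Y"
  obtains F where "F \<in> diag_nhds Y" "F \<subseteq> E" "\<And>g x y. g \<in> carrier G \<Longrightarrow> (x, y) \<in> F \<Longrightarrow> (\<phi> g x, \<phi> g y) \<in> F"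
    "N_subgroup (compact_uniformity Y) G \<phi> F \<subseteq> U_set (compact_uniformity Y) G \<phi> E"
proof -
  obtain F0 where F0: "F0 \<in> diag_nhds Y"
    "N_subgroup (compact_uniformity Y) G \<phi> F0 \<subseteq> U_set (compact_uniformity Y) G \<phi> E"
    using prodiscrete assms unfolding acts_prodiscretely_def uniformity by blast
  obtain F where F: "F \<in> diag_nhds Y" "F \<subseteq> F0 \<inter> E" "\<And>g x y. g \<in> carrier G \<Longrightarrow> (x, y) \<in> F \<Longrightarrow> (\<phi> g x, \<phi> g y) \<in> F"
    using invariant_entourage[OF diag_nhds_Int[OF F0(1) assms]] by metis
  have "S_set (compact_uniformity Y) G \<phi> F \<subseteq> S_set (compact_uniformity Y) G \<phi> F0"
    using F(2) by (auto simp: S_set_def)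
  then have "N_subgroup (compact_uniformity Y) G \<phi> F \<subseteq> N_subgroup (compact_uniformity Y) G \<phi> F0"
    unfolding N_subgroup_def by (rule group.mono_generate[OF is_group])
  then show ?thesis using that[OF F(1) _ F(3)] F(2) F0(2) by blast
qed

text \<open>
  Prodiscreteness turns a small displacement of one point into a small displacement of all
  points.
\<close>

lemma N_subgroup_act:
  assumes "N_subgroup (compact_uniformity Y) G \<phi> F \<subseteq> U_set (compact_uniformity Y) G \<phi> E"
    and "g \<in> carrier G" "x \<in> topspace Y" "(x, \<phi> g x) \<in> F" "y \<in> topspace Y"
  shows "(y, \<phi> g y) \<in> E"
proof -
  have "g \<in> S_set (compact_uniformity Y) G \<phi> F" using assms(2-4) unfolding S_set_def carrier_uniformity by blast
  then have "g \<in> N_subgroup (compact_uniformity Y) G \<phi> F" unfolding N_subgroup_def by (rule generate.incl)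
  then show ?thesis using assms(1,5) unfolding U_set_def carrier_uniformity by blast
qed

lemma entourages_separate:
  assumes "x \<in> topspace Y" "y \<in> topspace Y" "\<And>E. E \<in> diag_nhds Y \<Longrightarrow> (x, y) \<in> E"
  shows "x = y"
proof (rule ccontr)
  assume "x \<noteq> y"
  then obtain V where V: "openin Y V" "x \<in> V" "y \<notin> V"
    using metrizable_imp_t1_space[OF metrizable] assms(1,2) unfolding t1_space_def by blast
  then obtain E where "E \<in> diag_nhds Y" "E `` {x} \<subseteq> V"
    using openin_utopology[OF uniform_structure_diag_nhds[OF compact metrizable], of V]
    unfolding utopology_diag_nhds[OF compact metrizable] by blast
  then show False using assms(3)[of E] V by blast
qed

text \<open>
  A group element with a fixed point lies in \<open>S\<^bsub>F\<^esub>(G)\<close> for every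
  \<open>F\<close>, so it moves no point out of any entourage.
\<close>

lemma free:
  assumes g: "g \<in> carrier G" and y: "y \<in> topspace Y" and fixed: "\<phi> g y = y"
  shows "g = \<one>"
proof -
  have "\<phi> g x = x" if x: "x \<in> topspace Y" for x
  proof (rule sym, rule entourages_separate[OF x act_closed[OF g x]])
    fix E assume E: "E \<in> diag_nhds Y"
    obtain F where F: "F \<in> diag_nhds Y"
      "N_subgroup (compact_uniformity Y) G \<phi> F \<subseteq> U_set (compact_uniformity Y) G \<phi> E"
      using prodiscrete_entourage[OF E] by metis
    show "(x, \<phi> g x) \<in> E" using N_subgroup_act[OF F(2) g y _ x] diag_nhds_D(4)[OF F(1) y] fixed by simp
  qed
  then have "\<phi> g = \<phi> \<one>"
    using act_extensional[OF g] act_extensional[of \<one>] act_one group.is_monoid[OF is_group]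
    by (intro extensionalityI[of _ "topspace Y"]) (simp_all add: monoid.one_closed)
  then show ?thesis using faithful g group.is_monoid[OF is_group] by (metis inj_onD monoid.one_closed)
qed

lemma free_eq:
  assumes g: "g \<in> carrier G" and h: "h \<in> carrier G" and y: "y \<in> topspace Y" and eq: "\<phi> g y = \<phi> h y"
  shows "g = h"
  using act_eq_imp_eq[OF g h y eq] free y by blast

lemma f_fibre_closed: "y \<in> topspace Y \<Longrightarrow> closedin Y {z \<in> topspace Y. f z = f y}"
  using closedin_continuous_map_preimage[OF f_continuous, of "{f y}"] f_image
    metrizable_imp_t1_space[OF metrizable_X] by (auto simp: t1_space_closedin_singleton)

text \<open>
  A Cauchy filter on the group, evaluated at a point \<open>y0\<close>, clusters at some
  \<open>z\<close> by compactness.  The fibre of \<open>y0\<close> is closed, so \<open>z =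
  c y0\<close> for some group element \<open>c\<close>.  Every member of the filter contains
  elements that move \<open>y0\<close> close to \<open>c y0\<close>; they are uniformly close to
  \<open>c\<close> by prodiscreteness, and the Cauchy property carries this over to
  convergence to \<open>c\<close>.
\<close>

lemma complete: "complete_uniformity (uniform_convergence (compact_uniformity Y) G \<phi>)"
  unfolding complete_uniformity_def
proof (intro allI impI, elim conjE)
  let ?UC = "uniform_convergence (compact_uniformity Y) G \<phi>"
  define B where "B E = {(g, h) \<in> carrier G \<times> carrier G. \<forall>y\<in>topspace Y. (\<phi> g y, \<phi> h y) \<in> E}" for E
  have UC: "W \<in> ?UC \<longleftrightarrow> W \<subseteq> carrier G \<times> carrier G \<and> sym W \<and> (\<exists>E\<in>diag_nhds Y. B E \<subseteq> W)" for W
    unfolding uniform_convergence_def uniformity ucarrier_diag_nhds B_def by simp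
  have car: "ucarrier ?UC = carrier G"
  proof (rule equalityI)
    show "ucarrier ?UC \<subseteq> carrier G" unfolding ucarrier_def Field_def using UC by blast
    have "carrier G \<times> carrier G \<in> ?UC" unfolding UC using diag_nhds_total[of Y]
      by (intro conjI bexI[of _ "topspace Y \<times> topspace Y"]) (auto simp: sym_def B_def)
    then show "carrier G \<subseteq> ucarrier ?UC" unfolding ucarrier_def Field_def by blast
  qed
  have B_UC: "B E \<in> ?UC" if E: "E \<in> diag_nhds Y" for E
    unfolding UC using E diag_nhds_D(2)[OF E] by (auto simp: B_def sym_def)
  fix F assume F: "F \<noteq> bot" "F \<le> principal (ucarrier ?UC)" "\<forall>E\<in>?UC. \<forall>\<^sub>F p in F \<times>\<^sub>F F. p \<in> E"
  have evG: "\<forall>\<^sub>F g in F. g \<in> carrier G" using F(2) unfolding car le_principal .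
  obtain y0 where y0: "y0 \<in> topspace Y" using nonempty by blast
  have "\<exists>z\<in>topspace Y. \<forall>V. openin Y V \<and> z \<in> V \<longrightarrow> \<not> (\<forall>\<^sub>F g in F. \<phi> g y0 \<notin> V)"
  proof (rule ccontr)
    assume *: "\<not> ?thesis"
    have "\<exists>V. openin Y V \<and> z \<in> V \<and> (\<forall>\<^sub>F g in F. \<phi> g y0 \<notin> V)" if z: "z \<in> topspace Y" for z
      using * z by blast
    then obtain V where V: "\<And>z. z \<in> topspace Y \<Longrightarrow> openin Y (V z) \<and> z \<in> V z \<and> (\<forall>\<^sub>F g in F. \<phi> g y0 \<notin> V z)" by metis
    obtain A where A: "A \<subseteq> topspace Y" "finite A" "topspace Y \<subseteq> (\<Union>z\<in>A. V z)"
      using compact_space_finite_subcover[OF compact, of V] V by metis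
    have "\<forall>\<^sub>F g in F. \<forall>z\<in>A. \<phi> g y0 \<notin> V z"
      using A V by (intro eventually_ball_finite) auto
    with evG have "\<forall>\<^sub>F g in F. False"
    proof eventually_elim
      case (elim g)
      then have "\<phi> g y0 \<in> topspace Y" using act_closed y0 by simp
      then show ?case using elim(2) A(3) by blast
    qed
    then show False using F(1) by (simp add: trivial_limit_def)
  qed
  then obtain z where z: "z \<in> topspace Y" "\<And>V. openin Y V \<Longrightarrow> z \<in> V \<Longrightarrow> \<not> (\<forall>\<^sub>F g in F. \<phi> g y0 \<notin> V)" by blast
  have "f z = f y0"
  proof (rule ccontr)
    assume ne: "f z \<noteq> f y0"
    let ?V = "topspace Y - {w \<in> topspace Y. f w = f y0}"
    have "openin Y ?V" using f_fibre_closed[OF y0] by blast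
    moreover have "z \<in> ?V" using z(1) ne by blast
    moreover have "\<forall>\<^sub>F g in F. \<phi> g y0 \<notin> ?V" using evG
    proof eventually_elim
      case (elim g) then show ?case using f_act[OF elim y0] by blast
    qed
    ultimately show False using z(2) by blast
  qed
  then obtain c where c: "c \<in> carrier G" "z = \<phi> c y0" using f_fibre[OF y0 z(1)] by auto
  show "\<exists>x\<in>ucarrier ?UC. \<forall>E\<in>?UC. \<forall>\<^sub>F y in F. (x, y) \<in> E"
    unfolding car
  proof (intro bexI[OF _ c(1)] ballI)
    fix W assume "W \<in> ?UC"
    then obtain E where E: "E \<in> diag_nhds Y" "B E \<subseteq> W" unfolding UC by blast
    obtain E' where E': "E' \<in> diag_nhds Y" "E' O E' \<subseteq> E" using diag_nhds_half[OF compact metrizable E(1)] by blast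
    obtain I where I: "I \<in> diag_nhds Y" "I \<subseteq> E'" "\<And>g x y. g \<in> carrier G \<Longrightarrow> (x, y) \<in> I \<Longrightarrow> (\<phi> g x, \<phi> g y) \<in> I"
      using invariant_entourage[OF E'(1)] by metis
    obtain P' where P': "P' \<in> diag_nhds Y" "P' \<subseteq> I" "\<And>g x y. g \<in> carrier G \<Longrightarrow> (x, y) \<in> P' \<Longrightarrow> (\<phi> g x, \<phi> g y) \<in> P'"
      "N_subgroup (compact_uniformity Y) G \<phi> P' \<subseteq> U_set (compact_uniformity Y) G \<phi> I"
      using prodiscrete_entourage[OF I(1)] by metis
    obtain V where V: "openin Y V" "z \<in> V" "V \<times> V \<subseteq> P'" using diag_nhds_D(3)[OF P'(1) z(1)] by blast
    have "\<forall>\<^sub>F p in F \<times>\<^sub>F F. p \<in> B E'" using F(3) B_UC[OF E'(1)] by blast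
    then obtain Q R where QR: "eventually Q F" "eventually R F" "\<And>g h. Q g \<Longrightarrow> R h \<Longrightarrow> (g, h) \<in> B E'"
      unfolding eventually_prod_filter by blast
    have "\<exists>g. g \<in> carrier G \<and> Q g \<and> \<phi> g y0 \<in> V"
    proof (rule ccontr)
      assume no: "\<nexists>g. g \<in> carrier G \<and> Q g \<and> \<phi> g y0 \<in> V"
      have "\<forall>\<^sub>F g in F. \<phi> g y0 \<notin> V" using evG QR(1) by eventually_elim (use no in blast)
      then show False using z(2)[OF V(1,2)] by blast
    qed
    then obtain g where g: "g \<in> carrier G" "Q g" "\<phi> g y0 \<in> V" by blast
    have ic: "inv c \<in> carrier G" using group.inv_closed[OF is_group c(1)] .
    have icg: "inv c \<otimes> g \<in> carrier G" using monoid.m_closed[OF group.is_monoid[OF is_group] ic g(1)] .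
    have "(z, \<phi> g y0) \<in> P'" using V g by blast
    then have "(\<phi> (inv c) z, \<phi> (inv c) (\<phi> g y0)) \<in> P'" using P'(3)[OF ic] by blast
    then have small: "(y0, \<phi> (inv c \<otimes> g) y0) \<in> P'"
      using composition_rule[OF y0 ic g(1)] act_inv(1)[OF c(1) y0] c(2) by simp
    \<comment> \<open>The element \<open>inv c \<otimes> g\<close> moves \<open>y0\<close>, hence every point, only a little.\<close>
    have cg: "(\<phi> c y, \<phi> g y) \<in> E'" if y: "y \<in> topspace Y" for y
    proof -
      have "(y, \<phi> (inv c \<otimes> g) y) \<in> I" using N_subgroup_act[OF P'(4) icg y0 small y] .
      then have "(\<phi> c y, \<phi> c (\<phi> (inv c) (\<phi> g y))) \<in> E'"
        using I(2) I(3)[OF c(1)] composition_rule[OF y ic g(1)] by auto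
      then show ?thesis using act_inv(2)[OF c(1) act_closed[OF g(1) y]] by simp
    qed
    show "\<forall>\<^sub>F h in F. (c, h) \<in> W"
      using QR(2)
    proof eventually_elim
      case (elim h)
      then have gh: "(g, h) \<in> B E'" using QR(3) g(2) by blast
      have "(c, h) \<in> B E"
        unfolding B_def
      proof (rule CollectI, rule case_prodI, intro conjI ballI)
        show "(c, h) \<in> carrier G \<times> carrier G" using gh c(1) by (auto simp: B_def)
        fix y assume y: "y \<in> topspace Y"
        have "(\<phi> g y, \<phi> h y) \<in> E'" using gh y by (auto simp: B_def)
        then show "(\<phi> c y, \<phi> h y) \<in> E" using cg[OF y] E'(2) by blast
      qed
      then show ?case using E(2) by blast
    qed
  qed
qed

lemma generalized_regular_covering:
  "generalized_regular_covering (compact_uniformity Y) G \<phi> (compact_uniformity X) f"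
  using quotient prodiscrete complete by (simp add: generalized_regular_covering_def)

end


locale prodiscrete_quotient_normal = prodiscrete_quotient Y G \<phi> X f + isomorphic_action_normal Y G \<phi> K
  for Y :: "'y topology" and G :: "'g monoid" (structure) and \<phi> and X :: "'x topology" and f :: "'y \<Rightarrow> 'x" and K
begin

lemma quotient_projection_orbit:
  assumes y: "y \<in> topspace Y" shows "quotient_projection f (q y) = f y"
proof -
  have "f ` q y = {f y}"
  proof (rule equalityI; rule subsetI)
    fix p assume "p \<in> f ` q y"
    then obtain k where "k \<in> K" "p = f (\<phi> k y)" by (auto simp: mem_orbit_subgroup)
    then show "p \<in> {f y}" using f_act[OF K_carrier y] by simp
  qed (use orbit_subgroup_self[OF subgroup_K y] in auto)
  then show ?thesis by (simp add: quotient_projection_def)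
qed

lemma quotient_fibres:
  assumes y: "y \<in> topspace Y" and z: "z \<in> topspace Y"
  shows "f y = f z \<longleftrightarrow> q z \<in> orbit (G Mod K) act_Q (q y)"
proof
  assume "f y = f z"
  then obtain g where g: "g \<in> carrier G" "z = \<phi> g y" using f_fibre[OF y z] by blast
  then have "q z = act_Q (K #> g) (q y)" "K #> g \<in> carrier (G Mod K)" using act_Q_coset[OF g(1) y] carrier_Mod by auto
  then show "q z \<in> orbit (G Mod K) act_Q (q y)" unfolding orbit_def by blast
next
  assume "q z \<in> orbit (G Mod K) act_Q (q y)"
  then obtain C where C: "C \<in> carrier (G Mod K)" "q z = act_Q C (q y)" unfolding orbit_def[of "G Mod K"] by blast
  then obtain g where g: "g \<in> carrier G" "C = K #> g" unfolding carrier_Mod by blast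
  then have "q z = q (\<phi> g y)" using C act_Q_coset[OF g(1) y] by simp
  then have "f z = f (\<phi> g y)"
    using quotient_projection_orbit[OF z] quotient_projection_orbit[OF act_closed[OF g(1) y]] by simp
  then show "f y = f z" using f_act[OF g(1) y] by simp
qed

lemma quotient_isomorphic_quotient_map:
  "isomorphic_quotient_map UQ (G Mod K) act_Q (compact_uniformity X) (quotient_projection f)"
  unfolding isomorphic_quotient_map_def
proof (intro conjI)
  have car: "ucarrier UQ = q ` topspace Y" unfolding UQ_eq ucarrier_image_uniformity ..
  show "acts_isomorphically UQ (G Mod K) act_Q" using acts_isomorphically_Q[OF free nonempty] .
  show "quotient_projection f ` ucarrier UQ = ucarrier (compact_uniformity X)"
    unfolding car uniformity_X ucarrier_diag_nhds f_image[symmetric]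
    using quotient_projection_orbit by (force simp: image_image)
  show "fibres_are_orbits (ucarrier UQ) (G Mod K) act_Q (quotient_projection f)"
    unfolding fibres_are_orbits_def car using quotient_fibres quotient_projection_orbit by auto
  have eq: "map_prod (quotient_projection f) (quotient_projection f) ` map_prod q q ` E = map_prod f f ` E"
    if E: "E \<in> diag_nhds Y" for E
  proof -
    have "map_prod (quotient_projection f) (quotient_projection f) (map_prod q q p) = map_prod f f p"
      if p: "p \<in> E" for p
    proof -
      have "fst p \<in> topspace Y" "snd p \<in> topspace Y" using diag_nhds_D(1)[OF E] p by auto
      then show ?thesis using quotient_projection_orbit by (cases p) simp
    qed
    then show ?thesis unfolding image_image by (rule image_cong[OF refl])
  qed
  have "image_uniformity (quotient_projection f) UQ = image_uniformity f (diag_nhds Y)"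
    unfolding UQ_eq image_uniformity_def
    unfolding image_image[of "\<lambda>E. map_prod (quotient_projection f) (quotient_projection f) ` E" "\<lambda>E. map_prod q q ` E"]
    by (rule image_cong[OF refl]) (rule eq)
  then show "compact_uniformity X = image_uniformity (quotient_projection f) UQ"
    unfolding uniformity_X diag_nhds_X by simp
qed

text \<open>\<open>S\<^bsub>q(F)\<^esub>(G/K)\<close> consists of the cosets of \<open>S\<^bsub>F\<^esub>(G)\<close> when \<open>F\<close> is invariant.\<close>

lemma quotient_prodiscrete: "acts_prodiscretely UQ (G Mod K) act_Q"
  unfolding acts_prodiscretely_def
proof
  interpret h: group_hom G "G Mod K" "\<lambda>g. K #> g" by (rule coset_group_hom)
  have car: "ucarrier UQ = q ` topspace Y" unfolding UQ_eq ucarrier_image_uniformity ..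
  fix W assume W: "W \<in> UQ"
  let ?E = "{(x, y) \<in> topspace Y \<times> topspace Y. (q x, q y) \<in> W}"
  have E: "?E \<in> diag_nhds Y" using W unfolding UQ_iff by blast
  obtain F where F: "F \<in> diag_nhds Y" "\<And>g x y. g \<in> carrier G \<Longrightarrow> (x, y) \<in> F \<Longrightarrow> (\<phi> g x, \<phi> g y) \<in> F"
    "N_subgroup (compact_uniformity Y) G \<phi> F \<subseteq> U_set (compact_uniformity Y) G \<phi> ?E"
    by (rule prodiscrete_entourage[OF E]) (rule that)
  let ?N = "N_subgroup (compact_uniformity Y) G \<phi> F"
  define V where "V = map_prod q q ` F"
  have V: "V \<in> UQ" unfolding V_def UQ_eq image_uniformity_def using F(1) by (rule imageI)
  have S_carrier: "S_set (compact_uniformity Y) G \<phi> F \<subseteq> carrier G" by (auto simp: S_set_def)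
  have N_sub: "subgroup ?N G" unfolding N_subgroup_def by (rule h.G.generate_is_subgroup[OF S_carrier])
  have S: "\<exists>n\<in>?N. C = K #> n" if C: "C \<in> S_set UQ (G Mod K) act_Q V" for C
  proof -
    obtain y where y: "y \<in> topspace Y" "(q y, act_Q C (q y)) \<in> V" and CM: "C \<in> carrier (G Mod K)"
      using C unfolding S_set_def car by blast
    obtain g where g: "g \<in> carrier G" "C = K #> g" using CM unfolding carrier_Mod by blast
    obtain a b where ab: "(a, b) \<in> F" "q y = q a" "q (\<phi> g y) = q b"
      using y(2) act_Q_coset[OF g(1) y(1)] g(2) unfolding V_def by auto
    have abY: "a \<in> topspace Y" "b \<in> topspace Y" using diag_nhds_D(1)[OF F(1)] ab(1) by auto
    obtain k where k: "k \<in> K" "a = \<phi> k y" using orbit_subgroup_eq_iff[OF subgroup_K y(1) abY(1)] ab(2) by blast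
    obtain k' where k': "k' \<in> K" "b = \<phi> k' (\<phi> g y)"
      using orbit_subgroup_eq_iff[OF subgroup_K act_closed[OF g(1) y(1)] abY(2)] ab(3) by blast
    have c: "k \<in> carrier G" "k' \<in> carrier G" using k k' K_carrier by auto
    have mem: "inv k \<otimes> k' \<in> K"
      using subgroup.m_closed[OF subgroup_K subgroup.m_inv_closed[OF subgroup_K k(1)] k'(1)] .
    have mc: "inv k \<otimes> k' \<in> carrier G" using K_carrier[OF mem] .
    let ?n = "inv k \<otimes> k' \<otimes> g"
    have n: "?n \<in> carrier G" using mc g(1) by simp
    have "(\<phi> (inv k) a, \<phi> (inv k) b) \<in> F" using F(2)[OF _ ab(1)] c(1) by simp
    moreover have "\<phi> (inv k) a = y" using act_inv(1)[OF c(1) y(1)] k(2) by simp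
    moreover have "\<phi> (inv k) b = \<phi> ?n y"
      using composition_rule[OF act_closed[OF g(1) y(1)], of "inv k" k'] composition_rule[OF y(1) mc g(1)] k'(2) c by simp
    ultimately have "?n \<in> S_set (compact_uniformity Y) G \<phi> F"
      unfolding S_set_def carrier_uniformity using n y(1) by auto
    then have "?n \<in> ?N" unfolding N_subgroup_def by (rule generate.incl)
    moreover have "C = K #> ?n"
    proof -
      have "K #> (inv k \<otimes> k') = K" using h.G.coset_join2[OF mc subgroup_K mem] .
      then show ?thesis using h.G.coset_mult_assoc[OF subgroup.subset[OF subgroup_K] mc g(1)] g(2) by simp
    qed
    ultimately show ?thesis by blast
  qed
  have "subgroup ((\<lambda>g. K #> g) ` ?N) (G Mod K)" by (rule h.subgroup_img_is_subgroup[OF N_sub])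
  moreover have "S_set UQ (G Mod K) act_Q V \<subseteq> (\<lambda>g. K #> g) ` ?N" using S by blast
  ultimately have N: "N_subgroup UQ (G Mod K) act_Q V \<subseteq> (\<lambda>g. K #> g) ` ?N"
    unfolding N_subgroup_def[of UQ] by (intro h.H.generate_subgroup_incl)
  have "(\<lambda>g. K #> g) ` ?N \<subseteq> U_set UQ (G Mod K) act_Q W"
  proof (rule image_subsetI)
    fix n assume n: "n \<in> ?N"
    have nc: "n \<in> carrier G" using subgroup.mem_carrier[OF N_sub n] .
    have "(q y, act_Q (K #> n) (q y)) \<in> W" if y: "y \<in> topspace Y" for y
    proof -
      have "(y, \<phi> n y) \<in> ?E" using F(3) n y unfolding U_set_def carrier_uniformity by blast
      then show ?thesis using act_Q_coset[OF nc y] by simp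
    qed
    then show "K #> n \<in> U_set UQ (G Mod K) act_Q W" unfolding U_set_def car carrier_Mod using nc by blast
  qed
  with N have "N_subgroup UQ (G Mod K) act_Q V \<subseteq> U_set UQ (G Mod K) act_Q W" by (rule subset_trans)
  then show "\<exists>F\<in>UQ. N_subgroup UQ (G Mod K) act_Q F \<subseteq> U_set UQ (G Mod K) act_Q W" using V by (rule bexI)
qed

text \<open>
  All ingredients of a generalized regular covering pass to the quotient by a normal
  subgroup with closed orbits.
\<close>

lemma quotient_prodiscrete_quotient:
  "prodiscrete_quotient (utopology UQ) (G Mod K) act_Q X (quotient_projection f)"
  unfolding prodiscrete_quotient_def prodiscrete_quotient_axioms_def isomorphic_action_def
    UQ_compact_uniformity[symmetric]
  using compact_UQ metrizable_UQ acts_isomorphically_Q[OF free nonempty] compact_X metrizable_X nonempty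
    quotient_isomorphic_quotient_map quotient_prodiscrete by (simp add: topspace_UQ)

lemma quotient_generalized_regular_covering:
  "generalized_regular_covering UQ (G Mod K) act_Q (compact_uniformity X) (quotient_projection f)"
  using prodiscrete_quotient.generalized_regular_covering[OF quotient_prodiscrete_quotient]
  unfolding UQ_compact_uniformity[symmetric] .

lemma quotient_continuum: "connected_space Y \<Longrightarrow> continuum (utopology UQ)"
  using connected_space_image[OF _ continuous_q] compact_UQ metrizable_UQ topspace_UQ by (simp add: continuum_def)

end

lemma (in prodiscrete_quotient) closed_normal_subgroup:
  assumes "K \<lhd> G" "\<And>y. y \<in> topspace Y \<Longrightarrow> closedin Y (orbit (G\<lparr>carrier := K\<rparr>) \<phi> y)"
  shows "prodiscrete_quotient_normal Y G \<phi> X f K"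
  using assms prodiscrete_quotient_axioms isomorphic_action_axioms normal_imp_subgroup[OF assms(1)]
  by (simp add: prodiscrete_quotient_normal_def isomorphic_action_normal_def isomorphic_action_normal_axioms_def
      isomorphic_action_subgroup_def isomorphic_action_subgroup_axioms_def)


section \<open>Covers of a continuum by continua\<close>

text \<open>
  Deck transformations, without extensionality.
\<close>

definition over_homeomorphism :: "'y topology \<Rightarrow> ('y \<Rightarrow> 'x) \<Rightarrow> ('y \<Rightarrow> 'y) \<Rightarrow> bool" where
  "over_homeomorphism P f t \<longleftrightarrow> homeomorphic_map P P t \<and> (\<forall>w\<in>topspace P. f (t w) = f w)"

text \<open>
  The saturation of an open set is the union of its translates, and a continuous map from a
  compact space onto a Hausdorff space is a quotient map.
\<close>

lemma open_map_orbit_map: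
  assumes "compact_space P" "Hausdorff_space X" "continuous_map P X f" "f ` topspace P = topspace X"
    and trans: "\<And>y z. y \<in> topspace P \<Longrightarrow> z \<in> topspace P \<Longrightarrow> f y = f z \<Longrightarrow> \<exists>t. over_homeomorphism P f t \<and> t y = z"
  shows "open_map P X f"
  unfolding open_map_def
proof (intro allI impI)
  fix U assume U: "openin P U"
  have UP: "U \<subseteq> topspace P" using openin_subset[OF U] .
  have "openin P {y \<in> topspace P. f y \<in> f ` U}"
  proof (subst openin_subopen, intro ballI)
    fix y assume "y \<in> {y \<in> topspace P. f y \<in> f ` U}"
    then obtain u where u: "u \<in> U" "f u = f y" and y: "y \<in> topspace P" by auto
    then obtain t where t: "over_homeomorphism P f t" "t u = y" using trans[of u y] UP by blast
    have hom: "homeomorphic_map P P t" and ft: "\<And>w. w \<in> topspace P \<Longrightarrow> f (t w) = f w"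
      using t(1) by (auto simp: over_homeomorphism_def)
    have "openin P (t ` U)" using homeomorphic_map_openness[OF hom UP] U by simp
    moreover have "y \<in> t ` U" using u(1) t(2) by blast
    moreover have "t ` U \<subseteq> {y \<in> topspace P. f y \<in> f ` U}"
      using ft UP openin_subset[OF \<open>openin P (t ` U)\<close>] by auto
    ultimately show "\<exists>T. openin P T \<and> y \<in> T \<and> T \<subseteq> {y \<in> topspace P. f y \<in> f ` U}" by (intro exI conjI)
  qed
  moreover have "f ` U \<subseteq> topspace X" using UP assms(4) by blast
  ultimately show "openin X (f ` U)"
    using T1_Spaces.continuous_imp_quotient_map[OF assms(3,1,2,4)] unfolding quotient_map_def by simp
qed

lemma homeomorphic_map_inverse:
  assumes "homeomorphic_map P Q h"
  shows "homeomorphic_map Q P (inv_into (topspace P) h)"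
    "y \<in> topspace P \<Longrightarrow> inv_into (topspace P) h (h y) = y"
    "z \<in> topspace Q \<Longrightarrow> h (inv_into (topspace P) h z) = z"
    "z \<in> topspace Q \<Longrightarrow> inv_into (topspace P) h z \<in> topspace P"
proof -
  obtain g where g: "homeomorphic_maps P Q h g" using assms homeomorphic_map_maps by blast
  have inj: "inj_on h (topspace P)" and im: "h ` topspace P = topspace Q"
    using homeomorphic_imp_injective_map[OF assms] homeomorphic_imp_surjective_map[OF assms] .
  have gP: "homeomorphic_map Q P g" "\<And>z. z \<in> topspace Q \<Longrightarrow> h (g z) = z" "\<And>z. z \<in> topspace Q \<Longrightarrow> g z \<in> topspace P"
    using g homeomorphic_maps_map[of P Q h g] homeomorphic_imp_surjective_map[of Q P g] by auto
  show "y \<in> topspace P \<Longrightarrow> inv_into (topspace P) h (h y) = y" using inj by simp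
  show "z \<in> topspace Q \<Longrightarrow> h (inv_into (topspace P) h z) = z" using im by (simp add: f_inv_into_f)
  show "z \<in> topspace Q \<Longrightarrow> inv_into (topspace P) h z \<in> topspace P" using im inv_into_into by metis
  have "g z = inv_into (topspace P) h z" if "z \<in> topspace Q" for z
    using inv_into_f_f[OF inj gP(3)[OF that]] gP(2)[OF that] by simp
  then show "homeomorphic_map Q P (inv_into (topspace P) h)" using homeomorphic_map_eq[OF gP(1)] by blast
qed

text \<open>
  A description of regular coverings of a continuum by compact spaces that mentions no
  group: the map is locally injective and deck transformations act transitively on its
  fibres.  If the total space is connected, the group is recovered as the group of all deck
  transformations.
\<close>

locale normal_covering =
  fixes P :: "'y topology" and X :: "'x topology" and f :: "'y \<Rightarrow> 'x"
  assumes compact: "compact_space P" and metrizable: "metrizable_space P" and continuum_X: "continuum X"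
    and f_continuous: "continuous_map P X f" and f_image: "f ` topspace P = topspace X"
    and locally_injective: "\<And>y. y \<in> topspace P \<Longrightarrow> \<exists>V. openin P V \<and> y \<in> V \<and> inj_on f V"
    and transitive: "\<And>y z. y \<in> topspace P \<Longrightarrow> z \<in> topspace P \<Longrightarrow> f y = f z \<Longrightarrow> \<exists>t. over_homeomorphism P f t \<and> t y = z"
begin

lemma compact_X: "compact_space X" and metrizable_X: "metrizable_space X" and connected_X: "connected_space X"
  using continuum_X by (simp_all add: continuum_def)

lemma Hausdorff: "Hausdorff_space P" and Hausdorff_X: "Hausdorff_space X"
  using metrizable metrizable_X metrizable_imp_Hausdorff_space by blast+

lemma f_surj: "x \<in> topspace X \<Longrightarrow> \<exists>y\<in>topspace P. f y = x"
  unfolding f_image[symmetric] by (erule imageE) blast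

lemma f_open: "open_map P X f"
  using open_map_orbit_map[OF compact Hausdorff_X f_continuous f_image] transitive by blast

text \<open>
  The set where two lifts agree is closed as the target is Hausdorff, and open as the map is
  locally injective.
\<close>

lemma unique_lift:
  assumes "connected_space Z" "continuous_map Z P u" "continuous_map Z P v"
    and over: "\<And>z. z \<in> topspace Z \<Longrightarrow> f (u z) = f (v z)"
    and z0: "z0 \<in> topspace Z" "u z0 = v z0" and z: "z \<in> topspace Z"
  shows "u z = v z"
proof -
  let ?A = "{z \<in> topspace Z. u z = v z}"
  have "closedin Z ?A" using closedin_continuous_maps_eq[OF Hausdorff assms(2,3)] .
  moreover have "openin Z ?A"
  proof (subst openin_subopen, intro ballI)
    fix w assume w: "w \<in> ?A"
    then have "u w \<in> topspace P" using continuous_map_image_subset_topspace[OF assms(2)] by blast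
    then obtain V where V: "openin P V" "u w \<in> V" "inj_on f V" using locally_injective by blast
    let ?W = "{z \<in> topspace Z. u z \<in> V} \<inter> {z \<in> topspace Z. v z \<in> V}"
    have "openin Z ?W"
      using openin_continuous_map_preimage[OF assms(2) V(1)] openin_continuous_map_preimage[OF assms(3) V(1)] by blast
    moreover have "w \<in> ?W" using w V(2) by auto
    moreover have "?W \<subseteq> ?A" using over V(3) by (auto dest: inj_onD)
    ultimately show "\<exists>T. openin Z T \<and> w \<in> T \<and> T \<subseteq> ?A" by blast
  qed
  moreover have "?A \<noteq> {}" using z0 by blast
  ultimately have "?A = topspace Z" using assms(1) unfolding connected_space_clopen_in by blast
  then show ?thesis using z by blast
qed

text \<open>
  A finite cover of the compact total space by sets on which \<open>f\<close> is injective
  meets a fibre in finitely many points.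
\<close>

lemma finite_fibre: "finite {y \<in> topspace P. f y = x}"
proof -
  obtain V where V: "\<And>y. y \<in> topspace P \<Longrightarrow> openin P (V y) \<and> y \<in> V y \<and> inj_on f (V y)"
    using locally_injective by metis
  obtain A where A: "finite A" "A \<subseteq> topspace P" "topspace P \<subseteq> (\<Union>y\<in>A. V y)"
    using compact_space_finite_subcover[OF compact, of V] V by metis
  have "finite (V y \<inter> {y \<in> topspace P. f y = x})" if "y \<in> A" for y
  proof (rule finite_imageD[of f])
    show "finite (f ` (V y \<inter> {y \<in> topspace P. f y = x}))" by (rule finite_subset[of _ "{x}"]) auto
    show "inj_on f (V y \<inter> {y \<in> topspace P. f y = x})" using V A(2) that by (meson inf_le1 inj_on_subset subsetD)
  qed
  then have "finite (\<Union>y\<in>A. V y \<inter> {y \<in> topspace P. f y = x})" using A(1) by blast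
  moreover have "{y \<in> topspace P. f y = x} \<subseteq> (\<Union>y\<in>A. V y \<inter> {y \<in> topspace P. f y = x})" using A(3) by blast
  ultimately show ?thesis by (rule rev_finite_subset)
qed

lemma injective_entourage:
  obtains M where "M \<in> diag_nhds P" "\<And>a b. (a, b) \<in> M \<Longrightarrow> f a = f b \<Longrightarrow> a = b"
proof -
  let ?M = "{(a, b). a \<in> topspace P \<and> b \<in> topspace P \<and> (f a = f b \<longrightarrow> a = b)}"
  have "?M \<in> diag_nhds P"
  proof (rule diag_nhdsI)
    fix y assume "y \<in> topspace P"
    then obtain V where V: "openin P V" "y \<in> V" "inj_on f V" using locally_injective by blast
    have "V \<times> V \<subseteq> ?M" using openin_subset[OF V(1)] V(3) by (auto dest: inj_onD)
    then show "\<exists>V. openin P V \<and> y \<in> V \<and> V \<times> V \<subseteq> ?M" using V(1,2) by (intro exI[of _ V]) simp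
  qed (auto simp: sym_def)
  then show thesis by (rule that) auto
qed

end

locale normal_cover = normal_covering P X f
  for P :: "'y topology" and X :: "'x topology" and f +
  assumes connected: "connected_space P"
begin

lemma continuum_P: "continuum P"
  using compact metrizable connected by (simp add: continuum_def)

lemma over_homeomorphism_unique:
  assumes "over_homeomorphism P f t" "over_homeomorphism P f s" "y \<in> topspace P" "t y = s y" "z \<in> topspace P"
  shows "t z = s z"
  using unique_lift[OF connected, of t s y z] assms homeomorphic_imp_continuous_map
  unfolding over_homeomorphism_def by auto

definition "Deck = {t \<in> extensional (topspace P). over_homeomorphism P f t}"
definition "Deck_group = (BijGroup (topspace P))\<lparr>carrier := Deck\<rparr>"

lemma Deck_transitive:
  assumes "y \<in> topspace P" "z \<in> topspace P" "f y = f z" shows "\<exists>t\<in>Deck. t y = z"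
proof -
  obtain t where t: "over_homeomorphism P f t" "t y = z" using transitive[OF assms] by blast
  have "over_homeomorphism P f (restrict t (topspace P))"
    using t(1) homeomorphic_map_eq[of P P t "restrict t (topspace P)"] by (auto simp: over_homeomorphism_def)
  then show ?thesis using t(2) assms(1) by (intro bexI[of _ "restrict t (topspace P)"]) (auto simp: Deck_def)
qed

lemma Deck_closed: "t \<in> Deck \<Longrightarrow> y \<in> topspace P \<Longrightarrow> t y \<in> topspace P"
  and Deck_over: "t \<in> Deck \<Longrightarrow> y \<in> topspace P \<Longrightarrow> f (t y) = f y"
  and Deck_homeomorphic_map: "t \<in> Deck \<Longrightarrow> homeomorphic_map P P t"
  using homeomorphic_imp_surjective_map[of P P t] by (auto simp: Deck_def over_homeomorphism_def)

lemma Deck_eqI: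
  assumes "t \<in> Deck" "s \<in> Deck" "y \<in> topspace P" "t y = s y" shows "t = s"
proof (rule extensionalityI[of _ "topspace P"])
  show "t \<in> extensional (topspace P)" "s \<in> extensional (topspace P)" using assms(1,2) by (auto simp: Deck_def)
  show "t z = s z" if "z \<in> topspace P" for z
    using over_homeomorphism_unique[of t s y z] assms that by (auto simp: Deck_def)
qed

lemma subgroup_Deck: "subgroup Deck (BijGroup (topspace P))"
proof (rule group.subgroupI[OF group_BijGroup])
  have Bij: "t \<in> Bij (topspace P)" if t: "t \<in> Deck" for t
  proof -
    have "t \<in> extensional (topspace P)" "homeomorphic_map P P t"
      using t by (simp_all add: Deck_def over_homeomorphism_def)
    then show ?thesis
      using homeomorphic_imp_surjective_map[of P P t] homeomorphic_imp_injective_map[of P P t]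
      by (simp add: Bij_def bij_betw_def)
  qed
  show "Deck \<subseteq> carrier (BijGroup (topspace P))" using Bij by (simp add: BijGroup_def subsetI)
  have "restrict id (topspace P) \<in> Deck"
    using homeomorphic_map_eq[of P P id "restrict id (topspace P)"] by (auto simp: Deck_def over_homeomorphism_def)
  then show "Deck \<noteq> {}" by blast
  fix t assume t: "t \<in> Deck"
  have hom: "homeomorphic_map P P t" and over: "\<And>w. w \<in> topspace P \<Longrightarrow> f (t w) = f w"
    using t by (auto simp: Deck_def over_homeomorphism_def)
  note inv = homeomorphic_map_inverse[OF hom]
  have "restrict (inv_into (topspace P) t) (topspace P) \<in> Deck"
    using homeomorphic_map_eq[OF inv(1), of "restrict (inv_into (topspace P) t) (topspace P)"] over[OF inv(4)] inv(3)
    by (auto simp: Deck_def over_homeomorphism_def)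
  then show "inv\<^bsub>BijGroup (topspace P)\<^esub> t \<in> Deck" using inv_BijGroup[OF Bij[OF t]] by simp
  fix s assume s: "s \<in> Deck"
  have "homeomorphic_map P P (t \<circ> s)"
    using homeomorphic_map_compose[of P P s P t] hom s by (auto simp: Deck_def over_homeomorphism_def)
  then have "homeomorphic_map P P (compose (topspace P) t s)"
    by (rule homeomorphic_map_eq) (simp add: compose_def)
  then have "compose (topspace P) t s \<in> Deck"
    using Deck_over[OF t Deck_closed[OF s]] Deck_over[OF s] by (simp add: Deck_def over_homeomorphism_def compose_def)
  then show "t \<otimes>\<^bsub>BijGroup (topspace P)\<^esub> s \<in> Deck" using Bij[OF t] Bij[OF s] by (simp add: BijGroup_def)
qed

text \<open>
  The image of an open set \<open>N\<close> on which \<open>f\<close> is injective is evenly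
  covered, with the translates of \<open>N\<close> as sheets; two translates that meet are
  equal because \<open>f\<close> is injective on \<open>N\<close>.
\<close>

lemma covering: "covering_map P X f"
  unfolding covering_map_def
proof (intro conjI ballI f_continuous f_image)
  fix x assume "x \<in> topspace X"
  then obtain y where y: "y \<in> topspace P" "f y = x" using f_surj by blast
  obtain N where N: "openin P N" "y \<in> N" "inj_on f N" using locally_injective[OF y(1)] by blast
  have NP: "N \<subseteq> topspace P" using openin_subset[OF N(1)] .
  have fN: "openin X (f ` N)" using f_open N(1) by (simp add: open_map_def)
  let ?\<V> = "(\<lambda>t. t ` N) ` Deck"
  have tN: "openin P (t ` N)" if "t \<in> Deck" for t
    using homeomorphic_map_openness[OF Deck_homeomorphic_map[OF that] NP] N(1) by simp
  have ftN: "f ` t ` N = f ` N" if "t \<in> Deck" for t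
    unfolding image_image using Deck_over[OF that] NP by (intro image_cong) auto
  have inj: "inj_on f (t ` N)" if t: "t \<in> Deck" for t
  proof (rule inj_onI)
    fix a b assume "a \<in> t ` N" "b \<in> t ` N" "f a = f b"
    then obtain c d where cd: "c \<in> N" "d \<in> N" "a = t c" "b = t d" "f (t c) = f (t d)" by blast
    have "c \<in> topspace P" "d \<in> topspace P" using cd NP by auto
    then have "f c = f d" using cd(5) Deck_over[OF t] by simp
    then show "a = b" using cd N(3) by (metis inj_onD)
  qed
  show "\<exists>T. x \<in> T \<and> openin X T \<and> (\<exists>\<V>. \<Union>\<V> = {y \<in> topspace P. f y \<in> T} \<and> (\<forall>V\<in>\<V>. openin P V) \<and>
          pairwise disjnt \<V> \<and> (\<forall>V\<in>\<V>. homeomorphic_map (subtopology P V) (subtopology X T) f))"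
  proof (intro exI[of _ "f ` N"] exI[of _ ?\<V>] conjI)
    show "x \<in> f ` N" using y N(2) by blast
    show "openin X (f ` N)" by (rule fN)
    show "\<Union>?\<V> = {y \<in> topspace P. f y \<in> f ` N}"
    proof (rule equalityI; rule subsetI)
      fix z assume "z \<in> \<Union>?\<V>"
      then obtain t where t: "t \<in> Deck" "z \<in> t ` N" by blast
      then have "f z \<in> f ` N" using ftN by blast
      then show "z \<in> {y \<in> topspace P. f y \<in> f ` N}" using t openin_subset[OF tN] by blast
    next
      fix z assume "z \<in> {y \<in> topspace P. f y \<in> f ` N}"
      then obtain n where n: "n \<in> N" "f n = f z" "z \<in> topspace P" by auto
      then obtain t where "t \<in> Deck" "t n = z" using Deck_transitive[of n z] NP by blast
      then show "z \<in> \<Union>?\<V>" using n(1) by blast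
    qed
    show "\<forall>V\<in>?\<V>. openin P V" using tN by blast
    show "pairwise disjnt ?\<V>"
    proof (rule pairwiseI)
      fix A B assume "A \<in> ?\<V>" "B \<in> ?\<V>" "A \<noteq> B"
      then obtain t s where ts: "t \<in> Deck" "s \<in> Deck" "A = t ` N" "B = s ` N" by blast
      show "disjnt A B"
      proof (rule ccontr)
        assume "\<not> disjnt A B"
        then obtain a b where ab: "a \<in> N" "b \<in> N" "t a = s b" using ts unfolding disjnt_iff by blast
        have aP: "a \<in> topspace P" and bP: "b \<in> topspace P" using ab NP by auto
        have "f a = f b" using ab(3) Deck_over[OF ts(1) aP] Deck_over[OF ts(2) bP] by simp
        then have "a = b" using ab N(3) by (meson inj_onD)
        then have "t = s" using Deck_eqI[OF ts(1,2) aP] ab(3) by simp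
        then show False using ts \<open>A \<noteq> B\<close> by simp
      qed
    qed
    show "\<forall>V\<in>?\<V>. homeomorphic_map (subtopology P V) (subtopology X (f ` N)) f"
    proof
      fix V assume "V \<in> ?\<V>"
      then obtain t where t: "t \<in> Deck" "V = t ` N" by blast
      have V: "topspace (subtopology P V) = V" using openin_subset[OF tN[OF t(1)]] t(2) by auto
      show "homeomorphic_map (subtopology P V) (subtopology X (f ` N)) f"
      proof (rule bijective_open_imp_homeomorphic_map)
        show "continuous_map (subtopology P V) (subtopology X (f ` N)) f"
          using ftN[OF t(1)] t(2) V continuous_map_from_subtopology[OF f_continuous, of V]
          by (auto simp: continuous_map_in_subtopology)
        show "open_map (subtopology P V) (subtopology X (f ` N)) f"
          using open_map_from_subtopology[OF f_open tN[OF t(1)]] ftN[OF t(1)] t(2) V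
          by (intro open_map_into_subtopology) auto
        show "f ` topspace (subtopology P V) = topspace (subtopology X (f ` N))"
          using V ftN[OF t(1)] t(2) openin_subset[OF fN] by auto
        show "inj_on f (topspace (subtopology P V))" using V inj[OF t(1)] t(2) by simp
      qed
    qed
  qed
qed

lemma Deck_group_cover:
  "cover_by_continuum X \<lparr>cov_space = P, cov_group = Deck_group, cov_act = (\<lambda>t. t), cov_map = f, cov_base = b\<rparr>"
proof -
  let ?B = "BijGroup (topspace P)"
  have grp: "group Deck_group"
    unfolding Deck_group_def using subgroup.subgroup_is_group[OF subgroup_Deck group_BijGroup] .
  have carB: "Deck \<subseteq> Bij (topspace P)" using subgroup.subset[OF subgroup_Deck] by (simp add: BijGroup_def)
  have "faithful_action Deck_group (topspace P) (\<lambda>t. t)"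
  proof (rule faithful_actionI[OF grp])
    show "t y \<in> topspace P" if "t \<in> carrier Deck_group" "y \<in> topspace P" for t y
      using that Deck_closed by (simp add: Deck_group_def)
    show "t \<in> extensional (topspace P)" if "t \<in> carrier Deck_group" for t
      using that by (simp add: Deck_group_def Deck_def)
    show one: "\<one>\<^bsub>Deck_group\<^esub> y = y" if "y \<in> topspace P" for y
      using that by (simp add: Deck_group_def BijGroup_def)
    show "(t \<otimes>\<^bsub>Deck_group\<^esub> s) y = t (s y)" if "t \<in> carrier Deck_group" "s \<in> carrier Deck_group" "y \<in> topspace P" for t s y
      using that carB by (auto simp: Deck_group_def BijGroup_def compose_def)
    show "t = \<one>\<^bsub>Deck_group\<^esub>" if "t \<in> carrier Deck_group" "\<And>y. y \<in> topspace P \<Longrightarrow> t y = y" for t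
      using that by (intro extensionalityI[of _ "topspace P"]) (auto simp: Deck_group_def BijGroup_def Deck_def)
  qed
  moreover have "\<forall>t\<in>carrier Deck_group. homeomorphic_map P P t"
    using Deck_homeomorphic_map by (simp add: Deck_group_def)
  moreover have "t = \<one>\<^bsub>Deck_group\<^esub>" if t: "t \<in> carrier Deck_group" "y \<in> topspace P" "t y = y" for t y
  proof (rule Deck_eqI[of _ _ y])
    show "t \<in> Deck" using t by (simp add: Deck_group_def)
    show "\<one>\<^bsub>Deck_group\<^esub> \<in> Deck" using monoid.one_closed[OF group.is_monoid[OF grp]] by (simp add: Deck_group_def)
    show "t y = \<one>\<^bsub>Deck_group\<^esub> y" using t by (simp add: Deck_group_def BijGroup_def)
  qed (use t in simp)
  moreover have "quotient_map P X f"
    using T1_Spaces.continuous_imp_quotient_map[OF f_continuous compact Hausdorff_X f_image] .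
  moreover have "fibres_are_orbits (topspace P) Deck_group (\<lambda>t. t) f"
    unfolding fibres_are_orbits_def orbit_def Deck_group_def
    using Deck_transitive Deck_over by (auto 4 4)
  ultimately show ?thesis
    unfolding cover_by_continuum_def regular_covering_map_def using continuum_P covering by simp
qed

end


lemma ex_homeomorphic_image:
  assumes "inj_on e (topspace P)"
  obtains P' where "homeomorphic_map P P' e"
proof -
  define P' where "P' = pullback_topology (e ` topspace P) (inv_into (topspace P) e) P"
  have inv: "inv_into (topspace P) e (e y) = y" if "y \<in> topspace P" for y using assms that by simp
  have tP': "topspace P' = e ` topspace P"
    unfolding P'_def topspace_pullback_topology using inv by auto
  have op: "openin P' (e ` U)" if U: "openin P U" for U
  proof -
    have "e ` U = inv_into (topspace P) e -` U \<inter> e ` topspace P"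
      using inv openin_subset[OF U] by (auto simp: image_iff)
    then show ?thesis unfolding P'_def openin_pullback_topology using U by blast
  qed
  have "homeomorphic_map P P' e"
  proof (rule bijective_open_imp_homeomorphic_map)
    show "open_map P P' e" using op by (simp add: open_map_def)
    show "continuous_map P P' e"
      unfolding continuous_map_def tP'
    proof (intro conjI allI impI)
      fix S assume "openin P' S"
      then obtain U where U: "openin P U" "S = inv_into (topspace P) e -` U \<inter> e ` topspace P"
        unfolding P'_def openin_pullback_topology by blast
      have "e y \<in> S \<longleftrightarrow> y \<in> U" if "y \<in> topspace P" for y unfolding U(2) using inv[OF that] that by simp
      then have "{y \<in> topspace P. e y \<in> S} = U" using openin_subset[OF U(1)] by blast
      then show "openin P {y \<in> topspace P. e y \<in> S}" using U(1) by simp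
    qed simp
  qed (simp_all add: tP' assms)
  then show thesis by (rule that)
qed

lemma (in normal_cover) homeomorphic_normal_cover:
  assumes e: "homeomorphic_map P P' e" and f': "\<And>y. y \<in> topspace P \<Longrightarrow> f' (e y) = f y"
  shows "normal_cover P' X f'"
proof
  let ?d = "inv_into (topspace P) e"
  note d = homeomorphic_map_inverse[OF e]
  have eP: "e ` topspace P = topspace P'" using homeomorphic_imp_surjective_map[OF e] .
  have f'd: "f' z = f (?d z)" if "z \<in> topspace P'" for z using f'[OF d(4)[OF that]] d(3)[OF that] by simp
  have hs: "P homeomorphic_space P'" using e homeomorphic_map_imp_homeomorphic_space by blast
  show "compact_space P'" "metrizable_space P'" "connected_space P'"
    using compact metrizable connected
      homeomorphic_compact_space[OF hs] homeomorphic_connected_space[OF hs] homeomorphic_metrizable_space[OF hs]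
    by simp_all
  show "continuum X" by (rule continuum_X)
  show "continuous_map P' X f'"
  proof (rule continuous_map_eq)
    show "continuous_map P' X (f \<circ> ?d)"
      using continuous_map_compose[OF homeomorphic_imp_continuous_map[OF d(1)] f_continuous] .
    show "(f \<circ> ?d) z = f' z" if "z \<in> topspace P'" for z using f'd[OF that] by simp
  qed
  show "f' ` topspace P' = topspace X"
    unfolding eP[symmetric] f_image[symmetric] image_image using f' by (intro image_cong) simp_all
  fix y assume y: "y \<in> topspace P'"
  show "\<exists>V. openin P' V \<and> y \<in> V \<and> inj_on f' V"
  proof -
    obtain V where V: "openin P V" "?d y \<in> V" "inj_on f V" using locally_injective[OF d(4)[OF y]] by blast
    have VP: "V \<subseteq> topspace P" using openin_subset[OF V(1)] .
    have "openin P' (e ` V)" using homeomorphic_map_openness[OF e VP] V(1) by simp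
    moreover have "y \<in> e ` V" using V(2) d(3)[OF y] by (metis imageI)
    moreover have "inj_on f' (e ` V)"
    proof (rule inj_onI)
      fix a b assume "a \<in> e ` V" "b \<in> e ` V" "f' a = f' b"
      then obtain c e' where c: "c \<in> V" "e' \<in> V" "a = e c" "b = e e'" "f' (e c) = f' (e e')" by blast
      then have "f c = f e'" using f' VP by (simp add: subset_iff)
      then show "a = b" using c V(3) by (metis inj_onD)
    qed
    ultimately show ?thesis by (intro exI conjI)
  qed
  fix z assume z: "z \<in> topspace P'" and yz: "f' y = f' z"
  show "\<exists>t. over_homeomorphism P' f' t \<and> t y = z"
  proof -
    obtain t where t: "over_homeomorphism P f t" "t (?d y) = ?d z"
      using transitive[OF d(4)[OF y] d(4)[OF z]] yz f'd[OF y] f'd[OF z] by auto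
    have tP: "homeomorphic_map P P t" using t(1) by (simp add: over_homeomorphism_def)
    have "homeomorphic_map P' P' (e \<circ> (t \<circ> ?d))"
      using homeomorphic_map_compose[OF homeomorphic_map_compose[OF d(1) tP] e] .
    moreover have "f' (e (t (?d w))) = f' w" if w: "w \<in> topspace P'" for w
    proof -
      have dw: "?d w \<in> topspace P" using d(4)[OF w] .
      have "t (?d w) \<in> topspace P" using dw homeomorphic_imp_surjective_map[OF tP] by blast
      then show ?thesis using f' t(1) dw f'd[OF w] by (simp add: over_homeomorphism_def)
    qed
    ultimately have "over_homeomorphism P' f' (e \<circ> (t \<circ> ?d))" by (simp add: over_homeomorphism_def)
    then show ?thesis using t(2) d(3)[OF z] by (intro exI[of _ "e \<circ> (t \<circ> ?d)"]) simp
  qed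
qed

locale cover =
  fixes X :: "'x topology" and C :: "('y, 'g, 'x) pointed_cover"
  assumes continuum_base: "continuum X" and base_nonempty: "topspace X \<noteq> {}"
    and cover: "cover_by_continuum X C"
begin

lemma regular: "regular_covering_map (cov_space C) (cov_group C) (cov_act C) X (cov_map C)"
  using cover by (simp add: cover_by_continuum_def)

sublocale faithful_action "cov_group C" "topspace (cov_space C)" "cov_act C"
  using regular by (simp add: regular_covering_map_def)

lemma fibre:
  assumes "y \<in> topspace (cov_space C)" "z \<in> topspace (cov_space C)"
  shows "cov_map C y = cov_map C z \<longleftrightarrow> (\<exists>g\<in>carrier (cov_group C). z = cov_act C g y)"
proof -
  have "cov_map C y = cov_map C z \<longleftrightarrow> z \<in> orbit (cov_group C) (cov_act C) y"
    using regular assms unfolding regular_covering_map_def fibres_are_orbits_def by blast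
  then show ?thesis unfolding orbit_def by blast
qed

lemma over: "g \<in> carrier (cov_group C) \<Longrightarrow> y \<in> topspace (cov_space C) \<Longrightarrow> cov_map C (cov_act C g y) = cov_map C y"
  using fibre[of y "cov_act C g y"] act_closed[of g y] by metis

lemma free_act:
  assumes "g \<in> carrier (cov_group C)" "h \<in> carrier (cov_group C)" "y \<in> topspace (cov_space C)" "cov_act C g y = cov_act C h y"
  shows "g = h"
  using act_eq_imp_eq[OF assms] regular[unfolded regular_covering_map_def] assms(3) by blast

lemma act_homeomorphic: "g \<in> carrier (cov_group C) \<Longrightarrow> homeomorphic_map (cov_space C) (cov_space C) (cov_act C g)"
  using regular by (simp add: regular_covering_map_def)

sublocale normal_cover "cov_space C" X "cov_map C"
proof
  have cov: "covering_map (cov_space C) X (cov_map C)" using regular by (simp add: regular_covering_map_def)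
  show "compact_space (cov_space C)" "metrizable_space (cov_space C)" "connected_space (cov_space C)"
    using cover by (simp_all add: cover_by_continuum_def continuum_def)
  show "continuum X" by (rule continuum_base)
  show "continuous_map (cov_space C) X (cov_map C)" "cov_map C ` topspace (cov_space C) = topspace X"
    using cov by (simp_all add: covering_map_def)
  fix y assume y: "y \<in> topspace (cov_space C)"
  show "\<exists>V. openin (cov_space C) V \<and> y \<in> V \<and> inj_on (cov_map C) V"
  proof -
    have fy: "cov_map C y \<in> topspace X"
      using cov y continuous_map_image_subset_topspace[of "cov_space C" X "cov_map C"] unfolding covering_map_def by auto
    obtain T \<V> where T: "cov_map C y \<in> T" "\<Union>\<V> = {y \<in> topspace (cov_space C). cov_map C y \<in> T}"
      "\<forall>V\<in>\<V>. openin (cov_space C) V" "\<forall>V\<in>\<V>. homeomorphic_map (subtopology (cov_space C) V) (subtopology X T) (cov_map C)"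
      using cov[unfolded covering_map_def, THEN conjunct2, THEN conjunct2, THEN bspec, OF fy]
      by (elim exE conjE) (rule that)
    have "y \<in> \<Union>\<V>" unfolding T(2) using T(1) y by simp
    then obtain V where V: "V \<in> \<V>" "y \<in> V" by blast
    have "openin (cov_space C) V" using T(3) V by blast
    moreover have "inj_on (cov_map C) V"
      using homeomorphic_imp_injective_map[OF T(4)[rule_format, OF V(1)]] openin_subset[OF \<open>openin (cov_space C) V\<close>]
      by (simp add: inf_absorb2)
    ultimately show ?thesis using V(2) by blast
  qed
  fix z assume z: "z \<in> topspace (cov_space C)" and "cov_map C y = cov_map C z"
  then obtain g where "g \<in> carrier (cov_group C)" "z = cov_act C g y" using fibre[OF y z] by blast
  then show "\<exists>t. over_homeomorphism (cov_space C) (cov_map C) t \<and> t y = z"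
    using act_homeomorphic over by (intro exI[of _ "cov_act C g"]) (simp add: over_homeomorphism_def)
qed

lemma nonempty: "topspace (cov_space C) \<noteq> {}"
  using f_image base_nonempty by (metis image_is_empty)

lemma finite_group: "finite (carrier (cov_group C))"
proof -
  obtain y where y: "y \<in> topspace (cov_space C)" using nonempty by blast
  have "inj_on (\<lambda>g. cov_act C g y) (carrier (cov_group C))" using free_act y by (meson inj_onI)
  moreover have "(\<lambda>g. cov_act C g y) ` carrier (cov_group C) \<subseteq> {z \<in> topspace (cov_space C). cov_map C z = cov_map C y}"
    using act_closed over y by auto
  ultimately show ?thesis using finite_fibre by (meson finite_imageD finite_subset)
qed

end

text \<open>
  Both \<open>h \<circ> g\<close> and \<open>g' \<circ> h\<close> lift the projection of the
  source cover, so they are equal once they agree at one point; transitivity on fibres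
  supplies \<open>g'\<close>, and freeness makes it unique.
\<close>

lemma deck_transfer:
  assumes C: "cover X C" and D: "cover X D"
    and h: "continuous_map (cov_space D) (cov_space C) h"
    and over: "\<And>y. y \<in> topspace (cov_space D) \<Longrightarrow> cov_map C (h y) = cov_map D y"
    and g: "g \<in> carrier (cov_group D)"
  shows "\<exists>!g'. g' \<in> carrier (cov_group C) \<and> (\<forall>y\<in>topspace (cov_space D). cov_act C g' (h y) = h (cov_act D g y))"
proof -
  interpret C: cover X C by fact
  interpret D: cover X D by fact
  have hC: "h y \<in> topspace (cov_space C)" if "y \<in> topspace (cov_space D)" for y
    using continuous_map_image_subset_topspace[OF h] that by blast
  obtain y0 where y0: "y0 \<in> topspace (cov_space D)" using D.nonempty by blast
  have gy0: "cov_act D g y0 \<in> topspace (cov_space D)" using D.act_closed[OF g y0] .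
  have "cov_map C (h y0) = cov_map C (h (cov_act D g y0))" using over[OF y0] over[OF gy0] D.over[OF g y0] by simp
  then obtain g' where g': "g' \<in> carrier (cov_group C)" "h (cov_act D g y0) = cov_act C g' (h y0)"
    using C.fibre[OF hC[OF y0] hC[OF gy0]] by blast
  have "(cov_act C g' \<circ> h) y = (h \<circ> cov_act D g) y" if y: "y \<in> topspace (cov_space D)" for y
  proof (rule C.unique_lift[OF D.connected _ _ _ y0 _ y])
    show "continuous_map (cov_space D) (cov_space C) (cov_act C g' \<circ> h)"
      using continuous_map_compose[OF h homeomorphic_imp_continuous_map[OF C.act_homeomorphic[OF g'(1)]]] .
    show "continuous_map (cov_space D) (cov_space C) (h \<circ> cov_act D g)"
      using continuous_map_compose[OF homeomorphic_imp_continuous_map[OF D.act_homeomorphic[OF g]] h] .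
    show "cov_map C ((cov_act C g' \<circ> h) z) = cov_map C ((h \<circ> cov_act D g) z)" if z: "z \<in> topspace (cov_space D)" for z
      using C.over[OF g'(1) hC[OF z]] over[OF z] over[OF D.act_closed[OF g z]] D.over[OF g z] by simp
    show "(cov_act C g' \<circ> h) y0 = (h \<circ> cov_act D g) y0" using g'(2) by simp
  qed
  then show ?thesis using g'(1) C.free_act[OF _ _ hC[OF y0]] y0 by (intro ex1I[of _ g']) auto
qed

text \<open>
  Transfer of deck transformations along \<open>h\<close> is the required isomorphism of
  groups.
\<close>

lemma homeomorphic_covers_equivalent:
  assumes C: "cover X C" and D: "cover X D"
    and h: "homeomorphic_map (cov_space C) (cov_space D) h"
    and over: "\<And>y. y \<in> topspace (cov_space C) \<Longrightarrow> cov_map D (h y) = cov_map C y"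
  shows "equivalent_covers C D"
proof -
  interpret C: cover X C by fact
  interpret D: cover X D by fact
  have hc: "continuous_map (cov_space C) (cov_space D) h" using homeomorphic_imp_continuous_map[OF h] .
  have hD: "h y \<in> topspace (cov_space D)" if "y \<in> topspace (cov_space C)" for y
    using continuous_map_image_subset_topspace[OF hc] that by blast
  have inj: "inj_on h (topspace (cov_space C))" using homeomorphic_imp_injective_map[OF h] .
  obtain y0 where y0: "y0 \<in> topspace (cov_space C)" using C.nonempty by blast
  define \<theta> where "\<theta> g = (THE g'. g' \<in> carrier (cov_group D) \<and>
     (\<forall>y\<in>topspace (cov_space C). cov_act D g' (h y) = h (cov_act C g y)))" for g
  have \<theta>: "\<theta> g \<in> carrier (cov_group D)" "\<And>y. y \<in> topspace (cov_space C) \<Longrightarrow> cov_act D (\<theta> g) (h y) = h (cov_act C g y)"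
    if g: "g \<in> carrier (cov_group C)" for g
    using theI'[OF deck_transfer[OF D C hc over g]] unfolding \<theta>_def by blast+
  have "\<theta> \<in> hom (cov_group C) (cov_group D)"
  proof (rule homI)
    show "\<theta> g \<in> carrier (cov_group D)" if "g \<in> carrier (cov_group C)" for g using \<theta>(1)[OF that] .
    fix g k assume g: "g \<in> carrier (cov_group C)" and k: "k \<in> carrier (cov_group C)"
    have gk: "g \<otimes>\<^bsub>cov_group C\<^esub> k \<in> carrier (cov_group C)" using monoid.m_closed[OF group.is_monoid[OF C.is_group] g k] .
    have tt: "\<theta> g \<otimes>\<^bsub>cov_group D\<^esub> \<theta> k \<in> carrier (cov_group D)"
      using monoid.m_closed[OF group.is_monoid[OF D.is_group] \<theta>(1)[OF g] \<theta>(1)[OF k]] .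
    have "cov_act D (\<theta> g \<otimes>\<^bsub>cov_group D\<^esub> \<theta> k) (h y0) = cov_act D (\<theta> (g \<otimes>\<^bsub>cov_group C\<^esub> k)) (h y0)"
      using D.composition_rule[OF hD[OF y0] \<theta>(1)[OF g] \<theta>(1)[OF k]] C.composition_rule[OF y0 g k]
        \<theta>(2)[OF k y0] \<theta>(2)[OF g C.act_closed[OF k y0]] \<theta>(2)[OF gk y0] by simp
    then show "\<theta> (g \<otimes>\<^bsub>cov_group C\<^esub> k) = \<theta> g \<otimes>\<^bsub>cov_group D\<^esub> \<theta> k"
      using D.free_act[OF \<theta>(1)[OF gk] tt hD[OF y0]] by simp
  qed
  moreover have "bij_betw \<theta> (carrier (cov_group C)) (carrier (cov_group D))"
    unfolding bij_betw_def
  proof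
    show "inj_on \<theta> (carrier (cov_group C))"
    proof (rule inj_onI)
      fix g k assume gk: "g \<in> carrier (cov_group C)" "k \<in> carrier (cov_group C)" "\<theta> g = \<theta> k"
      have "h (cov_act C g y0) = h (cov_act C k y0)" using \<theta>(2)[OF gk(1) y0] \<theta>(2)[OF gk(2) y0] gk(3) by simp
      then have "cov_act C g y0 = cov_act C k y0"
        using inj C.act_closed[OF gk(1) y0] C.act_closed[OF gk(2) y0] by (meson inj_onD)
      then show "g = k" using C.free_act[OF gk(1,2) y0] by simp
    qed
    show "\<theta> ` carrier (cov_group C) = carrier (cov_group D)"
    proof (rule equalityI; rule subsetI)
      fix k assume k: "k \<in> carrier (cov_group D)"
      have kD: "cov_act D k (h y0) \<in> topspace (cov_space D)" using D.act_closed[OF k hD[OF y0]] .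
      then have "cov_act D k (h y0) \<in> h ` topspace (cov_space C)" using homeomorphic_imp_surjective_map[OF h] by simp
      then obtain y where y: "y \<in> topspace (cov_space C)" "h y = cov_act D k (h y0)" by (metis imageE)
      have "cov_map C y0 = cov_map C y" using over[OF y0] over[OF y(1)] y(2) D.over[OF k hD[OF y0]] by simp
      then obtain g where g: "g \<in> carrier (cov_group C)" "y = cov_act C g y0" using C.fibre[OF y0 y(1)] by blast
      have "k = \<theta> g" using D.free_act[OF k \<theta>(1)[OF g(1)] hD[OF y0]] \<theta>(2)[OF g(1) y0] y(2) g(2) by simp
      then show "k \<in> \<theta> ` carrier (cov_group C)" using g(1) by blast
    qed (use \<theta>(1) in blast)
  qed
  ultimately have "\<theta> \<in> iso (cov_group C) (cov_group D)" by (simp add: iso_def)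
  moreover have "uniform_homeomorphism (compact_uniformity (cov_space C)) (compact_uniformity (cov_space D)) h"
    using uniform_homeomorphism_iff[OF C.compact C.metrizable D.compact D.metrizable] h by blast
  ultimately show ?thesis
    unfolding equivalent_covers_def equivalent_quotients_def
      compact_uniformity_eq[OF C.compact C.metrizable] ucarrier_diag_nhds
    using \<theta>(2) over by (metis (no_types, lifting))
qed

lemma all_covers_by_continuaD:
  fixes C :: "'i \<Rightarrow> ('c, 'd, 'x) pointed_cover" and D :: "('x \<times> nat, 'x \<times> nat \<Rightarrow> 'x \<times> nat, 'x) pointed_cover"
  assumes "all_covers_by_continua X x\<^sub>0 I C"
  shows "x\<^sub>0 \<in> topspace X"
    and "i \<in> I \<Longrightarrow> cover_by_continuum X (C i)"
    and "i \<in> I \<Longrightarrow> cov_base (C i) \<in> topspace (cov_space (C i))"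
    and "i \<in> I \<Longrightarrow> cov_map (C i) (cov_base (C i)) = x\<^sub>0"
    and "i \<in> I \<Longrightarrow> j \<in> I \<Longrightarrow> equivalent_covers (C i) (C j) \<Longrightarrow> i = j"
    and "cover_by_continuum X D \<Longrightarrow> \<exists>i\<in>I. equivalent_covers (C i) D"
proof -
  note a = assms[unfolded all_covers_by_continua_def]
  note b = a[THEN conjunct2] note c = b[THEN conjunct2] note d = c[THEN conjunct1] note e = c[THEN conjunct2]
  show "x\<^sub>0 \<in> topspace X" using a by (rule conjunct1)
  show "cover_by_continuum X (C i)" "cov_base (C i) \<in> topspace (cov_space (C i))" "cov_map (C i) (cov_base (C i)) = x\<^sub>0"
    if "i \<in> I" using b[THEN conjunct1, THEN bspec, OF that] by simp_all
  show "i = j" if "i \<in> I" "j \<in> I" "equivalent_covers (C i) (C j)"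
    using d[THEN bspec, OF that(1), THEN bspec, OF that(2)] that(3) by (rule mp)
  show "\<exists>i\<in>I. equivalent_covers (C i) D" if "cover_by_continuum X D"
    using e[THEN spec, of D] that by (rule mp)
qed

text \<open>
  The representatives cover every cover whose points are pairs in \<open>'x \<times>
  nat\<close>.  A total space of any type has finite fibres, so numbering the points of each
  fibre moves the cover to that type.
\<close>

lemma (in normal_cover) equivalent_cover_exists:
  fixes I :: "'i set" and C :: "'i \<Rightarrow> ('c, 'd, 'x) pointed_cover"
  assumes all: "all_covers_by_continua X x\<^sub>0 I C"
  obtains i h where "i \<in> I" "homeomorphic_map (cov_space (C i)) P h"
    "\<And>y. y \<in> topspace (cov_space (C i)) \<Longrightarrow> f (h y) = cov_map (C i) y"
proof -
  \<comment> \<open>The points of each fibre, being finitely many, are numbered.\<close>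
  define e where "e y = (f y, to_nat_on {z \<in> topspace P. f z = f y} y)" for y
  have "inj_on e (topspace P)"
  proof (rule inj_onI)
    fix y z assume yz: "y \<in> topspace P" "z \<in> topspace P" "e y = e z"
    have "countable {w \<in> topspace P. f w = f y}" using finite_fibre by (rule countable_finite)
    then show "y = z" using yz inj_on_to_nat_on[of "{w \<in> topspace P. f w = f y}"] by (auto simp: e_def dest: inj_onD)
  qed
  then obtain P' where P': "homeomorphic_map P P' e" by (rule ex_homeomorphic_image)
  have "normal_cover P' X fst" by (rule homeomorphic_normal_cover[OF P']) (simp add: e_def)
  then interpret P': normal_cover P' X fst .
  let ?D = "\<lparr>cov_space = P', cov_group = P'.Deck_group, cov_act = (\<lambda>t. t), cov_map = fst, cov_base = undefined\<rparr>"
  have "cover_by_continuum X ?D" by (rule P'.Deck_group_cover)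
  then obtain i where i: "i \<in> I" "equivalent_covers (C i) ?D"
    using all_covers_by_continuaD(6)[OF all] by blast
  have "cover X (C i)"
    using all_covers_by_continuaD(1,2)[OF all] i(1) continuum_X unfolding cover_def by blast
  then interpret Ci: cover X "C i" .
  obtain h where h: "uniform_homeomorphism (compact_uniformity (cov_space (C i))) (compact_uniformity P') h"
    "\<And>y. y \<in> ucarrier (compact_uniformity (cov_space (C i))) \<Longrightarrow> fst (h y) = cov_map (C i) y"
    using i(2) unfolding equivalent_covers_def equivalent_quotients_def by auto
  have hom: "homeomorphic_map (cov_space (C i)) P' h"
    using h(1) uniform_homeomorphism_iff[OF Ci.compact Ci.metrizable P'.compact P'.metrizable] by blast
  have over: "fst (h y) = cov_map (C i) y" if "y \<in> topspace (cov_space (C i))" for y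
    using h(2)[of y] that by (simp add: compact_uniformity_eq[OF Ci.compact Ci.metrizable] ucarrier_diag_nhds)
  note d = homeomorphic_map_inverse[OF P']
  show thesis
  proof (rule that[OF i(1) homeomorphic_map_compose[OF hom d(1)]])
    fix y assume y: "y \<in> topspace (cov_space (C i))"
    have hy: "h y \<in> topspace P'" using homeomorphic_imp_surjective_map[OF hom] y by blast
    have "fst (e (inv_into (topspace P) e (h y))) = f (inv_into (topspace P) e (h y))" by (simp add: e_def)
    then show "f ((inv_into (topspace P) e \<circ> h) y) = cov_map (C i) y" using d(3)[OF hy] over[OF y] by simp
  qed
qed


section \<open>The covers form a countable directed family\<close>

lemma clopen_open_map_image:
  assumes "compact_space T" "Hausdorff_space X" "connected_space X" "continuous_map T X f" "open_map T X f"
    and A: "openin T A" "closedin T A" "A \<noteq> {}"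
  shows "f ` A = topspace X"
proof -
  have "openin X (f ` A)" using assms(5) A(1) by (simp add: open_map_def)
  moreover have "closedin X (f ` A)"
    using T1_Spaces.continuous_imp_closed_map[OF assms(4,1,2)] A(2) by (simp add: closed_map_def)
  ultimately have "f ` A = {} \<or> f ` A = topspace X" using assms(3) unfolding connected_space_clopen_in by blast
  then show ?thesis using A(3) by simp
qed

text \<open>
  Every nonempty clopen set maps onto the connected base and thus meets the finite fibre
  through \<open>p\<close>.  A clopen set containing \<open>p\<close> that meets this fibre
  in as few points as possible is therefore connected.  A deck transformation taking one of
  its points to another one preserves it.
\<close>

lemma (in normal_covering) connected_part:
  assumes p: "p \<in> topspace P"
  obtains A where "openin P A" "closedin P A" "p \<in> A" "normal_cover (subtopology P A) X f"
proof -
  define F where "F = {y \<in> topspace P. f y = f p}"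
  let ?\<A> = "\<lambda>A. openin P A \<and> closedin P A \<and> p \<in> A"
  have "?\<A> (topspace P)" using p by simp
  then obtain A where A: "?\<A> A" and least: "\<And>B. ?\<A> B \<Longrightarrow> card (A \<inter> F) \<le> card (B \<inter> F)"
    using ex_has_least_nat[of ?\<A> "topspace P" "\<lambda>A. card (A \<inter> F)"] by blast
  have finF: "finite F" using finite_fibre unfolding F_def .
  have onto: "f ` B = topspace X" if "openin P B" "closedin P B" "B \<noteq> {}" for B
    using clopen_open_map_image[OF compact Hausdorff_X connected_X f_continuous f_open] that by blast
  have meets: "B \<inter> F \<noteq> {}" if B: "openin P B" "closedin P B" "B \<noteq> {}" for B
  proof -
    have "f p \<in> f ` B" unfolding onto[OF B] using f_image p by blast
    then obtain b where "b \<in> B" "f b = f p" by force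
    then show ?thesis using openin_subset[OF B(1)] unfolding F_def by blast
  qed
  have AP: "A \<subseteq> topspace P" using A openin_subset by blast
  have topA: "topspace (subtopology P A) = A" using AP by auto
  have openA: "openin (subtopology P A) B \<longleftrightarrow> openin P B \<and> B \<subseteq> A" for B
    using A openin_open_subtopology by blast
  have closedA: "closedin (subtopology P A) B \<longleftrightarrow> closedin P B \<and> B \<subseteq> A" for B
    using A closedin_closed_subtopology by blast
  have conn: "connected_space (subtopology P A)"
    unfolding connected_space_clopen_in topA
  proof (intro allI impI, elim conjE)
    fix B assume B: "openin (subtopology P A) B" "closedin (subtopology P A) B"
    have B1: "openin P B" "closedin P B" "B \<subseteq> A" using B openA closedA by blast+
    have B2: "openin P (A - B)" "closedin P (A - B)" using B1 A by (auto intro: openin_diff closedin_diff)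
    \<comment> \<open>A part of \<open>A\<close> containing \<open>p\<close> would lose a point of the fibre to the other part.\<close>
    have part: False if D: "openin P D" "closedin P D" "p \<in> D" "openin P E" "closedin P E" "E \<noteq> {}" "D \<union> E = A" "D \<inter> E = {}" for D E
    proof -
      have "card (A \<inter> F) \<le> card (D \<inter> F)" using least D by blast
      moreover have "D \<inter> F \<subset> A \<inter> F" using meets[OF D(4-6)] D(7,8) by blast
      ultimately show False using psubset_card_mono[of "A \<inter> F" "D \<inter> F"] finF by simp
    qed
    show "B = {} \<or> B = A"
    proof (rule ccontr)
      assume "\<not> (B = {} \<or> B = A)"
      then have ne: "B \<noteq> {}" "A - B \<noteq> {}" using B1 by blast+
      have un: "B \<union> (A - B) = A" "(A - B) \<union> B = A" "B \<inter> (A - B) = {}" "(A - B) \<inter> B = {}" using B1(3) by blast+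
      show False
      proof (cases "p \<in> B")
        case True
        show ?thesis using part[OF B1(1,2) True B2 ne(2) un(1,3)] .
      next
        case False
        then have "p \<in> A - B" using A by blast
        then show ?thesis using part[OF B2 _ B1(1,2) ne(1) un(2,4)] by blast
      qed
    qed
  qed
  have "normal_cover (subtopology P A) X f"
  proof
    show "compact_space (subtopology P A)"
      using compact A by (simp add: closedin_compact_space compact_space_subtopology)
    show "metrizable_space (subtopology P A)" using metrizable by (rule metrizable_space_subtopology)
    show "continuum X" by (rule continuum_X)
    show "continuous_map (subtopology P A) X f" using f_continuous by (rule continuous_map_from_subtopology)
    show "f ` topspace (subtopology P A) = topspace X" unfolding topA using onto A by blast
    show "connected_space (subtopology P A)" by (rule conn)
    fix y assume y: "y \<in> topspace (subtopology P A)"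
    show "\<exists>V. openin (subtopology P A) V \<and> y \<in> V \<and> inj_on f V"
    proof -
      obtain V where V: "openin P V" "y \<in> V" "inj_on f V" using locally_injective[of y] y AP topA by blast
      have "openin P (V \<inter> A)" using V(1) A by blast
      then show ?thesis using V y topA unfolding openA
        by (intro exI[of _ "V \<inter> A"]) (auto intro: inj_on_subset)
    qed
    fix z assume z: "z \<in> topspace (subtopology P A)" and yz: "f y = f z"
    obtain t where t: "over_homeomorphism P f t" "t y = z" using transitive[of y z] y z yz AP topA by blast
    have hom: "homeomorphic_map P P t" using t(1) by (simp add: over_homeomorphism_def)
    have sub: "A \<subseteq> s ` A" if s: "homeomorphic_map P P s" "s a = b" "a \<in> A" "b \<in> A" for s a b
    proof -
      have "openin P (s ` A)" using homeomorphic_map_openness[OF s(1) AP] A by simp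
      moreover have "closedin P (s ` A)" using homeomorphic_map_closedness[OF s(1) AP] A by simp
      ultimately have "openin (subtopology P A) (A \<inter> s ` A)" "closedin (subtopology P A) (A \<inter> s ` A)"
        unfolding openA closedA using A by auto
      moreover have "A \<inter> s ` A \<noteq> {}" using s by blast
      ultimately have "A \<inter> s ` A = A" using conn unfolding connected_space_clopen_in topA by blast
      then show ?thesis by blast
    qed
    let ?i = "inv_into (topspace P) t"
    note inv = homeomorphic_map_inverse[OF hom]
    have yA: "y \<in> A" and zA: "z \<in> A" using y z topA by simp_all
    have "?i z = y" using inv(2)[of y] t(2) yA AP by blast
    then have i: "A \<subseteq> ?i ` A" using sub[OF inv(1) _ zA yA] by blast
    have "t ` A \<subseteq> A"
    proof (rule image_subsetI)
      fix a assume "a \<in> A"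
      then obtain b where b: "b \<in> A" "a = ?i b" using i by blast
      then show "t a \<in> A" using inv(3)[of b] AP by auto
    qed
    then have tA: "t ` A = A" using sub[OF hom t(2) yA zA] by blast
    have "homeomorphic_map (subtopology P A) (subtopology P A) t"
      by (rule homeomorphic_map_subtopologies[OF hom]) (use tA AP in \<open>simp add: inf_absorb2\<close>)
    then have "over_homeomorphism (subtopology P A) f t" using t(1) by (simp add: over_homeomorphism_def)
    then show "\<exists>t. over_homeomorphism (subtopology P A) f t \<and> t y = z" using t(2) by blast
  qed
  then show thesis using that A by blast
qed

lemma over_homeomorphism_id: "over_homeomorphism P f (\<lambda>x. x)"
  using homeomorphic_map_id[of P P] by (simp add: over_homeomorphism_def id_def)

definition fibre_product :: "'y topology \<Rightarrow> ('y \<Rightarrow> 'x) \<Rightarrow> 'z topology \<Rightarrow> ('z \<Rightarrow> 'x) \<Rightarrow> ('y \<times> 'z) topology" where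
  "fibre_product P f Q g = subtopology (prod_topology P Q) {(a, b). f a = g b}"

lemma topspace_fibre_product:
  "topspace (fibre_product P f Q g) = {(a, b). a \<in> topspace P \<and> b \<in> topspace Q \<and> f a = g b}"
  by (auto simp: fibre_product_def)

lemma fibre_product_homeomorphism:
  assumes t: "over_homeomorphism P f t" and s: "over_homeomorphism Q g s"
  shows "homeomorphic_map (fibre_product P f Q g) (fibre_product P f Q g) (\<lambda>(a, b). (t a, s b))"
proof -
  have tP: "homeomorphic_map P P t" "\<And>w. w \<in> topspace P \<Longrightarrow> f (t w) = f w"
    and sQ: "homeomorphic_map Q Q s" "\<And>w. w \<in> topspace Q \<Longrightarrow> g (s w) = g w"
    using t s by (auto simp: over_homeomorphism_def)
  obtain t' s' where t': "homeomorphic_maps P P t t'" and s': "homeomorphic_maps Q Q s s'"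
    using tP sQ homeomorphic_map_maps by metis
  have tt: "t' a \<in> topspace P" "t (t' a) = a" if "a \<in> topspace P" for a
    using t' that unfolding homeomorphic_maps_def continuous_map_def by auto
  have ss: "s' b \<in> topspace Q" "s (s' b) = b" if "b \<in> topspace Q" for b
    using s' that unfolding homeomorphic_maps_def continuous_map_def by auto
  have t'f: "f (t' a) = f a" if "a \<in> topspace P" for a using tP(2)[OF tt(1)[OF that]] tt(2)[OF that] by simp
  have s'g: "g (s' b) = g b" if "b \<in> topspace Q" for b using sQ(2)[OF ss(1)[OF that]] ss(2)[OF that] by simp
  have "homeomorphic_maps (prod_topology P Q) (prod_topology P Q) (\<lambda>(a, b). (t a, s b)) (\<lambda>(a, b). (t' a, s' b))"
    using t' s' by (simp add: homeomorphic_maps_prod)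
  then have "homeomorphic_maps (fibre_product P f Q g) (fibre_product P f Q g) (\<lambda>(a, b). (t a, s b)) (\<lambda>(a, b). (t' a, s' b))"
    unfolding fibre_product_def
    by (rule homeomorphic_maps_subtopologies_alt) (auto simp: tP(2) sQ(2) t'f s'g)
  then show ?thesis using homeomorphic_map_maps by blast
qed

lemma normal_covering_fibre_product:
  assumes "normal_cover P X f" "normal_cover Q X g"
  shows "normal_covering (fibre_product P f Q g) X (\<lambda>p. f (fst p))"
    and "open_map (fibre_product P f Q g) P fst" and "open_map (fibre_product P f Q g) Q snd"
proof -
  interpret P: normal_cover P X f by fact
  interpret Q: normal_cover Q X g by fact
  let ?T = "fibre_product P f Q g"
  note top = topspace_fibre_product[of P f Q g]
  have c1: "continuous_map ?T P fst" and c2: "continuous_map ?T Q snd"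
    unfolding fibre_product_def by (simp_all add: continuous_map_from_subtopology continuous_map_fst continuous_map_snd)
  have cp: "continuous_map (prod_topology P Q) X (f \<circ> fst)" "continuous_map (prod_topology P Q) X (g \<circ> snd)"
    using P.f_continuous Q.f_continuous by (simp_all add: continuous_map_compose[OF continuous_map_fst] continuous_map_compose[OF continuous_map_snd])
  have "closedin (prod_topology P Q) {p \<in> topspace (prod_topology P Q). (f \<circ> fst) p = (g \<circ> snd) p}"
    using closedin_continuous_maps_eq[OF P.Hausdorff_X cp] .
  then have comp: "compactin (prod_topology P Q) {p \<in> topspace (prod_topology P Q). (f \<circ> fst) p = (g \<circ> snd) p}"
    using P.compact Q.compact by (intro closedin_compact_space) (simp_all add: compact_space_prod_topology)
  have eqT: "?T = subtopology (prod_topology P Q) {p \<in> topspace (prod_topology P Q). (f \<circ> fst) p = (g \<circ> snd) p}"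
    unfolding fibre_product_def by (subst subtopology_restrict[symmetric]) (rule arg_cong2[of _ _ _ _ subtopology], auto)
  have compT: "compact_space ?T" unfolding eqT using comp by (rule compact_space_subtopology)
  show "normal_covering ?T X (\<lambda>p. f (fst p))"
  proof
    show "compact_space ?T" by (rule compT)
    show "metrizable_space ?T"
      unfolding fibre_product_def by (rule metrizable_space_subtopology) (simp add: metrizable_space_prod_topology P.metrizable Q.metrizable)
    show "continuum X" by (rule P.continuum_X)
    show "continuous_map ?T X (\<lambda>p. f (fst p))"
      using continuous_map_compose[OF c1 P.f_continuous] by (simp add: comp_def)
    show "(\<lambda>p. f (fst p)) ` topspace ?T = topspace X"
    proof (rule equalityI; rule subsetI)
      fix x assume "x \<in> (\<lambda>p. f (fst p)) ` topspace ?T"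
      then obtain a where "a \<in> topspace P" "x = f a" unfolding top by auto
      then show "x \<in> topspace X" unfolding P.f_image[symmetric] by simp
    next
      fix x assume x: "x \<in> topspace X"
      obtain a b where "a \<in> topspace P" "f a = x" "b \<in> topspace Q" "g b = x" using P.f_surj[OF x] Q.f_surj[OF x] by blast
      then show "x \<in> (\<lambda>p. f (fst p)) ` topspace ?T" unfolding top by (intro image_eqI[of _ _ "(a, b)"]) auto
    qed
    fix y assume y: "y \<in> topspace ?T"
    obtain a b where ab: "y = (a, b)" "a \<in> topspace P" "b \<in> topspace Q" using y unfolding top by blast
    show "\<exists>V. openin ?T V \<and> y \<in> V \<and> inj_on (\<lambda>p. f (fst p)) V"
    proof -
      obtain V where V: "openin P V" "a \<in> V" "inj_on f V" using P.locally_injective[OF ab(2)] by blast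
      obtain W where W: "openin Q W" "b \<in> W" "inj_on g W" using Q.locally_injective[OF ab(3)] by blast
      have "openin (prod_topology P Q) (V \<times> W)" using V(1) W(1) by (simp add: openin_prod_Times_iff)
      then have "openin ?T (V \<times> W \<inter> {(a, b). f a = g b})" unfolding fibre_product_def by (rule openin_subtopology_Int)
      moreover have "y \<in> V \<times> W \<inter> {(a, b). f a = g b}" using y V(2) W(2) ab(1) unfolding top by auto
      moreover have "inj_on (\<lambda>p. f (fst p)) (V \<times> W \<inter> {(a, b). f a = g b})"
      proof (rule inj_onI)
        fix p q assume p: "p \<in> V \<times> W \<inter> {(a, b). f a = g b}" and q: "q \<in> V \<times> W \<inter> {(a, b). f a = g b}"
          and eq: "f (fst p) = f (fst q)"
        have "f (fst p) = f (fst q)" "g (snd p) = g (snd q)" using p q eq by (auto simp: case_prod_beta)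
        moreover have "fst p \<in> V" "fst q \<in> V" "snd p \<in> W" "snd q \<in> W" using p q by auto
        ultimately show "p = q" using V(3) W(3) by (auto simp: prod_eq_iff dest: inj_onD)
      qed
      ultimately show ?thesis by blast
    qed
    fix z assume z: "z \<in> topspace ?T" and yz: "f (fst y) = f (fst z)"
    obtain c d where cd: "z = (c, d)" "c \<in> topspace P" "d \<in> topspace Q" "f c = g d" using z unfolding top by blast
    have "f a = f c" "g b = g d" using yz ab cd y unfolding top by auto
    then obtain t where t: "over_homeomorphism P f t" "t a = c" using P.transitive[OF ab(2) cd(2)] by blast
    obtain s where s: "over_homeomorphism Q g s" "s b = d"
      using Q.transitive[OF ab(3) cd(3)] \<open>g b = g d\<close> by blast
    have "over_homeomorphism ?T (\<lambda>p. f (fst p)) (\<lambda>(a, b). (t a, s b))"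
      unfolding over_homeomorphism_def using fibre_product_homeomorphism[OF t(1) s(1)] t(1) unfolding top
      by (auto simp: over_homeomorphism_def)
    then show "\<exists>t. over_homeomorphism ?T (\<lambda>p. f (fst p)) t \<and> t y = z" using t(2) s(2) ab(1) cd(1)
      by (intro exI[of _ "\<lambda>(a, b). (t a, s b)"]) simp
  qed
  show "open_map ?T P fst"
  proof (rule open_map_orbit_map[OF compT P.Hausdorff c1])
    show "fst ` topspace ?T = topspace P"
    proof (rule equalityI; rule subsetI)
      fix a assume a: "a \<in> topspace P"
      then have "f a \<in> topspace X" unfolding P.f_image[symmetric] by simp
      then obtain b where "b \<in> topspace Q" "g b = f a" using Q.f_surj by blast
      then show "a \<in> fst ` topspace ?T" using a unfolding top by (intro image_eqI[of _ _ "(a, b)"]) auto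
    qed (auto simp: top)
    fix y z assume yz: "y \<in> topspace ?T" "z \<in> topspace ?T" "fst y = fst z"
    then have "snd y \<in> topspace Q" "snd z \<in> topspace Q" "g (snd y) = g (snd z)" unfolding top by auto
    then obtain s where s: "over_homeomorphism Q g s" "s (snd y) = snd z" using Q.transitive by blast
    have "over_homeomorphism ?T fst (\<lambda>(a, b). (a, s b))"
      unfolding over_homeomorphism_def using fibre_product_homeomorphism[OF over_homeomorphism_id s(1)] by auto
    moreover have "(\<lambda>(a, b). (a, s b)) y = z" using s(2) yz(3) by (cases y, cases z) auto
    ultimately show "\<exists>t. over_homeomorphism ?T fst t \<and> t y = z" by blast
  qed
  show "open_map ?T Q snd"
  proof (rule open_map_orbit_map[OF compT Q.Hausdorff c2])
    show "snd ` topspace ?T = topspace Q"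
    proof (rule equalityI; rule subsetI)
      fix b assume b: "b \<in> topspace Q"
      then have "g b \<in> topspace X" unfolding Q.f_image[symmetric] by simp
      then obtain a where "a \<in> topspace P" "f a = g b" using P.f_surj by blast
      then show "b \<in> snd ` topspace ?T" using b unfolding top by (intro image_eqI[of _ _ "(a, b)"]) auto
    qed (auto simp: top)
    fix y z assume yz: "y \<in> topspace ?T" "z \<in> topspace ?T" "snd y = snd z"
    then have "fst y \<in> topspace P" "fst z \<in> topspace P" "f (fst y) = f (fst z)" unfolding top by auto
    then obtain t where t: "over_homeomorphism P f t" "t (fst y) = fst z" using P.transitive by blast
    have "over_homeomorphism ?T snd (\<lambda>(a, b). (t a, b))"
      unfolding over_homeomorphism_def using fibre_product_homeomorphism[OF t(1) over_homeomorphism_id] by auto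
    moreover have "(\<lambda>(a, b). (t a, b)) y = z" using t(2) yz(3) by (cases y, cases z) auto
    ultimately show "\<exists>t. over_homeomorphism ?T snd t \<and> t y = z" by blast
  qed
qed

text \<open>
  A component of the fibre product lies above both covers; it projects onto each of them
  because the projections of the fibre product are open and closed.
\<close>

lemma common_cover:
  assumes P: "normal_cover P X f" and Q: "normal_cover Q X g" and ne: "topspace X \<noteq> {}"
  obtains R where "normal_cover R X (\<lambda>p. f (fst p))" "continuous_map R P fst" "continuous_map R Q snd"
    "fst ` topspace R = topspace P" "snd ` topspace R = topspace Q" "\<And>r. r \<in> topspace R \<Longrightarrow> f (fst r) = g (snd r)"
proof -
  interpret P: normal_cover P X f by fact
  interpret Q: normal_cover Q X g by fact
  let ?T = "fibre_product P f Q g"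
  interpret T: normal_covering ?T X "\<lambda>p. f (fst p)" by (rule normal_covering_fibre_product[OF P Q])
  obtain x where "x \<in> topspace X" using ne by blast
  then obtain p where "p \<in> topspace ?T" using T.f_surj by blast
  then obtain A where A: "openin ?T A" "closedin ?T A" "p \<in> A" "normal_cover (subtopology ?T A) X (\<lambda>p. f (fst p))"
    by (rule T.connected_part)
  have AT: "A \<subseteq> topspace ?T" using openin_subset[OF A(1)] .
  have c1: "continuous_map ?T P fst" and c2: "continuous_map ?T Q snd"
    unfolding fibre_product_def by (simp_all add: continuous_map_from_subtopology continuous_map_fst continuous_map_snd)
  have ne: "A \<noteq> {}" using A(3) by blast
  have "fst ` A = topspace P"
    using clopen_open_map_image[OF T.compact P.Hausdorff P.connected c1 normal_covering_fibre_product(2)[OF P Q] A(1,2) ne] .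
  moreover have "snd ` A = topspace Q"
    using clopen_open_map_image[OF T.compact Q.Hausdorff Q.connected c2 normal_covering_fibre_product(3)[OF P Q] A(1,2) ne] .
  moreover have tA: "topspace (subtopology ?T A) = A" using AT by auto
  moreover have "f (fst r) = g (snd r)" if "r \<in> A" for r using that AT unfolding topspace_fibre_product by auto
  ultimately show thesis
    using that[OF A(4) continuous_map_from_subtopology[OF c1] continuous_map_from_subtopology[OF c2]] by simp
qed


lemma compact_metrizable_countable_base:
  assumes "compact_space X" "metrizable_space X"
  obtains \<B> where "countable \<B>" "\<And>W. W \<in> \<B> \<Longrightarrow> openin X W"
    "\<And>U x. openin X U \<Longrightarrow> x \<in> U \<Longrightarrow> \<exists>W\<in>\<B>. x \<in> W \<and> W \<subseteq> U"
proof -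
  obtain M d where M: "Metric_space M d" and X: "X = Metric_space.mtopology M d"
    using assms(2) unfolding metrizable_space_def by blast
  interpret Metric_space M d by fact
  have tX: "topspace X = M" by (simp add: X)
  have "\<exists>A. finite A \<and> A \<subseteq> M \<and> M \<subseteq> (\<Union>x\<in>A. mball x (1 / Suc n))" for n
  proof (rule compact_space_finite_subcover[OF assms(1), of "\<lambda>x. mball x (1 / Suc n)"])
    fix x assume "x \<in> topspace X"
    then show "openin X (mball x (1 / Suc n)) \<and> x \<in> mball x (1 / Suc n)" by (simp add: X)
  next
    fix A assume "A \<subseteq> topspace X" "finite A" "topspace X \<subseteq> (\<Union>x\<in>A. mball x (1 / Suc n))"
    then show ?thesis unfolding tX by (intro exI[of _ A] conjI)
  qed
  then obtain A where A: "\<And>n. finite (A n)" "\<And>n. A n \<subseteq> M" "\<And>n. M \<subseteq> (\<Union>x\<in>A n. mball x (1 / Suc n))" by metis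
  define \<B> where "\<B> = (\<Union>n. (\<lambda>x. mball x (1 / Suc n)) ` A n)"
  show thesis
  proof (rule that[of \<B>])
    show "countable \<B>" unfolding \<B>_def using A(1) by (intro countable_UN countableI_type countable_image countable_finite)
    show "openin X W" if "W \<in> \<B>" for W using that unfolding \<B>_def X by auto
    fix U x assume U: "openin X U" and x: "x \<in> U"
    obtain e where e: "e > 0" "mball x e \<subseteq> U" using U x unfolding X openin_mtopology by blast
    obtain n where n: "1 / Suc n < e / 2" using nat_approx_posE[of "e / 2"] e(1) by auto
    have xM: "x \<in> M" using openin_subset[OF U] x tX by blast
    then obtain a where a: "a \<in> A n" "x \<in> mball a (1 / Suc n)" using A(3)[of n] by blast
    have "mball a (1 / Suc n) \<subseteq> mball x e"
    proof
      fix y assume y: "y \<in> mball a (1 / Suc n)"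
      have "d x y \<le> d a x + d a y" using triangle''[of x a y] y a(2) by simp
      then show "y \<in> mball x e" using y a(2) n by simp
    qed
    then show "\<exists>W\<in>\<B>. x \<in> W \<and> W \<subseteq> U" using a e(2) unfolding \<B>_def by blast
  qed
qed

text \<open>
  Finite covers of the total space by open sets so small that \<open>f\<close> is injective
  on any two that meet.
\<close>

definition sheets :: "'y topology \<Rightarrow> ('y \<Rightarrow> 'x) \<Rightarrow> 'y set list \<Rightarrow> bool" where
  "sheets P f Vs \<longleftrightarrow> (\<forall>V\<in>set Vs. openin P V) \<and> \<Union>(set Vs) = topspace P \<and>
     (\<forall>V\<in>set Vs. \<forall>W\<in>set Vs. V \<inter> W \<noteq> {} \<longrightarrow> inj_on f (V \<union> W))"

definition nerve :: "'y set list \<Rightarrow> (nat \<times> nat) set" where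
  "nerve Vs = {(k, l). k < length Vs \<and> l < length Vs \<and> Vs ! k \<inter> Vs ! l \<noteq> {}}"

text \<open>
  Take an entourage that contains no two points of one fibre.  On the union of two meeting
  sets of half its size \<open>f\<close> is injective; intersecting a sheet with the preimage
  of a base set inside its image makes that base set its image.
\<close>

lemma (in normal_covering) sheets_exist:
  assumes \<B>: "\<And>U x. openin X U \<Longrightarrow> x \<in> U \<Longrightarrow> \<exists>W\<in>\<B>. x \<in> W \<and> W \<subseteq> U" "\<And>W. W \<in> \<B> \<Longrightarrow> openin X W"
  obtains Vs where "sheets P f Vs" "\<And>V. V \<in> set Vs \<Longrightarrow> f ` V \<in> \<B>"
proof -
  obtain M where M: "M \<in> diag_nhds P" "\<And>a b. (a, b) \<in> M \<Longrightarrow> f a = f b \<Longrightarrow> a = b" by (rule injective_entourage) blast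
  obtain M' where M': "M' \<in> diag_nhds P" "M' O M' \<subseteq> M" using diag_nhds_half[OF compact metrizable M(1)] by blast
  have "\<exists>V. openin P V \<and> y \<in> V \<and> V \<times> V \<subseteq> M' \<and> f ` V \<in> \<B>" if y: "y \<in> topspace P" for y
  proof -
    obtain V where V: "openin P V" "y \<in> V" "V \<times> V \<subseteq> M'" using diag_nhds_D(3)[OF M'(1) y] by blast
    have "openin X (f ` V)" using f_open V(1) by (simp add: open_map_def)
    then obtain W where W: "W \<in> \<B>" "f y \<in> W" "W \<subseteq> f ` V" using \<B>(1)[of "f ` V" "f y"] V(2) by blast
    let ?V = "V \<inter> {z \<in> topspace P. f z \<in> W}"
    have "openin P ?V" using openin_continuous_map_preimage[OF f_continuous \<B>(2)[OF W(1)]] V(1) by blast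
    moreover have "f ` ?V = W"
    proof (rule equalityI; rule subsetI)
      fix x assume x: "x \<in> W"
      then obtain z where z: "z \<in> V" "x = f z" using W(3) by blast
      then show "x \<in> f ` ?V" using x openin_subset[OF V(1)] by (intro image_eqI[of _ _ z]) auto
    qed auto
    ultimately show ?thesis using V y W by (intro exI[of _ ?V]) auto
  qed
  then obtain V where V: "\<And>y. y \<in> topspace P \<Longrightarrow> openin P (V y) \<and> y \<in> V y \<and> V y \<times> V y \<subseteq> M' \<and> f ` V y \<in> \<B>" by metis
  obtain A where A: "A \<subseteq> topspace P" "finite A" "topspace P \<subseteq> (\<Union>y\<in>A. V y)"
    using compact_space_finite_subcover[OF compact, of V] V by metis
  obtain ys where ys: "set ys = A" using finite_list[OF A(2)] by blast
  have Vy: "openin P (V y)" "V y \<times> V y \<subseteq> M'" "f ` V y \<in> \<B>" if "y \<in> A" for y using V A(1) that by blast+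
  show thesis
  proof (rule that[of "map V ys"])
    have "inj_on f (V y \<union> V z)" if yz: "y \<in> A" "z \<in> A" and w: "w \<in> V y" "w \<in> V z" for y z w
    proof (rule inj_onI)
      fix a b assume ab: "a \<in> V y \<union> V z" "b \<in> V y \<union> V z" "f a = f b"
      have "(a, w) \<in> M'" "(w, b) \<in> M'" using ab w Vy(2)[OF yz(1)] Vy(2)[OF yz(2)] by blast+
      then show "a = b" using M(2) M'(2) ab(3) by blast
    qed
    moreover have "\<Union>(V ` A) = topspace P" using A(3) openin_subset[OF Vy(1)] by blast
    ultimately show "sheets P f (map V ys)" unfolding sheets_def using Vy(1) ys by auto
    show "f ` W \<in> \<B>" if "W \<in> set (map V ys)" for W using that ys Vy(3) by auto
  qed
qed

text \<open>
  A point of the \<open>k\<close>-th sheet of the first cover is sent to the point of the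
  \<open>k\<close>-th sheet of the second one above the same base point.  If it also lies in
  the \<open>l\<close>-th sheet, then the \<open>k\<close>-th and \<open>l\<close>-th sheets
  of the second cover meet as the nerves agree, and both choices coincide by injectivity on
  their union.
\<close>

lemma sheets_map:
  assumes P: "normal_cover P X f" and Q: "normal_cover Q X g"
    and Vs: "sheets P f Vs" and Ws: "sheets Q g Ws"
    and im: "map ((`) f) Vs = map ((`) g) Ws" and nerve: "nerve Vs = nerve Ws"
  obtains h where "continuous_map P Q h" "\<And>y. y \<in> topspace P \<Longrightarrow> g (h y) = f y"
    "\<And>k y. k < length Vs \<Longrightarrow> y \<in> Vs ! k \<Longrightarrow> h y \<in> Ws ! k"
proof -
  interpret P: normal_cover P X f by fact
  interpret Q: normal_cover Q X g by fact
  have len: "length Ws = length Vs" using im by (metis length_map)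
  have img: "g ` (Ws ! k) = f ` (Vs ! k)" if "k < length Vs" for k
    using im that len by (metis nth_map)
  have Vo: "openin P (Vs ! k)" and Wo: "openin Q (Ws ! k)" if "k < length Vs" for k
    using Vs Ws that len nth_mem unfolding sheets_def by metis+
  have Winj: "inj_on g (Ws ! k \<union> Ws ! l)" if "k < length Vs" "l < length Vs" "Ws ! k \<inter> Ws ! l \<noteq> {}" for k l
    using Ws that len nth_mem unfolding sheets_def by metis
  have cov: "\<exists>k<length Vs. y \<in> Vs ! k" if y: "y \<in> topspace P" for y
  proof -
    have "y \<in> \<Union>(set Vs)" using Vs y by (simp add: sheets_def)
    then show ?thesis by (auto simp: in_set_conv_nth)
  qed
  define R where "R y z \<longleftrightarrow> (\<exists>k<length Vs. y \<in> Vs ! k \<and> z \<in> Ws ! k \<and> g z = f y)" for y z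
  have ex: "\<exists>z. z \<in> Ws ! k \<and> g z = f y" if "k < length Vs" "y \<in> Vs ! k" for k y
  proof -
    have "f y \<in> g ` (Ws ! k)" unfolding img[OF that(1)] using that(2) by (rule imageI)
    then show ?thesis by (metis imageE)
  qed
  have uniq: "z = z'" if R: "R y z" "R y z'" for y z z'
  proof -
    obtain k l where k: "k < length Vs" "y \<in> Vs ! k" "z \<in> Ws ! k" "g z = f y"
      and l: "l < length Vs" "y \<in> Vs ! l" "z' \<in> Ws ! l" "g z' = f y" using R unfolding R_def by blast
    have "(k, l) \<in> nerve Ws" unfolding nerve[symmetric] using k l by (auto simp: nerve_def)
    then have "inj_on g (Ws ! k \<union> Ws ! l)" using Winj[OF k(1) l(1)] by (simp add: nerve_def)
    then show ?thesis by (rule inj_onD) (use k l in simp_all)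
  qed
  define h where "h y = (THE z. R y z)" for y
  have h: "h y = z" if "R y z" for y z unfolding h_def using that uniq by (intro the_equality) blast+
  have hk: "h y \<in> Ws ! k" "g (h y) = f y" if k: "k < length Vs" "y \<in> Vs ! k" for k y
  proof -
    obtain z where z: "z \<in> Ws ! k" "g z = f y" using ex[OF k] by blast
    then have "R y z" unfolding R_def using k by blast
    then show "h y \<in> Ws ! k" "g (h y) = f y" using h z by auto
  qed
  have "continuous_map P Q h"
    unfolding continuous_map_def
  proof (intro conjI allI impI)
    show "h \<in> topspace P \<rightarrow> topspace Q"
    proof
      fix y assume "y \<in> topspace P"
      then obtain k where k: "k < length Vs" "y \<in> Vs ! k" using cov by blast
      show "h y \<in> topspace Q" using hk(1)[OF k] openin_subset[OF Wo[OF k(1)]] by blast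
    qed
    fix U assume U: "openin Q U"
    show "openin P {y \<in> topspace P. h y \<in> U}"
    proof (subst openin_subopen, intro ballI)
      fix y assume y: "y \<in> {y \<in> topspace P. h y \<in> U}"
      then obtain k where k: "k < length Vs" "y \<in> Vs ! k" using cov by blast
      let ?S = "U \<inter> Ws ! k"
      let ?T = "Vs ! k \<inter> {z \<in> topspace P. f z \<in> g ` ?S}"
      have "openin X (g ` ?S)" using Q.f_open U Wo[OF k(1)] by (simp add: open_map_def openin_Int)
      then have "openin P ?T" using openin_continuous_map_preimage[OF P.f_continuous] Vo[OF k(1)] by blast
      moreover have "y \<in> ?T"
      proof -
        have "h y \<in> ?S" "f y = g (h y)" using y hk[OF k] by auto
        then have "f y \<in> g ` ?S" by (rule rev_image_eqI)
        then show ?thesis using k(2) y by blast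
      qed
      moreover have "?T \<subseteq> {y \<in> topspace P. h y \<in> U}"
      proof
        fix z assume z: "z \<in> ?T"
        then obtain w where w: "w \<in> U" "w \<in> Ws ! k" "g w = f z" by auto
        have "R z w" unfolding R_def using k(1) w z by blast
        then show "z \<in> {y \<in> topspace P. h y \<in> U}" using h w(1) z by auto
      qed
      ultimately show "\<exists>T. openin P T \<and> y \<in> T \<and> T \<subseteq> {y \<in> topspace P. h y \<in> U}" by (intro exI conjI)
    qed
  qed
  then show thesis using that[of h] hk cov by metis
qed

text \<open>
  The maps obtained in both directions preserve the index of a sheet, so their composites
  agree with the identity by injectivity on each sheet.
\<close>

lemma sheets_determine_cover:
  assumes P: "normal_cover P X f" and Q: "normal_cover Q X g"
    and Vs: "sheets P f Vs" and Ws: "sheets Q g Ws"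
    and im: "map ((`) f) Vs = map ((`) g) Ws" and nerve: "nerve Vs = nerve Ws"
  obtains h where "homeomorphic_map P Q h" "\<And>y. y \<in> topspace P \<Longrightarrow> g (h y) = f y"
proof -
  obtain h where h: "continuous_map P Q h" "\<And>y. y \<in> topspace P \<Longrightarrow> g (h y) = f y"
    "\<And>k y. k < length Vs \<Longrightarrow> y \<in> Vs ! k \<Longrightarrow> h y \<in> Ws ! k"
    by (rule sheets_map[OF P Q Vs Ws im nerve]) (rule that)
  obtain h' where h': "continuous_map Q P h'" "\<And>y. y \<in> topspace Q \<Longrightarrow> f (h' y) = g y"
    "\<And>k y. k < length Ws \<Longrightarrow> y \<in> Ws ! k \<Longrightarrow> h' y \<in> Vs ! k"
    by (rule sheets_map[OF Q P Ws Vs im[symmetric] nerve[symmetric]]) (rule that)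
  \<comment> \<open>Stated with types of its own, so that it applies to \<open>h\<close> after \<open>h'\<close> and to \<open>h'\<close> after \<open>h\<close>.\<close>
  have inv: "k' (k y) = y"
    if k: "continuous_map A B k" "\<And>y. y \<in> topspace A \<Longrightarrow> b (k y) = a y" "\<And>i y. i < length As \<Longrightarrow> y \<in> As ! i \<Longrightarrow> k y \<in> Bs ! i"
    and k': "\<And>y. y \<in> topspace B \<Longrightarrow> a (k' y) = b y" "\<And>i y. i < length Bs \<Longrightarrow> y \<in> Bs ! i \<Longrightarrow> k' y \<in> As ! i"
    and A: "sheets A a As" "length As = length Bs" and y: "y \<in> topspace A"
    for A :: "'p topology" and B :: "'q topology" and k k' and a :: "'p \<Rightarrow> 'z" and b As Bs y
  proof -
    have "y \<in> \<Union>(set As)" using A(1) y by (simp add: sheets_def)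
    then obtain i where i: "i < length As" "y \<in> As ! i" by (auto simp: in_set_conv_nth)
    have "k' (k y) \<in> As ! i" using k'(2) k(3)[OF i] i(1) A(2) by simp
    moreover have "k y \<in> topspace B" using k(1) y continuous_map_image_subset_topspace by blast
    then have "a (k' (k y)) = a y" using k'(1) k(2)[OF y] by simp
    moreover have "inj_on a (As ! i \<union> As ! i)" using A(1) i nth_mem unfolding sheets_def by blast
    ultimately show ?thesis using i(2) by (intro inj_onD[of a "As ! i \<union> As ! i"]) simp_all
  qed
  have len: "length Vs = length Ws" using im by (metis length_map)
  have "homeomorphic_maps P Q h h'"
    unfolding homeomorphic_maps_def
    using h(1) h'(1) inv[OF h h'(2,3) Vs len] inv[OF h' h(2,3) Ws len[symmetric]] by blast
  then show thesis using that h(2) homeomorphic_map_maps by blast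
qed

text \<open>
  A cover is determined up to equivalence by the base sets below its sheets, chosen in a
  countable base, and by the finite nerve of its sheets.
\<close>

lemma countable_covers:
  assumes X: "continuum X" and all: "all_covers_by_continua X x\<^sub>0 I C"
  shows "countable I"
proof -
  have "compact_space X" "metrizable_space X" using X by (simp_all add: continuum_def)
  then obtain \<B> where \<B>: "countable \<B>" "\<And>W. W \<in> \<B> \<Longrightarrow> openin X W"
    "\<And>U x. openin X U \<Longrightarrow> x \<in> U \<Longrightarrow> \<exists>W\<in>\<B>. x \<in> W \<and> W \<subseteq> U"
    by (rule compact_metrizable_countable_base) blast
  have cov: "cover X (C i)" if "i \<in> I" for i
    using all_covers_by_continuaD(1,2)[OF all] that X unfolding cover_def by blast
  have nc: "normal_cover (cov_space (C i)) X (cov_map (C i))" if "i \<in> I" for i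
  proof -
    interpret cover X "C i" using cov[OF that] .
    show ?thesis by (rule normal_cover_axioms)
  qed
  have "\<exists>Vs. sheets (cov_space (C i)) (cov_map (C i)) Vs \<and> (\<forall>V\<in>set Vs. cov_map (C i) ` V \<in> \<B>)" if i: "i \<in> I" for i
  proof -
    interpret normal_cover "cov_space (C i)" X "cov_map (C i)" using nc[OF i] .
    show ?thesis using sheets_exist[of \<B>] \<B>(2,3) by metis
  qed
  then obtain Vs where Vs: "\<And>i. i \<in> I \<Longrightarrow> sheets (cov_space (C i)) (cov_map (C i)) (Vs i)"
    "\<And>i V. i \<in> I \<Longrightarrow> V \<in> set (Vs i) \<Longrightarrow> cov_map (C i) ` V \<in> \<B>" by metis
  define D where "D i = (map ((`) (cov_map (C i))) (Vs i), nerve (Vs i))" for i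
  have "inj_on D I"
  proof (rule inj_onI)
    fix i j assume ij: "i \<in> I" "j \<in> I" "D i = D j"
    then obtain h where "homeomorphic_map (cov_space (C i)) (cov_space (C j)) h"
      "\<And>y. y \<in> topspace (cov_space (C i)) \<Longrightarrow> cov_map (C j) (h y) = cov_map (C i) y"
      using sheets_determine_cover[OF nc[OF ij(1)] nc[OF ij(2)] Vs(1)[OF ij(1)] Vs(1)[OF ij(2)]] unfolding D_def by auto
    then have "equivalent_covers (C i) (C j)" using homeomorphic_covers_equivalent[OF cov[OF ij(1)] cov[OF ij(2)]] by blast
    then show "i = j" using all_covers_by_continuaD(5)[OF all ij(1,2)] by blast
  qed
  moreover have "D ` I \<subseteq> lists \<B> \<times> Collect finite"
  proof (rule image_subsetI)
    fix i assume i: "i \<in> I"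
    have "nerve (Vs i) \<subseteq> {..<length (Vs i)} \<times> {..<length (Vs i)}" by (auto simp: nerve_def)
    then have "finite (nerve (Vs i))" by (rule finite_subset) simp
    then show "D i \<in> lists \<B> \<times> Collect finite" using Vs(2)[OF i] by (auto simp: D_def)
  qed
  moreover have "countable (lists \<B> \<times> (Collect finite :: (nat \<times> nat) set set))"
    using \<B>(1) countable_Collect_finite by (intro countable_SIGMA) auto
  ultimately show ?thesis using countable_image_inj_on countable_subset by metis
qed


section \<open>The compact universal cover\<close>

text \<open>
  The finite intersection property for a directed family, in which finitely many members
  always contain a further one.
\<close>

lemma compact_directed_Inter:
  assumes T: "compact_space T" and J: "J \<noteq> {}"
    and K: "\<And>a. a \<in> J \<Longrightarrow> closedin T (K a)" "\<And>a. a \<in> J \<Longrightarrow> K a \<noteq> {}"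
    and dir: "\<And>a b. a \<in> J \<Longrightarrow> b \<in> J \<Longrightarrow> \<exists>c\<in>J. K c \<subseteq> K a \<and> K c \<subseteq> K b"
  obtains x where "x \<in> topspace T" "\<And>a. a \<in> J \<Longrightarrow> x \<in> K a"
proof -
  have lower: "\<exists>c\<in>J. \<forall>a\<in>A. K c \<subseteq> K a" if "finite A" "A \<subseteq> J" for A using that
  proof (induction A)
    case empty then show ?case using J by blast
  next
    case (insert a A)
    then obtain c where c: "c \<in> J" "\<forall>a\<in>A. K c \<subseteq> K a" by auto
    obtain e where e: "e \<in> J" "K e \<subseteq> K a" "K e \<subseteq> K c" using dir[of a c] insert.prems c(1) by blast
    then show ?case using c(2) by blast
  qed
  have "\<Inter>(K ` J) \<noteq> {}"
  proof (rule T[unfolded compact_space_fip, rule_format], intro conjI allI impI ballI)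
    show "closedin T L" if "L \<in> K ` J" for L using that K(1) by blast
    fix \<F> assume F: "finite \<F> \<and> \<F> \<subseteq> K ` J"
    then obtain A where A: "A \<subseteq> J" "finite A" "\<F> = K ` A" using finite_subset_image[of \<F> K J] by blast
    obtain c where c: "c \<in> J" "\<forall>a\<in>A. K c \<subseteq> K a" using lower[OF A(2,1)] by blast
    obtain x where "x \<in> K c" using K(2)[OF c(1)] by blast
    then show "\<Inter>\<F> \<noteq> {}" using c(2) unfolding A(3) by blast
  qed
  then obtain x where x: "\<And>a. a \<in> J \<Longrightarrow> x \<in> K a" by blast
  obtain a where "a \<in> J" using J by blast
  then have "x \<in> topspace T" using x closedin_subset[OF K(1)] by blast
  then show thesis using that x by blast
qed

locale cover_system =
  fixes X :: "'x topology" and x\<^sub>0 :: 'x and I :: "'i set" and C :: "'i \<Rightarrow> ('c, 'd, 'x) pointed_cover"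
  assumes continuum_X: "continuum X" and all_covers: "all_covers_by_continua X x\<^sub>0 I C"
begin

abbreviation "S i \<equiv> cov_space (C i)"
abbreviation "D i \<equiv> cov_group (C i)"
abbreviation "act i \<equiv> cov_act (C i)"
abbreviation "p i \<equiv> cov_map (C i)"
abbreviation "base i \<equiv> cov_base (C i)"
abbreviation "cle i j \<equiv> cover_le (C i) (C j)"
abbreviation "B i j \<equiv> bonding_map (C i) (C j)"
abbreviation "\<Theta> i j \<equiv> bonding_hom (C i) (C j)"
abbreviation "Z \<equiv> universal_space I C"

lemma x0: "x\<^sub>0 \<in> topspace X"
  using all_covers_by_continuaD(1)[OF all_covers] .

lemma base: "i \<in> I \<Longrightarrow> base i \<in> topspace (S i)" "i \<in> I \<Longrightarrow> p i (base i) = x\<^sub>0"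
  using all_covers_by_continuaD(3,4)[OF all_covers] by blast+

lemma cov: "i \<in> I \<Longrightarrow> cover X (C i)"
  using all_covers_by_continuaD(2)[OF all_covers] continuum_X x0 unfolding cover_def by blast

lemma normal: assumes "i \<in> I" shows "normal_cover (S i) X (p i)"
proof -
  interpret cover X "C i" using cov[OF assms] .
  show ?thesis by (rule normal_cover_axioms)
qed

text \<open>
  A deck transformation of the target corrects any morphism to preserve basepoints; two such
  morphisms agree by unique lifting.
\<close>

lemma bonding_map_ex1:
  assumes i: "i \<in> I" and j: "j \<in> I" and le: "cle i j"
  shows "\<exists>!h. h \<in> extensional (topspace (S j)) \<and> cover_morphism (C j) (C i) h \<and> h (base j) = base i"
proof -
  interpret i: cover X "C i" by (rule cov[OF i])
  interpret j: cover X "C j" by (rule cov[OF j])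
  obtain h where h: "continuous_map (S j) (S i) h" "h ` topspace (S j) = topspace (S i)"
    "\<And>y. y \<in> topspace (S j) \<Longrightarrow> p i (h y) = p j y"
    using le unfolding cover_le_def cover_morphism_def by blast
  have hS: "h y \<in> topspace (S i)" if "y \<in> topspace (S j)" for y
    using continuous_map_image_subset_topspace[OF h(1)] that by blast
  have "p i (h (base j)) = p i (base i)" using h(3)[OF base(1)[OF j]] base(2)[OF i] base(2)[OF j] by simp
  then obtain g where g: "g \<in> carrier (D i)" "base i = act i g (h (base j))"
    using i.fibre[OF hS[OF base(1)[OF j]] base(1)[OF i]] by blast
  let ?h = "restrict (act i g \<circ> h) (topspace (S j))"
  have "continuous_map (S j) (S i) (act i g \<circ> h)"
    using continuous_map_compose[OF h(1) homeomorphic_imp_continuous_map[OF i.act_homeomorphic[OF g(1)]]] .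
  then have c: "continuous_map (S j) (S i) ?h" by (rule continuous_map_eq) simp
  have "?h ` topspace (S j) = act i g ` h ` topspace (S j)" by (simp add: image_image)
  then have im: "?h ` topspace (S j) = topspace (S i)" using h(2) i.surj_prop[OF g(1)] by simp
  have "cover_morphism (C j) (C i) ?h"
    unfolding cover_morphism_def using c im h(3) i.over[OF g(1) hS] by simp
  moreover have "?h (base j) = base i" using base(1)[OF j] g(2) by simp
  moreover have "k = l" if k: "k \<in> extensional (topspace (S j))" "cover_morphism (C j) (C i) k" "k (base j) = base i"
    and l: "l \<in> extensional (topspace (S j))" "cover_morphism (C j) (C i) l" "l (base j) = base i" for k l
  proof (rule extensionalityI[OF k(1) l(1)])
    show "k y = l y" if y: "y \<in> topspace (S j)" for y
      using i.unique_lift[OF j.connected, of k l "base j" y] k l y base(1)[OF j]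
      unfolding cover_morphism_def by simp
  qed
  ultimately show ?thesis by (intro ex1I[of _ ?h]) (simp_all add: restrict_extensional)
qed

lemma bonding:
  assumes i: "i \<in> I" and j: "j \<in> I" and le: "cle i j"
  shows "continuous_map (S j) (S i) (B i j)" "B i j ` topspace (S j) = topspace (S i)"
    and "\<And>y. y \<in> topspace (S j) \<Longrightarrow> p i (B i j y) = p j y"
    and "B i j (base j) = base i"
    and "\<And>y. y \<in> topspace (S j) \<Longrightarrow> B i j y \<in> topspace (S i)"
proof -
  have *: "B i j \<in> extensional (topspace (S j)) \<and> cover_morphism (C j) (C i) (B i j) \<and> B i j (base j) = base i"
    unfolding bonding_map_def by (rule theI'[OF bonding_map_ex1[OF assms]])
  then show c: "continuous_map (S j) (S i) (B i j)" "B i j ` topspace (S j) = topspace (S i)" "B i j (base j) = base i"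
    unfolding cover_morphism_def by simp_all
  show "p i (B i j y) = p j y" if "y \<in> topspace (S j)" for y using * that unfolding cover_morphism_def by simp
  show "B i j y \<in> topspace (S i)" if "y \<in> topspace (S j)" for y
    using continuous_map_image_subset_topspace[OF c(1)] that by blast
qed

lemma bonding_unique:
  assumes i: "i \<in> I" and j: "j \<in> I" and le: "cle i j" and h: "continuous_map (S j) (S i) h"
    and over: "\<And>y. y \<in> topspace (S j) \<Longrightarrow> p i (h y) = p j y" and hb: "h (base j) = base i" and y: "y \<in> topspace (S j)"
  shows "B i j y = h y"
proof -
  interpret i: cover X "C i" by (rule cov[OF i])
  interpret j: cover X "C j" by (rule cov[OF j])
  show ?thesis
    using i.unique_lift[OF j.connected bonding(1)[OF i j le] h _ base(1)[OF j] _ y] over hb bonding(3,4)[OF i j le] by simp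
qed

lemma le_refl: "i \<in> I \<Longrightarrow> cle i i"
  unfolding cover_le_def cover_morphism_def by (intro exI[of _ "\<lambda>y. y"]) simp

lemma le_trans:
  assumes "cle i j" "cle j k" shows "cle i k"
proof -
  obtain h h' where h: "cover_morphism (C j) (C i) h" "cover_morphism (C k) (C j) h'"
    using assms unfolding cover_le_def by blast
  have h': "h' y \<in> topspace (S j)" if "y \<in> topspace (S k)" for y
    using h(2) that unfolding cover_morphism_def by blast
  have "cover_morphism (C k) (C i) (h \<circ> h')"
    unfolding cover_morphism_def
  proof (intro conjI ballI)
    show "continuous_map (S k) (S i) (h \<circ> h')" using h unfolding cover_morphism_def by (meson continuous_map_compose)
    show "(h \<circ> h') ` topspace (S k) = topspace (S i)"
      unfolding image_comp[symmetric] using h unfolding cover_morphism_def by simp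
    show "p i ((h \<circ> h') y) = p k y" if "y \<in> topspace (S k)" for y
      using h h'[OF that] that unfolding cover_morphism_def by simp
  qed
  then show ?thesis unfolding cover_le_def by blast
qed

lemma bonding_comp:
  assumes i: "i \<in> I" and j: "j \<in> I" and k: "k \<in> I" and le: "cle i j" "cle j k" and y: "y \<in> topspace (S k)"
  shows "B i j (B j k y) = B i k y"
  using bonding_unique[OF i k le_trans[OF le] continuous_map_compose[OF bonding(1)[OF j k le(2)] bonding(1)[OF i j le(1)]] _ _ y]
    bonding(3-5)[OF j k le(2)] bonding(3-5)[OF i j le(1)] by simp

lemma directed:
  assumes i: "i \<in> I" and j: "j \<in> I" obtains k where "k \<in> I" "cle i k" "cle j k"
proof -
  have ne: "topspace X \<noteq> {}" using x0 by blast
  obtain R where R: "normal_cover R X (\<lambda>r. p i (fst r))" "continuous_map R (S i) fst" "continuous_map R (S j) snd"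
    "fst ` topspace R = topspace (S i)" "snd ` topspace R = topspace (S j)" "\<And>r. r \<in> topspace R \<Longrightarrow> p i (fst r) = p j (snd r)"
    by (rule common_cover[OF normal[OF i] normal[OF j] ne]) (rule that)
  obtain k h where k: "k \<in> I" and h: "homeomorphic_map (S k) R h" "\<And>y. y \<in> topspace (S k) \<Longrightarrow> p i (fst (h y)) = p k y"
    by (rule normal_cover.equivalent_cover_exists[OF R(1) all_covers]) (rule that)
  have hR: "h y \<in> topspace R" if "y \<in> topspace (S k)" for y using homeomorphic_imp_surjective_map[OF h(1)] that by blast
  note hc = homeomorphic_imp_continuous_map[OF h(1)] and hs = homeomorphic_imp_surjective_map[OF h(1)]
  have "cover_morphism (C k) (C i) (fst \<circ> h)"
    unfolding cover_morphism_def image_comp[symmetric] hs R(4) using continuous_map_compose[OF hc R(2)] h(2) by simp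
  moreover have "cover_morphism (C k) (C j) (snd \<circ> h)"
    unfolding cover_morphism_def image_comp[symmetric] hs R(5)
    using continuous_map_compose[OF hc R(3)] h(2) R(6)[OF hR] by simp
  ultimately show thesis using that[OF k] unfolding cover_le_def by blast
qed

text \<open>
  The identity of \<open>X\<close> is a cover.
\<close>

lemma index_nonempty: "I \<noteq> {}"
proof -
  have "normal_cover X X (\<lambda>x. x)"
  proof
    show "compact_space X" "metrizable_space X" "connected_space X" "continuum X"
      using continuum_X by (simp_all add: continuum_def)
    show "continuous_map X X (\<lambda>x. x)" "(\<lambda>x. x) ` topspace X = topspace X" by simp_all
    show "\<exists>V. openin X V \<and> y \<in> V \<and> inj_on (\<lambda>x. x) V" if "y \<in> topspace X" for y
      using that by (intro exI[of _ "topspace X"]) simp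
    show "\<exists>t. over_homeomorphism X (\<lambda>x. x) t \<and> t y = z" if "y = z" for y z
      using that over_homeomorphism_id by (intro exI[of _ "\<lambda>x. x"]) simp
  qed
  then show ?thesis by (rule normal_cover.equivalent_cover_exists[OF _ all_covers]) blast
qed

lemma directed_finite:
  assumes "finite J" "J \<subseteq> I" obtains k where "k \<in> I" "\<And>j. j \<in> J \<Longrightarrow> cle j k"
proof -
  have "\<exists>k\<in>I. \<forall>j\<in>J. cle j k" using assms
  proof (induction J)
    case empty then show ?case using index_nonempty by blast
  next
    case (insert j J)
    then obtain k where k: "k \<in> I" "\<forall>j\<in>J. cle j k" by auto
    obtain m where m: "m \<in> I" "cle j m" "cle k m" using directed[of j k] k(1) insert.prems by blast
    then show ?case using k(2) le_trans by blast
  qed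
  then show thesis using that by blast
qed

abbreviation "PS \<equiv> product_topology S I"

lemma topspace_Z: "x \<in> topspace Z \<longleftrightarrow> x \<in> topspace PS \<and> (\<forall>i\<in>I. \<forall>j\<in>I. cle i j \<longrightarrow> B i j (x j) = x i)"
  by (simp add: universal_space_def)

lemma Z_coordinate: "x \<in> topspace Z \<Longrightarrow> i \<in> I \<Longrightarrow> x i \<in> topspace (S i)"
  unfolding topspace_Z by auto

lemma Z_bonding: "x \<in> topspace Z \<Longrightarrow> i \<in> I \<Longrightarrow> j \<in> I \<Longrightarrow> cle i j \<Longrightarrow> B i j (x j) = x i"
  unfolding topspace_Z by blast

lemma Z_projection: "i \<in> I \<Longrightarrow> continuous_map Z (S i) (\<lambda>x. x i)"
  unfolding universal_space_def by (intro continuous_map_from_subtopology continuous_map_product_projection)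

lemma PS_projection: "i \<in> I \<Longrightarrow> continuous_map PS (S i) (\<lambda>x. x i)"
  by (rule continuous_map_product_projection)

lemma compact_PS: "compact_space PS"
  unfolding compact_space_product_topology using normal normal_covering.compact normal_cover.axioms(1) by blast

lemma closed_bonding:
  assumes i: "i \<in> I" and j: "j \<in> I" and le: "cle i j"
  shows "closedin PS {x \<in> topspace PS. B i j (x j) = x i}"
proof -
  interpret i: cover X "C i" by (rule cov[OF i])
  show ?thesis
    using closedin_continuous_maps_eq[OF i.Hausdorff continuous_map_compose[OF PS_projection[OF j] bonding(1)[OF i j le]] PS_projection[OF i]]
    by (simp add: comp_def)
qed

lemma compact_Z: "compact_space Z"
proof -
  let ?\<F> = "insert (topspace PS) {{x \<in> topspace PS. B i j (x j) = x i} | i j. i \<in> I \<and> j \<in> I \<and> cle i j}"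
  have "closedin PS K" if "K \<in> ?\<F>" for K using that closed_bonding closedin_topspace[of PS] by blast
  then have cl: "closedin PS (\<Inter>?\<F>)" by (intro closedin_Inter) blast+
  have "Z = subtopology PS (\<Inter>?\<F>)"
    unfolding universal_space_def by (subst subtopology_restrict[symmetric]) (rule arg_cong2[of _ _ _ _ subtopology], auto)
  then show ?thesis using compact_space_subtopology[OF closedin_compact_space[OF compact_PS cl]] by simp
qed

text \<open>
  The limit sits in a product of countably many metrizable spaces.
\<close>

lemma metrizable_Z: "metrizable_space Z"
proof -
  have "countable I" using countable_covers[OF continuum_X all_covers] .
  then have "countable {i \<in> I. \<nexists>a. topspace (S i) \<subseteq> {a}}" by (rule countable_subset[rotated]) blast
  then have "metrizable_space PS"
    unfolding metrizable_space_product_topology using normal normal_covering.metrizable normal_cover.axioms(1) by blast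
  then show ?thesis unfolding universal_space_def by (rule metrizable_space_subtopology)
qed

text \<open>
  The points of the product that are compatible below an index \<open>m\<close> and have coordinate \<open>a\<close> form
  a directed family of nonempty closed sets; a common point of all of them lies in the limit.
\<close>

lemma Z_projection_onto:
  assumes i: "i \<in> I" and a: "a \<in> topspace (S i)"
  obtains x where "x \<in> topspace Z" "x i = a"
proof -
  define A where "A m = {x \<in> topspace PS. x i = a \<and> (\<forall>j\<in>I. cle j m \<longrightarrow> B j m (x m) = x j)}" for m
  have closed: "closedin PS (A m)" if m: "m \<in> I" for m
  proof -
    interpret i: cover X "C i" by (rule cov[OF i])
    let ?\<F> = "insert {x \<in> topspace PS. x i \<in> {a}} {{x \<in> topspace PS. B j m (x m) = x j} | j. j \<in> I \<and> cle j m}"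
    have "closedin (S i) {a}" using i.Hausdorff a by (simp add: closedin_Hausdorff_singleton)
    then have "closedin PS {x \<in> topspace PS. x i \<in> {a}}"
      by (rule closedin_continuous_map_preimage[OF PS_projection[OF i]])
    then have "closedin PS (\<Inter>?\<F>)" using closed_bonding m by (intro closedin_Inter) auto
    moreover have "A m = \<Inter>?\<F>" unfolding A_def by auto
    ultimately show ?thesis by simp
  qed
  have nonempty: "A m \<noteq> {}" if m: "m \<in> I" for m
  proof -
    obtain k where k: "k \<in> I" "cle i k" "cle m k" by (rule directed[OF i m])
    have "a \<in> B i k ` topspace (S k)" unfolding bonding(2)[OF i k(1,2)] by (rule a)
    then obtain c where c: "c \<in> topspace (S k)" "a = B i k c" by blast
    \<comment> \<open>\<open>A m\<close> constrains coordinates below \<open>m\<close>, hence below \<open>k\<close>; the others may be basepoints.\<close>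
    define x where "x = (\<lambda>j\<in>I. if cle j k then B j k c else base j)"
    have "x \<in> topspace PS"
      using bonding(5)[OF _ k(1) _ c(1)] base(1) by (auto simp: x_def)
    moreover have "B j m (x m) = x j" if j: "j \<in> I" "cle j m" for j
      using bonding_comp[OF j(1) m k(1) j(2) k(3) c(1)] le_trans[OF j(2) k(3)] j(1) m k(3) by (simp add: x_def)
    moreover have "x i = a" using c(2) k(2) i by (simp add: x_def)
    ultimately show ?thesis by (auto simp: A_def)
  qed
  have dir: "\<exists>k\<in>I. A k \<subseteq> A m \<and> A k \<subseteq> A n" if m: "m \<in> I" and n: "n \<in> I" for m n
  proof -
    obtain k where k: "k \<in> I" "cle m k" "cle n k" by (rule directed[OF m n])
    have "A k \<subseteq> A l" if l: "l \<in> I" "cle l k" for l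
    proof (rule subsetI)
      fix x assume x: "x \<in> A k"
      then have xk: "x k \<in> topspace (S k)" "B j k (x k) = x j" if "j \<in> I" "cle j k" for j
        using that k(1) by (auto simp: A_def)
      have "B j l (x l) = x j" if j: "j \<in> I" "cle j l" for j
        using bonding_comp[OF j(1) l(1) k(1) j(2) l(2) xk(1)[OF l]] xk(2)[OF l] xk(2)[OF j(1) le_trans[OF j(2) l(2)]] by simp
      then show "x \<in> A l" using x by (simp add: A_def)
    qed
    then show ?thesis using k m n by blast
  qed
  obtain x where x: "\<And>m. m \<in> I \<Longrightarrow> x \<in> A m"
    by (rule compact_directed_Inter[OF compact_PS index_nonempty closed nonempty dir]) (assumption | rule that)+
  have "x \<in> topspace Z" unfolding topspace_Z using x i by (auto simp: A_def)
  moreover have "x i = a" using x[OF i] by (simp add: A_def)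
  ultimately show thesis by (rule that)
qed

lemma Z_nonempty: "topspace Z \<noteq> {}"
proof -
  obtain i where i: "i \<in> I" using index_nonempty by blast
  obtain x where "x \<in> topspace Z" by (rule Z_projection_onto[OF i base(1)[OF i]])
  then show ?thesis by blast
qed

text \<open>
  An open set of the product restricts finitely many coordinates; a common upper bound
  \<open>k\<close> determines all of them.
\<close>

lemma Z_base:
  assumes U: "openin Z U" and x: "x \<in> U"
  obtains k W where "k \<in> I" "openin (S k) W" "x k \<in> W" "\<And>y. y \<in> topspace Z \<Longrightarrow> y k \<in> W \<Longrightarrow> y \<in> U"
proof -
  have xZ: "x \<in> topspace Z" using openin_subset[OF U] x by blast
  obtain U' where U': "openin PS U'" and UU': "U = U' \<inter> {x. \<forall>i\<in>I. \<forall>j\<in>I. cle i j \<longrightarrow> B i j (x j) = x i}"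
    using U unfolding universal_space_def openin_subtopology by blast
  have xU': "x \<in> U'" using x UU' by blast
  obtain V where V: "finite {i \<in> I. V i \<noteq> topspace (S i)}" "\<forall>i\<in>I. openin (S i) (V i)" "x \<in> PiE I V" "PiE I V \<subseteq> U'"
    using openin_product_topology_alt[THEN iffD1, OF U', THEN bspec, OF xU'] by (elim exE conjE) (rule that)
  define J where "J = {i \<in> I. V i \<noteq> topspace (S i)}"
  have JI: "j \<in> I" if "j \<in> J" for j using that by (simp add: J_def)
  obtain k where k: "k \<in> I" "\<And>j. j \<in> J \<Longrightarrow> cle j k" using directed_finite[of J] V(1) JI unfolding J_def[symmetric] by blast
  define W where "W = {c \<in> topspace (S k). \<forall>j\<in>J. B j k c \<in> V j}"
  have "openin (S k) {c \<in> topspace (S k). B j k c \<in> V j}" if j: "j \<in> J" for j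
    using openin_continuous_map_preimage[OF bonding(1)[OF JI[OF j] k(1) k(2)[OF j]]] V(2) JI[OF j] by blast
  then have "openin (S k) K" if "K \<in> insert (topspace (S k)) ((\<lambda>j. {c \<in> topspace (S k). B j k c \<in> V j}) ` J)" for K
    using that openin_topspace by blast
  then have "openin (S k) (\<Inter>(insert (topspace (S k)) ((\<lambda>j. {c \<in> topspace (S k). B j k c \<in> V j}) ` J)))"
    using V(1) unfolding J_def[symmetric] by (intro openin_Inter) blast+
  moreover have "\<Inter>(insert (topspace (S k)) ((\<lambda>j. {c \<in> topspace (S k). B j k c \<in> V j}) ` J)) = W"
    unfolding W_def by blast
  ultimately have "openin (S k) W" by simp
  moreover have "x k \<in> W"
    unfolding W_def using Z_coordinate[OF xZ k(1)] Z_bonding[OF xZ JI k(1) k(2)] JI PiE_mem[OF V(3)] by simp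
  moreover have "y \<in> U" if y: "y \<in> topspace Z" "y k \<in> W" for y
  proof -
    have "y i \<in> V i" if i: "i \<in> I" for i
    proof (cases "i \<in> J")
      case True
      then have "B i k (y k) \<in> V i" using y(2) unfolding W_def by blast
      then show ?thesis using Z_bonding[OF y(1) i k(1) k(2)[OF True]] by simp
    next
      case False
      then show ?thesis using Z_coordinate[OF y(1) i] i unfolding J_def by simp
    qed
    then have "y \<in> PiE I V" using y(1) unfolding topspace_Z by (auto simp: PiE_iff)
    then show ?thesis using V(4) UU' y(1) unfolding topspace_Z by blast
  qed
  ultimately show thesis using that[OF k(1)] by blast
qed

text \<open>
  Finitely many basic sets cover the compact limit, and an upper bound of their indices
  serves for all of them.
\<close>

lemma Z_entourage:
  assumes E: "E \<in> diag_nhds Z"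
  obtains i F where "i \<in> I" "F \<in> diag_nhds (S i)"
    "\<And>x y. x \<in> topspace Z \<Longrightarrow> y \<in> topspace Z \<Longrightarrow> (x i, y i) \<in> F \<Longrightarrow> (x, y) \<in> E"
proof -
  have "\<exists>k W. k \<in> I \<and> openin (S k) W \<and> x k \<in> W \<and> (\<forall>y\<in>topspace Z. \<forall>z\<in>topspace Z. y k \<in> W \<longrightarrow> z k \<in> W \<longrightarrow> (y, z) \<in> E)"
    if x: "x \<in> topspace Z" for x
  proof -
    obtain U where U: "openin Z U" "x \<in> U" "U \<times> U \<subseteq> E" using diag_nhds_D(3)[OF E x] by blast
    obtain k W where "k \<in> I" "openin (S k) W" "x k \<in> W" "\<And>y. y \<in> topspace Z \<Longrightarrow> y k \<in> W \<Longrightarrow> y \<in> U"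
      by (rule Z_base[OF U(1,2)]) (rule that)
    then show ?thesis using U(3) by (intro exI[of _ k] exI[of _ W]) blast
  qed
  then obtain k W where kW: "\<And>x. x \<in> topspace Z \<Longrightarrow> k x \<in> I \<and> openin (S (k x)) (W x) \<and> x (k x) \<in> W x \<and>
      (\<forall>y\<in>topspace Z. \<forall>z\<in>topspace Z. y (k x) \<in> W x \<longrightarrow> z (k x) \<in> W x \<longrightarrow> (y, z) \<in> E)" by metis
  have op: "openin Z {y \<in> topspace Z. y (k x) \<in> W x}" if "x \<in> topspace Z" for x
    using openin_continuous_map_preimage[OF Z_projection] kW[OF that] by blast
  obtain A where A: "A \<subseteq> topspace Z" "finite A" "topspace Z \<subseteq> (\<Union>x\<in>A. {y \<in> topspace Z. y (k x) \<in> W x})"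
  proof (rule compact_space_finite_subcover[OF compact_Z, of "\<lambda>x. {y \<in> topspace Z. y (k x) \<in> W x}"])
    fix x assume "x \<in> topspace Z"
    then show "openin Z {y \<in> topspace Z. y (k x) \<in> W x} \<and> x \<in> {y \<in> topspace Z. y (k x) \<in> W x}" using op kW by simp
  qed
  obtain m where m: "m \<in> I" "\<And>j. j \<in> k ` A \<Longrightarrow> cle j m"
  proof (rule directed_finite[of "k ` A"])
    show "finite (k ` A)" using A(2) by simp
    show "k ` A \<subseteq> I" using A(1) kW by blast
  qed (rule that)
  define V where "V x = {c \<in> topspace (S m). B (k x) m c \<in> W x}" for x
  have kx: "k x \<in> I" "cle (k x) m" "openin (S (k x)) (W x)" if "x \<in> A" for x
    using that A(1) kW[of x] m(2) by auto
  have Vo: "openin (S m) (V x)" if "x \<in> A" for x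
    unfolding V_def using openin_continuous_map_preimage[OF bonding(1)[OF kx(1)[OF that] m(1) kx(2)[OF that]] kx(3)[OF that]] .
  define F where "F = (\<Union>x\<in>A. V x \<times> V x)"
  have "F \<in> diag_nhds (S m)"
  proof (rule diag_nhdsI)
    show "F \<subseteq> topspace (S m) \<times> topspace (S m)" by (auto simp: F_def V_def)
    show "sym F" by (auto simp: F_def sym_def)
    fix c assume c: "c \<in> topspace (S m)"
    obtain z where z: "z \<in> topspace Z" "z m = c" by (rule Z_projection_onto[OF m(1) c])
    then obtain x where x: "x \<in> A" "z (k x) \<in> W x" using A(3) by blast
    have "B (k x) m c \<in> W x" using Z_bonding[OF z(1) kx(1)[OF x(1)] m(1) kx(2)[OF x(1)]] z(2) x(2) by simp
    then have "c \<in> V x" using c by (simp add: V_def)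
    then show "\<exists>V. openin (S m) V \<and> c \<in> V \<and> V \<times> V \<subseteq> F" using Vo[OF x(1)] x(1) unfolding F_def by blast
  qed
  moreover have "(y, z) \<in> E" if y: "y \<in> topspace Z" and z: "z \<in> topspace Z" and yz: "(y m, z m) \<in> F" for y z
  proof -
    obtain x where x: "x \<in> A" "y m \<in> V x" "z m \<in> V x" using yz unfolding F_def by blast
    have "y (k x) \<in> W x" "z (k x) \<in> W x"
      using x(2,3) Z_bonding[OF y kx(1)[OF x(1)] m(1) kx(2)[OF x(1)]] Z_bonding[OF z kx(1)[OF x(1)] m(1) kx(2)[OF x(1)]]
      by (simp_all add: V_def)
    then show ?thesis using kW[of x] x(1) A(1) y z by blast
  qed
  ultimately show thesis using that[OF m(1)] by blast
qed

text \<open>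
  A clopen set \<open>A\<close> and its complement are separated by an entourage, hence
  already in one coordinate \<open>i\<close>: the images of \<open>A\<close> and of its
  complement are disjoint closed sets covering the connected space of index
  \<open>i\<close>.
\<close>

lemma connected_Z: "connected_space Z"
  unfolding connected_space_clopen_in
proof (intro allI impI, elim conjE)
  fix A assume A: "openin Z A" "closedin Z A"
  let ?A' = "topspace Z - A"
  have A': "openin Z ?A'" "closedin Z ?A'" using A by auto
  let ?E = "A \<times> A \<union> ?A' \<times> ?A'"
  have AZ: "A \<subseteq> topspace Z" using openin_subset[OF A(1)] .
  have "?E \<in> diag_nhds Z"
  proof (rule diag_nhdsI)
    fix x assume "x \<in> topspace Z"
    then have "x \<in> A \<or> x \<in> ?A'" by blast
    then show "\<exists>V. openin Z V \<and> x \<in> V \<and> V \<times> V \<subseteq> ?E" using A(1) A'(1) by blast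
  qed (use AZ in \<open>auto simp: sym_def\<close>)
  then obtain i F where i: "i \<in> I" and F: "F \<in> diag_nhds (S i)"
    "\<And>x y. x \<in> topspace Z \<Longrightarrow> y \<in> topspace Z \<Longrightarrow> (x i, y i) \<in> F \<Longrightarrow> (x, y) \<in> ?E"
    by (rule Z_entourage) (rule that)
  interpret i: cover X "C i" by (rule cov[OF i])
  let ?f = "\<lambda>x. x i"
  have cl: "closedin (S i) (?f ` K)" if "closedin Z K" for K
    using T1_Spaces.continuous_imp_closed_map[OF Z_projection[OF i] compact_Z i.Hausdorff] that by (simp add: closed_map_def)
  have disj: "?f ` A \<inter> ?f ` ?A' = {}"
  proof (rule equals0I)
    fix c assume c: "c \<in> ?f ` A \<inter> ?f ` ?A'"
    obtain x where x: "x \<in> A" "x i = c" using c by (elim IntE imageE) simp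
    obtain y where y: "y \<in> ?A'" "y i = c" using c by (elim IntE imageE) simp
    have xZ: "x \<in> topspace Z" and yZ: "y \<in> topspace Z" using x(1) y(1) AZ by auto
    have "(x i, y i) \<in> F" using diag_nhds_D(4)[OF F(1) Z_coordinate[OF xZ i]] x(2) y(2) by simp
    then have "(x, y) \<in> ?E" by (rule F(2)[OF xZ yZ])
    then show False using x(1) y(1) by simp
  qed
  have union: "?f ` A \<union> ?f ` ?A' = topspace (S i)"
  proof (rule equalityI; rule subsetI)
    fix c assume "c \<in> ?f ` A \<union> ?f ` ?A'"
    then show "c \<in> topspace (S i)" using Z_coordinate[OF _ i] AZ by blast
  next
    fix c assume "c \<in> topspace (S i)"
    then obtain x where "x \<in> topspace Z" "x i = c" by (rule Z_projection_onto[OF i])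
    then show "c \<in> ?f ` A \<union> ?f ` ?A'" by blast
  qed
  have "topspace (S i) - ?f ` ?A' = ?f ` A" using disj union by blast
  then have "openin (S i) (?f ` A)" using cl[OF A'(2)] by (metis closedin_def)
  then have "?f ` A = {} \<or> ?f ` A = topspace (S i)"
    using cl[OF A(2)] i.connected unfolding connected_space_clopen_in by blast
  then show "A = {} \<or> A = topspace Z"
  proof
    assume "?f ` A = topspace (S i)"
    then have "?f ` ?A' = {}" using disj union by blast
    then show ?thesis using AZ by blast
  qed blast
qed

end


section \<open>The profinite fundamental group\<close>

text \<open>
  Open maps take squares of open sets to squares of open sets.
\<close>

lemma diag_nhds_open_map_image:
  assumes f: "continuous_map Y X f" "open_map Y X f" "f ` topspace Y = topspace X"
  shows "diag_nhds X = image_uniformity f (diag_nhds Y)"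
proof (rule equalityI; rule subsetI)
  fix W assume W: "W \<in> diag_nhds X"
  show "W \<in> image_uniformity f (diag_nhds Y)"
    unfolding image_uniformity_iff f(3) using diag_nhds_D(1,2)[OF W] preimage_diag_nhds[OF f(1) W] by simp
next
  fix W assume "W \<in> image_uniformity f (diag_nhds Y)"
  then have W: "W \<subseteq> topspace X \<times> topspace X" "sym W" "{(x, y) \<in> topspace Y \<times> topspace Y. (f x, f y) \<in> W} \<in> diag_nhds Y"
    unfolding image_uniformity_iff f(3) by simp_all
  show "W \<in> diag_nhds X"
  proof (rule diag_nhdsI[OF W(1,2)])
    fix x assume "x \<in> topspace X"
    then obtain y where y: "y \<in> topspace Y" "f y = x" unfolding f(3)[symmetric] by (rule imageE) simp
    obtain V where V: "openin Y V" "y \<in> V" "V \<times> V \<subseteq> {(x, y) \<in> topspace Y \<times> topspace Y. (f x, f y) \<in> W}"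
      using diag_nhds_D(3)[OF W(3) y(1)] by blast
    have "f ` V \<times> f ` V \<subseteq> W" using V(3) by auto
    moreover have "openin X (f ` V)" using f(2) V(1) by (simp add: open_map_def)
    moreover have "x \<in> f ` V" using V(2) y(2) by blast
    ultimately show "\<exists>V. openin X V \<and> x \<in> V \<and> V \<times> V \<subseteq> W" by (intro exI conjI)
  qed
qed

context cover_system
begin

abbreviation "\<Gamma> \<equiv> profinite_group I C"
abbreviation "\<Psi> \<equiv> universal_action I C"
abbreviation "proj \<equiv> universal_projection I C"

lemma bonding_hom:
  assumes i: "i \<in> I" and j: "j \<in> I" and le: "cle i j" and g: "g \<in> carrier (D j)"
  shows "\<Theta> i j g \<in> carrier (D i)" "y \<in> topspace (S j) \<Longrightarrow> act i (\<Theta> i j g) (B i j y) = B i j (act j g y)"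
  using theI'[OF deck_transfer[OF cov[OF i] cov[OF j] bonding(1)[OF i j le] bonding(3)[OF i j le] g]]
  unfolding bonding_hom_def by blast+

text \<open>
  By freeness, the value at one point identifies the image of a deck transformation under a
  bonding homomorphism.
\<close>

lemma bonding_hom_eqI:
  assumes i: "i \<in> I" and j: "j \<in> I" and le: "cle i j" and g: "g \<in> carrier (D j)"
    and g': "g' \<in> carrier (D i)" and y: "y \<in> topspace (S j)" and eq: "act i g' (B i j y) = B i j (act j g y)"
  shows "\<Theta> i j g = g'"
proof -
  interpret i: cover X "C i" by (rule cov[OF i])
  show ?thesis
    using i.free_act[OF bonding_hom(1)[OF i j le g] g' bonding(5)[OF i j le y]] bonding_hom(2)[OF i j le g y] eq by simp
qed

lemma group_D: "i \<in> I \<Longrightarrow> group (D i)"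
proof -
  assume "i \<in> I"
  then interpret i: cover X "C i" by (rule cov)
  show ?thesis by (rule i.is_group)
qed

lemma carrier_\<Gamma>: "g \<in> carrier \<Gamma> \<longleftrightarrow> g \<in> (\<Pi>\<^sub>E i\<in>I. carrier (D i)) \<and> (\<forall>i\<in>I. \<forall>j\<in>I. cle i j \<longrightarrow> \<Theta> i j (g j) = g i)"
  by (simp add: profinite_group_def)

lemma \<Gamma>_coordinate: "g \<in> carrier \<Gamma> \<Longrightarrow> i \<in> I \<Longrightarrow> g i \<in> carrier (D i)"
  unfolding carrier_\<Gamma> by (meson PiE_mem)

lemma \<Gamma>_bonding: "g \<in> carrier \<Gamma> \<Longrightarrow> i \<in> I \<Longrightarrow> j \<in> I \<Longrightarrow> cle i j \<Longrightarrow> \<Theta> i j (g j) = g i"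
  unfolding carrier_\<Gamma> by meson

lemma \<Gamma>_mult: "(g \<otimes>\<^bsub>\<Gamma>\<^esub> h) = (\<lambda>i\<in>I. g i \<otimes>\<^bsub>D i\<^esub> h i)"
  by (simp add: profinite_group_def product_group_def)

lemma \<Gamma>_one: "\<one>\<^bsub>\<Gamma>\<^esub> = (\<lambda>i\<in>I. \<one>\<^bsub>D i\<^esub>)"
  by (simp add: profinite_group_def product_group_def)

lemma group_\<Gamma>: "group \<Gamma>"
proof -
  have "subgroup (carrier \<Gamma>) (product_group I D)"
  proof (rule group.subgroupI)
    show "group (product_group I D)" by (rule product_group) (rule group_D)
    show "carrier \<Gamma> \<subseteq> carrier (product_group I D)" by (rule subsetI) (simp add: carrier_\<Gamma>)
    have "\<one>\<^bsub>\<Gamma>\<^esub> \<in> carrier \<Gamma>"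
      unfolding carrier_\<Gamma> \<Gamma>_one
    proof (intro conjI ballI impI)
      show "(\<lambda>i\<in>I. \<one>\<^bsub>D i\<^esub>) \<in> (\<Pi>\<^sub>E i\<in>I. carrier (D i))"
        using monoid.one_closed[OF group.is_monoid[OF group_D]] by simp
      fix i j assume i: "i \<in> I" and j: "j \<in> I" and le: "cle i j"
      interpret i: cover X "C i" by (rule cov[OF i])
      interpret j: cover X "C j" by (rule cov[OF j])
      have "\<Theta> i j \<one>\<^bsub>D j\<^esub> = \<one>\<^bsub>D i\<^esub>"
        using i.act_one[OF bonding(5)[OF i j le base(1)[OF j]]] j.act_one[OF base(1)[OF j]]
          monoid.one_closed[OF group.is_monoid[OF j.is_group]] monoid.one_closed[OF group.is_monoid[OF i.is_group]]
        by (intro bonding_hom_eqI[OF i j le _ _ base(1)[OF j]]) simp_all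
      then show "\<Theta> i j ((\<lambda>i\<in>I. \<one>\<^bsub>D i\<^esub>) j) = (\<lambda>i\<in>I. \<one>\<^bsub>D i\<^esub>) i" using i j by simp
    qed
    then show "carrier \<Gamma> \<noteq> {}" by blast
    fix g assume g: "g \<in> carrier \<Gamma>"
    have gP: "g \<in> (\<Pi>\<^sub>E i\<in>I. carrier (D i))" using g unfolding carrier_\<Gamma> by blast
    have ginv: "inv\<^bsub>D i\<^esub> (g i) \<in> carrier (D i)" if "i \<in> I" for i
      using group.inv_closed[OF group_D[OF that] \<Gamma>_coordinate[OF g that]] .
    have "(\<lambda>i\<in>I. inv\<^bsub>D i\<^esub> (g i)) \<in> carrier \<Gamma>"
      unfolding carrier_\<Gamma>
    proof (intro conjI ballI impI)
      show "(\<lambda>i\<in>I. inv\<^bsub>D i\<^esub> (g i)) \<in> (\<Pi>\<^sub>E i\<in>I. carrier (D i))" using ginv by simp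
      fix i j assume i: "i \<in> I" and j: "j \<in> I" and le: "cle i j"
      interpret i: cover X "C i" by (rule cov[OF i])
      interpret j: cover X "C j" by (rule cov[OF j])
      note gi = \<Gamma>_coordinate[OF g i] and gj = \<Gamma>_coordinate[OF g j]
      let ?y = "act j (g j) (base j)"
      have y: "?y \<in> topspace (S j)" using j.act_closed[OF gj base(1)[OF j]] .
      have "act i (g i) (B i j (base j)) = B i j ?y"
        using bonding_hom(2)[OF i j le gj base(1)[OF j]] \<Gamma>_bonding[OF g i j le] by simp
      then have "act i (inv\<^bsub>D i\<^esub> (g i)) (B i j ?y) = B i j (base j)"
        using i.act_inv(1)[OF gi bonding(5)[OF i j le base(1)[OF j]]] by simp
      then have "\<Theta> i j (inv\<^bsub>D j\<^esub> (g j)) = inv\<^bsub>D i\<^esub> (g i)"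
        using j.act_inv(1)[OF gj base(1)[OF j]] by (intro bonding_hom_eqI[OF i j le ginv[OF j] ginv[OF i] y]) simp
      then show "\<Theta> i j ((\<lambda>i\<in>I. inv\<^bsub>D i\<^esub> (g i)) j) = (\<lambda>i\<in>I. inv\<^bsub>D i\<^esub> (g i)) i" using i j by simp
    qed
    then show "inv\<^bsub>product_group I D\<^esub> g \<in> carrier \<Gamma>" using inv_product_group[OF gP group_D] by simp
    fix h assume h: "h \<in> carrier \<Gamma>"
    have mc: "g i \<otimes>\<^bsub>D i\<^esub> h i \<in> carrier (D i)" if "i \<in> I" for i
      using monoid.m_closed[OF group.is_monoid[OF group_D[OF that]]] \<Gamma>_coordinate[OF g that] \<Gamma>_coordinate[OF h that] .
    have "(\<lambda>i\<in>I. g i \<otimes>\<^bsub>D i\<^esub> h i) \<in> carrier \<Gamma>"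
      unfolding carrier_\<Gamma>
    proof (intro conjI ballI impI)
      show "(\<lambda>i\<in>I. g i \<otimes>\<^bsub>D i\<^esub> h i) \<in> (\<Pi>\<^sub>E i\<in>I. carrier (D i))" using mc by simp
      fix i j assume i: "i \<in> I" and j: "j \<in> I" and le: "cle i j"
      interpret i: cover X "C i" by (rule cov[OF i])
      interpret j: cover X "C j" by (rule cov[OF j])
      note gi = \<Gamma>_coordinate[OF g i] and gj = \<Gamma>_coordinate[OF g j] and hi = \<Gamma>_coordinate[OF h i] and hj = \<Gamma>_coordinate[OF h j]
      note b = base(1)[OF j]
      have "act i (g i \<otimes>\<^bsub>D i\<^esub> h i) (B i j (base j)) = act i (g i) (act i (h i) (B i j (base j)))"
        using i.composition_rule[OF bonding(5)[OF i j le b] gi hi] .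
      also have "\<dots> = act i (g i) (B i j (act j (h j) (base j)))"
        using bonding_hom(2)[OF i j le hj b] \<Gamma>_bonding[OF h i j le] by simp
      also have "\<dots> = B i j (act j (g j) (act j (h j) (base j)))"
        using bonding_hom(2)[OF i j le gj j.act_closed[OF hj b]] \<Gamma>_bonding[OF g i j le] by simp
      also have "\<dots> = B i j (act j (g j \<otimes>\<^bsub>D j\<^esub> h j) (base j))"
        using j.composition_rule[OF b gj hj] by simp
      finally have "\<Theta> i j (g j \<otimes>\<^bsub>D j\<^esub> h j) = g i \<otimes>\<^bsub>D i\<^esub> h i"
        by (rule bonding_hom_eqI[OF i j le mc[OF j] mc[OF i] b])
      then show "\<Theta> i j ((\<lambda>i\<in>I. g i \<otimes>\<^bsub>D i\<^esub> h i) j) = (\<lambda>i\<in>I. g i \<otimes>\<^bsub>D i\<^esub> h i) i" using i j by simp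
    qed
    then show "g \<otimes>\<^bsub>product_group I D\<^esub> h \<in> carrier \<Gamma>" by simp
  qed
  then have "group ((product_group I D)\<lparr>carrier := carrier \<Gamma>\<rparr>)"
    by (rule subgroup.subgroup_is_group) (rule product_group, rule group_D)
  then show ?thesis by (simp add: profinite_group_def)
qed

lemma \<Psi>_coordinate: "x \<in> topspace Z \<Longrightarrow> i \<in> I \<Longrightarrow> \<Psi> g x i = act i (g i) (x i)"
  by (simp add: universal_action_def)

lemma \<Psi>_closed:
  assumes g: "g \<in> carrier \<Gamma>" and x: "x \<in> topspace Z" shows "\<Psi> g x \<in> topspace Z"
  unfolding topspace_Z
proof (intro conjI ballI impI)
  have "act i (g i) (x i) \<in> topspace (S i)" if i: "i \<in> I" for i
  proof -
    interpret i: cover X "C i" by (rule cov[OF i])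
    show ?thesis using i.act_closed[OF \<Gamma>_coordinate[OF g i] Z_coordinate[OF x i]] .
  qed
  then show "\<Psi> g x \<in> topspace PS" using x by (simp add: universal_action_def)
  fix i j assume i: "i \<in> I" and j: "j \<in> I" and le: "cle i j"
  show "B i j (\<Psi> g x j) = \<Psi> g x i"
    using bonding_hom(2)[OF i j le \<Gamma>_coordinate[OF g j] Z_coordinate[OF x j]] \<Gamma>_bonding[OF g i j le] Z_bonding[OF x i j le]
      \<Psi>_coordinate[OF x i] \<Psi>_coordinate[OF x j] by simp
qed

lemma Z_eqI:
  assumes "x \<in> topspace Z" "y \<in> topspace Z" "\<And>i. i \<in> I \<Longrightarrow> x i = y i" shows "x = y"
proof (rule extensionalityI[of _ I])
  show "x \<in> extensional I" "y \<in> extensional I" using assms(1,2) unfolding topspace_Z by (auto simp: PiE_iff)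
qed (rule assms(3))

lemma \<Gamma>_eqI:
  assumes "g \<in> carrier \<Gamma>" "h \<in> carrier \<Gamma>" "\<And>i. i \<in> I \<Longrightarrow> g i = h i" shows "g = h"
proof (rule extensionalityI[of _ I])
  show "g \<in> extensional I" "h \<in> extensional I" using assms(1,2) unfolding carrier_\<Gamma> by (auto simp: PiE_iff)
qed (rule assms(3))

lemma \<Gamma>_free_coordinate:
  assumes g: "g \<in> carrier \<Gamma>" and h: "h \<in> carrier \<Gamma>" and x: "x \<in> topspace Z" and i: "i \<in> I"
    and eq: "\<Psi> g x i = \<Psi> h x i"
  shows "g i = h i"
proof -
  interpret i: cover X "C i" by (rule cov[OF i])
  show ?thesis
    using i.free_act[OF \<Gamma>_coordinate[OF g i] \<Gamma>_coordinate[OF h i] Z_coordinate[OF x i]] eq \<Psi>_coordinate[OF x i] by simp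
qed

lemma faithful_\<Psi>: "faithful_action \<Gamma> (topspace Z) \<Psi>"
proof (rule faithful_actionI[OF group_\<Gamma>])
  have oc: "\<one>\<^bsub>\<Gamma>\<^esub> \<in> carrier \<Gamma>" using monoid.one_closed[OF group.is_monoid[OF group_\<Gamma>]] .
  show "\<Psi> g \<in> extensional (topspace Z)" for g by (simp add: universal_action_def)
  show "\<Psi> g x \<in> topspace Z" if "g \<in> carrier \<Gamma>" "x \<in> topspace Z" for g x using \<Psi>_closed[OF that] .
  show one: "\<Psi> \<one>\<^bsub>\<Gamma>\<^esub> x = x" if x: "x \<in> topspace Z" for x
  proof (rule Z_eqI[OF \<Psi>_closed[OF oc x] x])
    fix i assume i: "i \<in> I"
    interpret i: cover X "C i" by (rule cov[OF i])
    show "\<Psi> \<one>\<^bsub>\<Gamma>\<^esub> x i = x i" using i.act_one[OF Z_coordinate[OF x i]] \<Psi>_coordinate[OF x i] i by (simp add: \<Gamma>_one)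
  qed
  show "\<Psi> (g \<otimes>\<^bsub>\<Gamma>\<^esub> h) x = \<Psi> g (\<Psi> h x)" if g: "g \<in> carrier \<Gamma>" and h: "h \<in> carrier \<Gamma>" and x: "x \<in> topspace Z" for g h x
  proof (rule Z_eqI)
    show "\<Psi> (g \<otimes>\<^bsub>\<Gamma>\<^esub> h) x \<in> topspace Z"
      using \<Psi>_closed[OF monoid.m_closed[OF group.is_monoid[OF group_\<Gamma>] g h] x] .
    show "\<Psi> g (\<Psi> h x) \<in> topspace Z" using \<Psi>_closed[OF g \<Psi>_closed[OF h x]] .
    fix i assume i: "i \<in> I"
    interpret i: cover X "C i" by (rule cov[OF i])
    show "\<Psi> (g \<otimes>\<^bsub>\<Gamma>\<^esub> h) x i = \<Psi> g (\<Psi> h x) i"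
      using i.composition_rule[OF Z_coordinate[OF x i] \<Gamma>_coordinate[OF g i] \<Gamma>_coordinate[OF h i]]
        \<Psi>_coordinate[OF x i] \<Psi>_coordinate[OF \<Psi>_closed[OF h x] i] i by (simp add: \<Gamma>_mult)
  qed
  show "g = \<one>\<^bsub>\<Gamma>\<^esub>" if g: "g \<in> carrier \<Gamma>" and triv: "\<And>x. x \<in> topspace Z \<Longrightarrow> \<Psi> g x = x" for g
  proof -
    obtain x where x: "x \<in> topspace Z" using Z_nonempty by blast
    show ?thesis using \<Gamma>_free_coordinate[OF g oc x] triv[OF x] one[OF x] by (intro \<Gamma>_eqI[OF g oc]) simp
  qed
qed

lemma proj_coordinate:
  assumes x: "x \<in> topspace Z" and i: "i \<in> I" shows "proj x = p i (x i)"
  unfolding universal_projection_def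
proof (rule the_equality)
  show "\<forall>j\<in>I. p j (x j) = p i (x i)"
  proof
    fix j assume j: "j \<in> I"
    obtain k where k: "k \<in> I" "cle i k" "cle j k" using directed[OF i j] by blast
    show "p j (x j) = p i (x i)"
      using bonding(3)[OF i k(1,2) Z_coordinate[OF x k(1)]] bonding(3)[OF j k(1,3) Z_coordinate[OF x k(1)]]
        Z_bonding[OF x i k(1,2)] Z_bonding[OF x j k(1,3)] by simp
  qed
  show "q = p i (x i)" if "\<forall>i\<in>I. p i (x i) = q" for q using that i by simp
qed

text \<open>
  The deck transformations matching two points of a fibre in each coordinate are unique, so
  they are compatible with the bonding homomorphisms and form an element of the limit group.
\<close>

lemma proj_fibre:
  assumes x: "x \<in> topspace Z" and y: "y \<in> topspace Z"
  shows "proj x = proj y \<longleftrightarrow> (\<exists>g\<in>carrier \<Gamma>. y = \<Psi> g x)"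
proof
  assume eq: "proj x = proj y"
  have "\<exists>g. g \<in> carrier (D i) \<and> y i = act i g (x i)" if i: "i \<in> I" for i
  proof -
    interpret i: cover X "C i" by (rule cov[OF i])
    have "p i (x i) = p i (y i)" using proj_coordinate[OF x i] proj_coordinate[OF y i] eq by simp
    then show ?thesis unfolding i.fibre[OF Z_coordinate[OF x i] Z_coordinate[OF y i]] by (elim bexE) (intro exI conjI)
  qed
  then obtain g0 where g0: "\<And>i. i \<in> I \<Longrightarrow> g0 i \<in> carrier (D i) \<and> y i = act i (g0 i) (x i)" by metis
  define g where "g = restrict g0 I"
  have g: "g i \<in> carrier (D i)" "y i = act i (g i) (x i)" if "i \<in> I" for i using g0[OF that] that by (simp_all add: g_def)
  have "g \<in> carrier \<Gamma>"
    unfolding carrier_\<Gamma>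
  proof (intro conjI ballI impI)
    show "g \<in> (\<Pi>\<^sub>E i\<in>I. carrier (D i))" using g(1) by (simp add: g_def PiE_iff)
    fix i j assume i: "i \<in> I" and j: "j \<in> I" and le: "cle i j"
    show "\<Theta> i j (g j) = g i"
      using g(2)[OF i] g(2)[OF j] Z_bonding[OF x i j le] Z_bonding[OF y i j le]
      by (intro bonding_hom_eqI[OF i j le g(1)[OF j] g(1)[OF i] Z_coordinate[OF x j]]) simp
  qed
  moreover have "y = \<Psi> g x"
    using g(2) \<Psi>_coordinate[OF x] \<Psi>_closed[OF \<open>g \<in> carrier \<Gamma>\<close> x] by (intro Z_eqI[OF y]) simp_all
  ultimately show "\<exists>g\<in>carrier \<Gamma>. y = \<Psi> g x" by blast
next
  assume "\<exists>g\<in>carrier \<Gamma>. y = \<Psi> g x"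
  then obtain g where g: "g \<in> carrier \<Gamma>" "y = \<Psi> g x" by blast
  obtain i where i: "i \<in> I" using index_nonempty by blast
  interpret i: cover X "C i" by (rule cov[OF i])
  show "proj x = proj y"
    using i.over[OF \<Gamma>_coordinate[OF g(1) i] Z_coordinate[OF x i]] proj_coordinate[OF x i] proj_coordinate[OF y i]
      \<Psi>_coordinate[OF x i] g(2) by simp
qed

lemma continuous_into_Z:
  assumes "\<And>i. i \<in> I \<Longrightarrow> continuous_map W (S i) (\<lambda>w. h w i)" "\<And>w. w \<in> topspace W \<Longrightarrow> h w \<in> topspace Z"
  shows "continuous_map W Z h"
proof -
  have "continuous_map W PS h"
    unfolding continuous_map_componentwise using assms by (auto simp: topspace_Z PiE_iff)
  then show ?thesis
    unfolding universal_space_def using assms(2)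
    by (intro continuous_map_into_subtopology) (auto simp: universal_space_def)
qed

lemma \<Psi>_continuous:
  assumes g: "g \<in> carrier \<Gamma>" shows "continuous_map Z Z (\<Psi> g)"
proof (rule continuous_into_Z)
  fix i assume i: "i \<in> I"
  interpret i: cover X "C i" by (rule cov[OF i])
  have "continuous_map Z (S i) (act i (g i) \<circ> (\<lambda>x. x i))"
    using continuous_map_compose[OF Z_projection[OF i] homeomorphic_imp_continuous_map[OF i.act_homeomorphic[OF \<Gamma>_coordinate[OF g i]]]] .
  then show "continuous_map Z (S i) (\<lambda>x. \<Psi> g x i)"
    by (rule continuous_map_eq) (simp add: \<Psi>_coordinate[OF _ i])
qed (rule \<Psi>_closed[OF g])

lemma \<Psi>_homeomorphism:
  assumes g: "g \<in> carrier \<Gamma>" shows "over_homeomorphism Z proj (\<Psi> g)"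
proof -
  interpret a: faithful_action \<Gamma> "topspace Z" \<Psi> by (rule faithful_\<Psi>)
  have ig: "inv\<^bsub>\<Gamma>\<^esub> g \<in> carrier \<Gamma>" using group.inv_closed[OF group_\<Gamma> g] .
  have "homeomorphic_maps Z Z (\<Psi> g) (\<Psi> (inv\<^bsub>\<Gamma>\<^esub> g))"
    unfolding homeomorphic_maps_def using \<Psi>_continuous[OF g] \<Psi>_continuous[OF ig] a.act_inv[OF g] by simp
  then have "homeomorphic_map Z Z (\<Psi> g)" using homeomorphic_map_maps by blast
  moreover have "proj (\<Psi> g x) = proj x" if "x \<in> topspace Z" for x
    using proj_fibre[OF that \<Psi>_closed[OF g that]] g by auto
  ultimately show ?thesis by (simp add: over_homeomorphism_def)
qed

lemma X_Hausdorff: "Hausdorff_space X"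
  using continuum_X metrizable_imp_Hausdorff_space[of X] by (simp add: continuum_def)

lemma proj_continuous: "continuous_map Z X proj" and proj_onto: "proj ` topspace Z = topspace X"
proof -
  obtain i where i: "i \<in> I" using index_nonempty by blast
  interpret i: cover X "C i" by (rule cov[OF i])
  have "continuous_map Z X (p i \<circ> (\<lambda>x. x i))" using continuous_map_compose[OF Z_projection[OF i] i.f_continuous] .
  then show "continuous_map Z X proj" by (rule continuous_map_eq) (simp add: proj_coordinate[OF _ i])
  show "proj ` topspace Z = topspace X"
  proof (rule equalityI; rule subsetI)
    fix a assume "a \<in> proj ` topspace Z"
    then obtain x where "x \<in> topspace Z" "a = proj x" by blast
    then show "a \<in> topspace X" using continuous_map_image_subset_topspace[OF \<open>continuous_map Z X proj\<close>] by blast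
  next
    fix a assume "a \<in> topspace X"
    then obtain c where c: "c \<in> topspace (S i)" "p i c = a" using i.f_surj by blast
    obtain x where x: "x \<in> topspace Z" "x i = c" by (rule Z_projection_onto[OF i c(1)])
    then have "a = proj x" using proj_coordinate[OF x(1) i] c(2) by simp
    then show "a \<in> proj ` topspace Z" using x(1) by (rule image_eqI)
  qed
qed

lemma proj_open: "open_map Z X proj"
proof (rule open_map_orbit_map[OF compact_Z X_Hausdorff proj_continuous proj_onto])
  fix x y assume "x \<in> topspace Z" "y \<in> topspace Z" "proj x = proj y"
  then obtain g where "g \<in> carrier \<Gamma>" "y = \<Psi> g x" using proj_fibre by blast
  then show "\<exists>t. over_homeomorphism Z proj t \<and> t x = y" using \<Psi>_homeomorphism by blast
qed

lemma uniformity_Z: "compact_uniformity Z = diag_nhds Z"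
  using compact_uniformity_eq[OF compact_Z metrizable_Z] .

lemma coordinate_entourage:
  assumes "i \<in> I" "F \<in> diag_nhds (S i)"
  shows "{(x, y) \<in> topspace Z \<times> topspace Z. (x i, y i) \<in> F} \<in> diag_nhds Z"
  using preimage_diag_nhds[OF Z_projection[OF assms(1)] assms(2)] .

text \<open>
  The deck group of each coordinate is finite, so the intersection of the translates of an
  entourage of that coordinate is an invariant entourage.
\<close>

lemma \<Psi>_isomorphic: "acts_isomorphically (compact_uniformity Z) \<Gamma> \<Psi>"
  unfolding acts_isomorphically_def uniformity_Z ucarrier_diag_nhds
proof (intro conjI ballI)
  show "uniform_structure (diag_nhds Z)" by (rule uniform_structure_diag_nhds[OF compact_Z metrizable_Z])
  show "faithful_action \<Gamma> (topspace Z) \<Psi>" by (rule faithful_\<Psi>)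
  then interpret a: faithful_action \<Gamma> "topspace Z" \<Psi> .
  fix E assume "E \<in> diag_nhds Z"
  then obtain i F where i: "i \<in> I" and F: "F \<in> diag_nhds (S i)"
    "\<And>x y. x \<in> topspace Z \<Longrightarrow> y \<in> topspace Z \<Longrightarrow> (x i, y i) \<in> F \<Longrightarrow> (x, y) \<in> E"
    by (rule Z_entourage) (rule that)
  interpret i: cover X "C i" by (rule cov[OF i])
  define H where "H = {(a, b) \<in> topspace (S i) \<times> topspace (S i). \<forall>g\<in>carrier (D i). (act i g a, act i g b) \<in> F}"
  have H: "H \<in> diag_nhds (S i)"
  proof (rule diag_nhdsI)
    show "sym H" using diag_nhds_D(2)[OF F(1)] by (auto simp: H_def sym_def)
    fix a assume a: "a \<in> topspace (S i)"
    have "\<exists>V. openin (S i) V \<and> act i g a \<in> V \<and> V \<times> V \<subseteq> F" if "g \<in> carrier (D i)" for g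
      using diag_nhds_D(3)[OF F(1) i.act_closed[OF that a]] .
    then obtain V where V: "\<And>g. g \<in> carrier (D i) \<Longrightarrow> openin (S i) (V g) \<and> act i g a \<in> V g \<and> V g \<times> V g \<subseteq> F" by metis
    define N where "N g = {b \<in> topspace (S i). act i g b \<in> V g}" for g
    have N: "openin (S i) (N g)" "a \<in> N g" if g: "g \<in> carrier (D i)" for g
      using openin_continuous_map_preimage[OF homeomorphic_imp_continuous_map[OF i.act_homeomorphic[OF g]]] V[OF g] a
      by (auto simp: N_def)
    have ne: "N ` carrier (D i) \<noteq> {}" using monoid.one_closed[OF group.is_monoid[OF i.is_group]] by blast
    have "openin (S i) (\<Inter>(N ` carrier (D i)))"
      using N(1) i.finite_group ne by (intro openin_Inter) auto
    moreover have "a \<in> \<Inter>(N ` carrier (D i))" using N(2) by blast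
    moreover have "\<Inter>(N ` carrier (D i)) \<times> \<Inter>(N ` carrier (D i)) \<subseteq> H"
    proof (rule subsetI)
      fix q assume q: "q \<in> \<Inter>(N ` carrier (D i)) \<times> \<Inter>(N ` carrier (D i))"
      obtain b c where bc: "q = (b, c)" by (cases q)
      have bN: "b \<in> N g" "c \<in> N g" if "g \<in> carrier (D i)" for g using q that unfolding bc by blast+
      have "b \<in> topspace (S i)" "c \<in> topspace (S i)" using bN ne unfolding N_def by blast+
      moreover have "(act i g b, act i g c) \<in> F" if g: "g \<in> carrier (D i)" for g
        using bN[OF g] V[OF g] unfolding N_def by blast
      ultimately show "q \<in> H" unfolding bc H_def by simp
    qed
    ultimately show "\<exists>V. openin (S i) V \<and> a \<in> V \<and> V \<times> V \<subseteq> H" by blast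
  qed (auto simp: H_def)
  have Hinv: "(act i g a, act i g b) \<in> H" if g: "g \<in> carrier (D i)" and ab: "(a, b) \<in> H" for g a b
  proof -
    have S: "a \<in> topspace (S i)" "b \<in> topspace (S i)" using ab by (auto simp: H_def)
    have "(act i k (act i g a), act i k (act i g b)) \<in> F" if k: "k \<in> carrier (D i)" for k
      using ab monoid.m_closed[OF group.is_monoid[OF i.is_group] k g]
        i.composition_rule[OF S(1) k g] i.composition_rule[OF S(2) k g] unfolding H_def by auto
    then show ?thesis using i.act_closed[OF g] S unfolding H_def by simp
  qed
  have HF: "H \<subseteq> F"
  proof (rule subsetI)
    fix q assume q: "q \<in> H"
    obtain a b where ab: "q = (a, b)" by (cases q)
    have "(act i \<one>\<^bsub>D i\<^esub> a, act i \<one>\<^bsub>D i\<^esub> b) \<in> F" "a \<in> topspace (S i)" "b \<in> topspace (S i)"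
      using q monoid.one_closed[OF group.is_monoid[OF i.is_group]] unfolding ab H_def by auto
    then show "q \<in> F" using i.act_one ab by simp
  qed
  define K where "K = {(x, y) \<in> topspace Z \<times> topspace Z. (x i, y i) \<in> H}"
  have K: "K \<in> diag_nhds Z" unfolding K_def by (rule coordinate_entourage[OF i H])
  have K1: "(\<Psi> g x, \<Psi> g y) \<in> K" if g: "g \<in> carrier \<Gamma>" and xy: "(x, y) \<in> K" for g x y
  proof -
    have S: "x \<in> topspace Z" "y \<in> topspace Z" "(x i, y i) \<in> H" using xy by (auto simp: K_def)
    show ?thesis
      using \<Psi>_closed[OF g] S Hinv[OF \<Gamma>_coordinate[OF g i] S(3)] \<Psi>_coordinate[OF S(1) i] \<Psi>_coordinate[OF S(2) i]
      by (simp add: K_def)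
  qed
  have "map_prod (\<Psi> g) (\<Psi> g) ` K = K" if g: "g \<in> carrier \<Gamma>" for g
  proof (rule equalityI; rule subsetI)
    fix q assume "q \<in> map_prod (\<Psi> g) (\<Psi> g) ` K"
    then obtain x y where "(x, y) \<in> K" "q = (\<Psi> g x, \<Psi> g y)" by auto
    then show "q \<in> K" using K1[OF g] by simp
  next
    fix q assume q: "q \<in> K"
    obtain x y where xy: "q = (x, y)" by (cases q)
    have S: "x \<in> topspace Z" "y \<in> topspace Z" using q xy by (auto simp: K_def)
    have "(\<Psi> (inv\<^bsub>\<Gamma>\<^esub> g) x, \<Psi> (inv\<^bsub>\<Gamma>\<^esub> g) y) \<in> K" using K1[OF group.inv_closed[OF group_\<Gamma> g]] q xy by simp
    moreover have "q = map_prod (\<Psi> g) (\<Psi> g) (\<Psi> (inv\<^bsub>\<Gamma>\<^esub> g) x, \<Psi> (inv\<^bsub>\<Gamma>\<^esub> g) y)"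
      using a.act_inv(2)[OF g] S xy by simp
    ultimately show "q \<in> map_prod (\<Psi> g) (\<Psi> g) ` K" by (rule rev_image_eqI)
  qed
  moreover have "K \<subseteq> E" using F(2) HF by (auto simp: K_def)
  ultimately show "\<exists>F\<in>diag_nhds Z. F \<subseteq> E \<and> (\<forall>g\<in>carrier \<Gamma>. map_prod (\<Psi> g) (\<Psi> g) ` F = F)"
    using K by (intro bexI[of _ K]) simp_all
qed

lemma kernel_subgroup:
  assumes i: "i \<in> I" shows "subgroup {g \<in> carrier \<Gamma>. g i = \<one>\<^bsub>D i\<^esub>} \<Gamma>"
proof -
  interpret G: group \<Gamma> by (rule group_\<Gamma>)
  interpret i: group "D i" by (rule group_D[OF i])
  have "group_hom \<Gamma> (D i) (\<lambda>g. g i)"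
    using i \<Gamma>_coordinate
    by (intro group_hom.intro group_hom_axioms.intro homI G.group_axioms i.group_axioms) (simp_all add: \<Gamma>_mult)
  then have "subgroup (kernel \<Gamma> (D i) (\<lambda>g. g i)) \<Gamma>" by (rule group_hom.subgroup_kernel)
  then show ?thesis by (simp add: kernel_def)
qed

text \<open>
  An entourage of coordinate \<open>i\<close> on which the covering is injective admits no
  element of the \<open>i\<close>-th deck group but the identity; so the group generated by
  the small elements is trivial in coordinate \<open>i\<close>.
\<close>

lemma \<Psi>_prodiscrete: "acts_prodiscretely (compact_uniformity Z) \<Gamma> \<Psi>"
  unfolding acts_prodiscretely_def uniformity_Z
proof
  fix E assume "E \<in> diag_nhds Z"
  then obtain i F where i: "i \<in> I" and F: "F \<in> diag_nhds (S i)"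
    "\<And>x y. x \<in> topspace Z \<Longrightarrow> y \<in> topspace Z \<Longrightarrow> (x i, y i) \<in> F \<Longrightarrow> (x, y) \<in> E"
    by (rule Z_entourage) (rule that)
  interpret i: cover X "C i" by (rule cov[OF i])
  obtain M where M: "M \<in> diag_nhds (S i)" "\<And>a b. (a, b) \<in> M \<Longrightarrow> p i a = p i b \<Longrightarrow> a = b"
    by (rule i.injective_entourage) blast
  define N where "N = {(x, y) \<in> topspace Z \<times> topspace Z. (x i, y i) \<in> M}"
  have oc: "\<one>\<^bsub>D i\<^esub> \<in> carrier (D i)" using monoid.one_closed[OF group.is_monoid[OF i.is_group]] .
  have "S_set (diag_nhds Z) \<Gamma> \<Psi> N \<subseteq> {g \<in> carrier \<Gamma>. g i = \<one>\<^bsub>D i\<^esub>}"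
  proof (rule subsetI)
    fix g assume "g \<in> S_set (diag_nhds Z) \<Gamma> \<Psi> N"
    then obtain x where g: "g \<in> carrier \<Gamma>" and x: "x \<in> topspace Z" "(x, \<Psi> g x) \<in> N"
      unfolding S_set_def ucarrier_diag_nhds by blast
    note gi = \<Gamma>_coordinate[OF g i] and xi = Z_coordinate[OF x(1) i]
    have "(x i, act i (g i) (x i)) \<in> M" using x(2) \<Psi>_coordinate[OF x(1) i] by (simp add: N_def)
    then have "x i = act i (g i) (x i)" using M(2) i.over[OF gi xi] by simp
    then have "g i = \<one>\<^bsub>D i\<^esub>" using i.free_act[OF gi oc xi] i.act_one[OF xi] by simp
    then show "g \<in> {g \<in> carrier \<Gamma>. g i = \<one>\<^bsub>D i\<^esub>}" using g by simp
  qed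
  then have ker: "N_subgroup (diag_nhds Z) \<Gamma> \<Psi> N \<subseteq> {g \<in> carrier \<Gamma>. g i = \<one>\<^bsub>D i\<^esub>}"
    unfolding N_subgroup_def using group.generate_subgroup_incl[OF group_\<Gamma> _ kernel_subgroup[OF i]] by blast
  have "N_subgroup (diag_nhds Z) \<Gamma> \<Psi> N \<subseteq> U_set (diag_nhds Z) \<Gamma> \<Psi> E"
  proof (rule subsetI)
    fix g assume "g \<in> N_subgroup (diag_nhds Z) \<Gamma> \<Psi> N"
    then have g: "g \<in> carrier \<Gamma>" "g i = \<one>\<^bsub>D i\<^esub>" using ker by blast+
    have "(x, \<Psi> g x) \<in> E" if x: "x \<in> topspace Z" for x
    proof -
      have "\<Psi> g x i = x i" using \<Psi>_coordinate[OF x i] g(2) i.act_one[OF Z_coordinate[OF x i]] by simp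
      then show ?thesis using F(2)[OF x \<Psi>_closed[OF g(1) x]] diag_nhds_D(4)[OF F(1) Z_coordinate[OF x i]] by simp
    qed
    then show "g \<in> U_set (diag_nhds Z) \<Gamma> \<Psi> E" unfolding U_set_def ucarrier_diag_nhds using g(1) by blast
  qed
  moreover have "N \<in> diag_nhds Z" unfolding N_def by (rule coordinate_entourage[OF i M(1)])
  ultimately show "\<exists>F\<in>diag_nhds Z. N_subgroup (diag_nhds Z) \<Gamma> \<Psi> F \<subseteq> U_set (diag_nhds Z) \<Gamma> \<Psi> E" by (intro bexI)
qed

lemma universal_prodiscrete_quotient: "prodiscrete_quotient Z \<Gamma> \<Psi> X proj"
proof
  have X: "compact_space X" "metrizable_space X" using continuum_X by (simp_all add: continuum_def)
  show "compact_space Z" "metrizable_space Z" by (rule compact_Z, rule metrizable_Z)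
  show "compact_space X" "metrizable_space X" using X .
  show "acts_isomorphically (compact_uniformity Z) \<Gamma> \<Psi>" by (rule \<Psi>_isomorphic)
  show "topspace Z \<noteq> {}" by (rule Z_nonempty)
  show "acts_prodiscretely (compact_uniformity Z) \<Gamma> \<Psi>" by (rule \<Psi>_prodiscrete)
  have "fibres_are_orbits (topspace Z) \<Gamma> \<Psi> proj"
    unfolding fibres_are_orbits_def orbit_def using proj_fibre by blast
  then show "isomorphic_quotient_map (compact_uniformity Z) \<Gamma> \<Psi> (compact_uniformity X) proj"
    unfolding isomorphic_quotient_map_def uniformity_Z compact_uniformity_eq[OF X] ucarrier_diag_nhds
    using \<Psi>_isomorphic[unfolded uniformity_Z] proj_onto
      diag_nhds_open_map_image[OF proj_continuous proj_open proj_onto] by blast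
qed

abbreviation "PT \<equiv> profinite_topology I C"

lemma topspace_PT: "topspace PT = carrier \<Gamma>"
  unfolding profinite_topology_def by (auto simp: carrier_\<Gamma>)

lemma PT_projection: "i \<in> I \<Longrightarrow> continuous_map PT (discrete_topology (carrier (D i))) (\<lambda>g. g i)"
  unfolding profinite_topology_def by (intro continuous_map_from_subtopology continuous_map_product_projection)

lemma compact_PT: "compact_space PT"
proof -
  let ?P = "product_topology (\<lambda>i. discrete_topology (carrier (D i))) I"
  let ?\<F> = "insert (topspace ?P) {{g \<in> topspace ?P. \<Theta> i j (g j) = g i} | i j. i \<in> I \<and> j \<in> I \<and> cle i j}"
  have fin: "finite (carrier (D i))" if i: "i \<in> I" for i
  proof -
    interpret i: cover X "C i" by (rule cov[OF i])
    show ?thesis by (rule i.finite_group)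
  qed
  have P: "compact_space ?P" unfolding compact_space_product_topology using fin by (simp add: compact_space_discrete_topology)
  have "closedin ?P {g \<in> topspace ?P. \<Theta> i j (g j) = g i}" if i: "i \<in> I" and j: "j \<in> I" and le: "cle i j" for i j
  proof -
    have pr: "continuous_map ?P (discrete_topology (carrier (D k))) (\<lambda>g. g k)" if "k \<in> I" for k
      using continuous_map_product_projection[OF that] .
    have "continuous_map (discrete_topology (carrier (D j))) (discrete_topology (carrier (D i))) (\<Theta> i j)"
      using bonding_hom(1)[OF i j le] by auto
    then have "continuous_map ?P (discrete_topology (carrier (D i))) (\<Theta> i j \<circ> (\<lambda>g. g j))"
      using continuous_map_compose[OF pr[OF j]] by blast
    then show ?thesis using closedin_continuous_maps_eq[OF _ _ pr[OF i]] by (simp add: comp_def)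
  qed
  then have "closedin ?P K" if "K \<in> ?\<F>" for K using that closedin_topspace[of ?P] by blast
  then have cl: "closedin ?P (\<Inter>?\<F>)" by (intro closedin_Inter) blast+
  have "carrier \<Gamma> = \<Inter>?\<F>"
  proof (rule equalityI; rule subsetI)
    fix g assume g: "g \<in> \<Inter>?\<F>"
    then have "g \<in> topspace ?P" by blast
    moreover have "\<Theta> i j (g j) = g i" if "i \<in> I" "j \<in> I" "cle i j" for i j
    proof -
      have "{g \<in> topspace ?P. \<Theta> i j (g j) = g i} \<in> ?\<F>" using that by blast
      then have "g \<in> {g \<in> topspace ?P. \<Theta> i j (g j) = g i}" using g by (rule InterD[rotated])
      then show ?thesis by simp
    qed
    ultimately show "g \<in> carrier \<Gamma>" unfolding carrier_\<Gamma> by simp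
  qed (auto simp: carrier_\<Gamma>)
  then show ?thesis
    unfolding profinite_topology_def using compact_space_subtopology[OF closedin_compact_space[OF P cl]] by simp
qed

lemma orbit_map_continuous:
  assumes x: "x \<in> topspace Z" shows "continuous_map PT Z (\<lambda>g. \<Psi> g x)"
proof (rule continuous_into_Z)
  fix i assume i: "i \<in> I"
  interpret i: cover X "C i" by (rule cov[OF i])
  have "continuous_map (discrete_topology (carrier (D i))) (S i) (\<lambda>g. act i g (x i))"
    using i.act_closed Z_coordinate[OF x i] by auto
  then have "continuous_map PT (S i) ((\<lambda>g. act i g (x i)) \<circ> (\<lambda>g. g i))"
    using continuous_map_compose[OF PT_projection[OF i]] by blast
  then show "continuous_map PT (S i) (\<lambda>g. \<Psi> g x i)" using \<Psi>_coordinate[OF x i] by (simp add: comp_def)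
qed (use \<Psi>_closed[OF _ x] topspace_PT in blast)

text \<open>
  Closed subgroups of the profinite group are compact, and the orbit map at a point is
  continuous, so their orbits are closed.
\<close>

lemma closed_subgroup_quotient:
  assumes normal: "K \<lhd> \<Gamma>" and closed: "closedin PT K"
  shows "prodiscrete_quotient_normal Z \<Gamma> \<Psi> X proj K"
proof -
  interpret Z: prodiscrete_quotient Z \<Gamma> \<Psi> X proj by (rule universal_prodiscrete_quotient)
  have "closedin Z (orbit (\<Gamma>\<lparr>carrier := K\<rparr>) \<Psi> x)" if x: "x \<in> topspace Z" for x
  proof -
    have "closed_map PT Z (\<lambda>g. \<Psi> g x)"
      using T1_Spaces.continuous_imp_closed_map[OF orbit_map_continuous[OF x] compact_PT metrizable_imp_Hausdorff_space[OF metrizable_Z]] .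
    then have "closedin Z ((\<lambda>g. \<Psi> g x) ` K)" using closed by (simp add: closed_map_def)
    moreover have "orbit (\<Gamma>\<lparr>carrier := K\<rparr>) \<Psi> x = (\<lambda>g. \<Psi> g x) ` K" by (auto simp: orbit_def)
    ultimately show ?thesis by simp
  qed
  then show ?thesis by (rule Z.closed_normal_subgroup[OF normal])
qed

end


section \<open>Coverings of a continuum are quotients of its universal cover\<close>

context prodiscrete_quotient
begin

text \<open>
  The entourages invariant under the group.
\<close>

definition "Inv = {F \<in> diag_nhds Y. \<forall>g\<in>carrier G. \<forall>x y. (x, y) \<in> F \<longrightarrow> (\<phi> g x, \<phi> g y) \<in> F}"

abbreviation "N F \<equiv> N_subgroup (compact_uniformity Y) G \<phi> F"

lemma Inv_D:
  assumes "F \<in> Inv"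
  shows "F \<in> diag_nhds Y" "g \<in> carrier G \<Longrightarrow> (x, y) \<in> F \<Longrightarrow> (\<phi> g x, \<phi> g y) \<in> F"
  using assms by (simp_all add: Inv_def)

lemma Inv_Int: "F \<in> Inv \<Longrightarrow> F' \<in> Inv \<Longrightarrow> F \<inter> F' \<in> Inv"
  by (simp add: Inv_def diag_nhds_Int)

lemma Inv_prodiscrete:
  assumes "E \<in> diag_nhds Y"
  obtains F where "F \<in> Inv" "F \<subseteq> E" "N F \<subseteq> U_set (compact_uniformity Y) G \<phi> E"
  by (rule prodiscrete_entourage[OF assms]) (rule that, simp_all add: Inv_def)

lemma S_carrier: "S_set (compact_uniformity Y) G \<phi> F \<subseteq> carrier G"
  by (auto simp: S_set_def)

lemma mem_N:
  assumes "g \<in> carrier G" "y \<in> topspace Y" "(y, \<phi> g y) \<in> F" shows "g \<in> N F"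
proof -
  have "g \<in> S_set (compact_uniformity Y) G \<phi> F" using assms unfolding S_set_def carrier_uniformity by blast
  then show ?thesis unfolding N_subgroup_def by (rule generate.incl)
qed

lemma N_mono: "F \<subseteq> F' \<Longrightarrow> N F \<subseteq> N F'"
  unfolding N_subgroup_def by (rule group.mono_generate[OF is_group]) (auto simp: S_set_def)

lemma subgroup_N: "subgroup (N F) G"
  unfolding N_subgroup_def by (rule group.generate_is_subgroup[OF is_group S_carrier])

lemma N_normal:
  assumes F: "F \<in> Inv" shows "N F \<lhd> G"
  unfolding N_subgroup_def
proof (rule group.normal_generateI[OF is_group S_carrier])
  interpret group G by (rule is_group)
  fix h g assume h: "h \<in> S_set (compact_uniformity Y) G \<phi> F" and g: "g \<in> carrier G"
  obtain y where y: "y \<in> topspace Y" "(y, \<phi> h y) \<in> F" and hG: "h \<in> carrier G"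
    using h unfolding S_set_def carrier_uniformity by blast
  have gy: "\<phi> g y \<in> topspace Y" using act_closed[OF g y(1)] .
  have "\<phi> (g \<otimes> h \<otimes> inv g) (\<phi> g y) = \<phi> (g \<otimes> h) (\<phi> (inv g) (\<phi> g y))"
    using composition_rule[OF gy m_closed[OF g hG] inv_closed[OF g]] .
  also have "\<dots> = \<phi> g (\<phi> h y)" using act_inv(1)[OF g y(1)] composition_rule[OF y(1) g hG] by simp
  finally have "(\<phi> g y, \<phi> (g \<otimes> h \<otimes> inv g) (\<phi> g y)) \<in> F" using Inv_D(2)[OF F g y(2)] by simp
  moreover have "g \<otimes> h \<otimes> inv g \<in> carrier G" using g hG by simp
  ultimately show "g \<otimes> h \<otimes> inv g \<in> S_set (compact_uniformity Y) G \<phi> F"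
    unfolding S_set_def carrier_uniformity using gy by blast
qed

text \<open>
  The fibres of \<open>f\<close> are closed.  Within a fibre, two points closer than
  \<open>F\<close> differ by an element of \<open>N\<^bsub>F\<^esub>(G)\<close>, so the
  orbits of \<open>N\<^bsub>F\<^esub>(G)\<close> are relatively open and therefore
  relatively closed.
\<close>

lemma N_orbit_closed:
  assumes F: "F \<in> Inv" and y: "y \<in> topspace Y"
  shows "closedin Y (orbit (G\<lparr>carrier := N F\<rparr>) \<phi> y)"
  unfolding closedin_def
proof
  interpret group G by (rule is_group)
  let ?O = "orbit (G\<lparr>carrier := N F\<rparr>) \<phi> y"
  have NG: "n \<in> carrier G" if "n \<in> N F" for n using subgroup.mem_carrier[OF subgroup_N that] .
  show OY: "?O \<subseteq> topspace Y"
  proof (rule subsetI)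
    fix z assume "z \<in> ?O"
    then obtain n where "n \<in> N F" "z = \<phi> n y" unfolding mem_orbit_subgroup by blast
    then show "z \<in> topspace Y" using act_closed[OF NG y] by simp
  qed
  show "openin Y (topspace Y - ?O)"
  proof (subst openin_subopen, intro ballI)
    fix z assume z: "z \<in> topspace Y - ?O"
    show "\<exists>T. openin Y T \<and> z \<in> T \<and> T \<subseteq> topspace Y - ?O"
    proof (cases "f z = f y")
      case False
      have "f w = f y" if "w \<in> ?O" for w using that f_act[OF NG y] unfolding mem_orbit_subgroup by auto
      then show ?thesis
        using f_fibre_closed[OF y] z False by (intro exI[of _ "topspace Y - {z \<in> topspace Y. f z = f y}"]) auto
    next
      case True
      then obtain g where g: "g \<in> carrier G" "z = \<phi> g y" using f_fibre[of y z] y z by auto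
      obtain V where V: "openin Y V" "z \<in> V" "V \<times> V \<subseteq> F" using diag_nhds_D(3)[OF Inv_D(1)[OF F], of z] z by blast
      have False if n: "n \<in> N F" "\<phi> n y \<in> V" for n
      proof -
        have nG: "n \<in> carrier G" and ig: "inv g \<in> carrier G" using NG[OF n(1)] g(1) by simp_all
        have "(\<phi> g y, \<phi> n y) \<in> F" using V n(2) g(2) by blast
        then have "(\<phi> (inv g) (\<phi> g y), \<phi> (inv g) (\<phi> n y)) \<in> F" by (rule Inv_D(2)[OF F ig])
        then have "(y, \<phi> (inv g \<otimes> n) y) \<in> F" using act_inv(1)[OF g(1) y] composition_rule[OF y ig nG] by simp
        then have "inv g \<otimes> n \<in> N F" using mem_N[of "inv g \<otimes> n" y F] y ig nG by simp
        then have "n \<otimes> inv (inv g \<otimes> n) \<in> N F"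
          using subgroup.m_closed[OF subgroup_N n(1) subgroup.m_inv_closed[OF subgroup_N]] by blast
        moreover have "n \<otimes> inv (inv g \<otimes> n) = g" using g(1) nG by (simp add: inv_mult_group m_assoc[symmetric])
        ultimately have "z \<in> ?O" using g(2) unfolding mem_orbit_subgroup by auto
        then show False using z by blast
      qed
      then have "V \<inter> ?O = {}" unfolding disjoint_iff mem_orbit_subgroup by blast
      then show ?thesis using V(1,2) openin_subset[OF V(1)] by (intro exI[of _ V]) blast
    qed
  qed
qed

lemma N_quotient: "F \<in> Inv \<Longrightarrow> prodiscrete_quotient_normal Y G \<phi> X f (N F)"
  using closed_normal_subgroup[OF N_normal N_orbit_closed] .

text \<open>
  Points of one fibre of \<open>Y/N\<^bsub>F\<^esub>(G) \<rightarrow> X\<close> that are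
  closer than the image of \<open>F\<close> are equal, so this map is locally injective:
  dividing by \<open>N\<^bsub>F\<^esub>(G)\<close> leaves a cover.
\<close>

lemma N_quotient_cover:
  assumes F: "F \<in> Inv" and X: "continuum X" and Y: "connected_space Y"
  shows "normal_cover (utopology (quotient_uniformity (compact_uniformity Y) G \<phi> (N F))) X (quotient_projection f)"
proof -
  interpret Q: prodiscrete_quotient_normal Y G \<phi> X f "N F" by (rule N_quotient[OF F])
  let ?Q = "utopology Q.UQ"
  interpret Q': prodiscrete_quotient ?Q "G Mod N F" Q.act_Q X "quotient_projection f"
    by (rule Q.quotient_prodiscrete_quotient)
  show ?thesis
  proof
    show "compact_space ?Q" "metrizable_space ?Q" by (rule Q.compact_UQ, rule Q.metrizable_UQ)
    show "connected_space ?Q" using connected_space_image[OF Y Q.continuous_q] Q.topspace_UQ by simp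
    show "continuum X" by (rule X)
    show "continuous_map ?Q X (quotient_projection f)" by (rule Q'.f_continuous)
    show "quotient_projection f ` topspace ?Q = topspace X" by (rule Q'.f_image)
    fix A assume A: "A \<in> topspace ?Q"
    define W where "W = map_prod Q.q Q.q ` F"
    have "W \<in> diag_nhds ?Q"
      unfolding Q.UQ_diag_nhds[symmetric] unfolding W_def Q.UQ_eq image_uniformity_def by (rule imageI[OF Inv_D(1)[OF F]])
    then obtain V where V: "openin ?Q V" "A \<in> V" "V \<times> V \<subseteq> W" using diag_nhds_D(3) A by metis
    have "inj_on (quotient_projection f) V"
    proof (rule inj_onI)
      fix B B' assume B: "B \<in> V" "B' \<in> V" "quotient_projection f B = quotient_projection f B'"
      then have "(B, B') \<in> W" using V(3) by blast
      then obtain a b where ab: "(a, b) \<in> F" "B = Q.q a" "B' = Q.q b" unfolding W_def by auto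
      have abY: "a \<in> topspace Y" "b \<in> topspace Y" using diag_nhds_D(1)[OF Inv_D(1)[OF F]] ab(1) by auto
      have "f a = f b" using B(3) ab Q.quotient_projection_orbit abY by simp
      then obtain g where g: "g \<in> carrier G" "b = \<phi> g a" using f_fibre[OF abY] by blast
      have "g \<in> N F" using mem_N[OF g(1) abY(1)] ab(1) g(2) by simp
      then show "B = B'" using orbit_subgroup_act[OF subgroup_N _ abY(1)] ab g(2) by simp
    qed
    then show "\<exists>V. openin ?Q V \<and> A \<in> V \<and> inj_on (quotient_projection f) V" using V by blast
    fix B assume B: "B \<in> topspace ?Q" and eq: "quotient_projection f A = quotient_projection f B"
    obtain c where c: "c \<in> carrier (G Mod N F)" "B = Q.act_Q c A" using Q'.f_fibre[OF A B] eq by blast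
    then show "\<exists>t. over_homeomorphism ?Q (quotient_projection f) t \<and> t A = B"
      using Q'.act_homeomorphic_map Q'.f_act by (intro exI[of _ "Q.act_Q c"]) (simp add: over_homeomorphism_def)
  qed
qed

end

text \<open>
  A generalized regular covering of \<open>X\<close> by a continuum \<open>Y\<close> next to
  the compact universal cover \<open>Z\<close>.  The covers
  \<open>Y/N\<^bsub>F\<^esub>(G)\<close> occur up to equivalence among those defining
  \<open>Z\<close>; the resulting maps from \<open>Z\<close> to them assemble to a map onto
  \<open>Y\<close>.
\<close>

locale universally_covered = cover_system X x\<^sub>0 I C + prodiscrete_quotient Y G \<phi> X f
  for X :: "'x topology" and x\<^sub>0 and I :: "'i set" and C :: "'i \<Rightarrow> ('c, 'd, 'x) pointed_cover"
    and Y :: "'y topology" and G :: "'g monoid" (structure) and \<phi> and f +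
  assumes connected_Y: "connected_space Y"
begin

abbreviation "q F \<equiv> orbit (G\<lparr>carrier := N F\<rparr>) \<phi>"
abbreviation "Q F \<equiv> utopology (quotient_uniformity (compact_uniformity Y) G \<phi> (N F))"

lemma Q_cover: "F \<in> Inv \<Longrightarrow> normal_cover (Q F) X (quotient_projection f)"
  using N_quotient_cover continuum_X connected_Y by blast

lemma q_continuous: "F \<in> Inv \<Longrightarrow> continuous_map Y (Q F) (q F)"
  and topspace_Q: "F \<in> Inv \<Longrightarrow> topspace (Q F) = q F ` topspace Y"
  and projection_q: "F \<in> Inv \<Longrightarrow> y \<in> topspace Y \<Longrightarrow> quotient_projection f (q F y) = f y"
proof -
  assume F: "F \<in> Inv"
  interpret Q: prodiscrete_quotient_normal Y G \<phi> X f "N F" by (rule N_quotient[OF F])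
  show "continuous_map Y (Q F) (q F)" by (rule Q.continuous_q)
  show "topspace (Q F) = q F ` topspace Y" by (rule Q.topspace_UQ)
  show "quotient_projection f (q F y) = f y" if "y \<in> topspace Y" by (rule Q.quotient_projection_orbit[OF that])
qed

text \<open>
  Two points with the same image in all \<open>Y/N\<^bsub>F\<^esub>(G)\<close> differ, for
  every entourage \<open>E\<close>, by an element of some \<open>N\<^bsub>F\<^esub>(G)
  \<subseteq> U\<^bsub>E\<^esub>(G)\<close>; so they are \<open>E\<close>-close for all
  \<open>E\<close>.
\<close>

lemma q_separate:
  assumes y: "y \<in> topspace Y" and z: "z \<in> topspace Y" and eq: "\<And>F. F \<in> Inv \<Longrightarrow> q F y = q F z"
  shows "y = z"
proof (rule entourages_separate[OF y z])
  fix E assume "E \<in> diag_nhds Y"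
  then obtain F where F: "F \<in> Inv" "F \<subseteq> E" "N F \<subseteq> U_set (compact_uniformity Y) G \<phi> E" by (rule Inv_prodiscrete)
  obtain n where "n \<in> N F" "z = \<phi> n y" using orbit_subgroup_eq_iff[OF subgroup_N y z] eq[OF F(1)] by blast
  then show "(y, z) \<in> E" using F(3) y unfolding U_set_def carrier_uniformity by blast
qed

text \<open>
  Lifts to \<open>Y\<close> are determined by their compositions with the maps to the covers
  \<open>Y/N\<^bsub>F\<^esub>(G)\<close>, where unique lifting applies.
\<close>

lemma unique_lift_Y:
  assumes u: "continuous_map Z Y u" and v: "continuous_map Z Y v"
    and over: "\<And>x. x \<in> topspace Z \<Longrightarrow> f (u x) = f (v x)"
    and z: "z \<in> topspace Z" "u z = v z" and x: "x \<in> topspace Z"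
  shows "u x = v x"
proof -
  have uv: "u x \<in> topspace Y" "v x \<in> topspace Y" if "x \<in> topspace Z" for x
    using continuous_map_image_subset_topspace[OF u] continuous_map_image_subset_topspace[OF v] that by blast+
  show ?thesis
  proof (rule q_separate[OF uv[OF x]])
    fix F assume F: "F \<in> Inv"
    interpret Q: normal_cover "Q F" X "quotient_projection f" by (rule Q_cover[OF F])
    have "(q F \<circ> u) x = (q F \<circ> v) x"
      by (rule Q.unique_lift[OF connected_Z continuous_map_compose[OF u q_continuous[OF F]] continuous_map_compose[OF v q_continuous[OF F]] _ z(1) _ x])
        (use over uv projection_q[OF F] z(2) in simp_all)
    then show "q F (u x) = q F (v x)" by simp
  qed
qed

definition "y\<^sub>0 = (SOME y. y \<in> topspace Y \<and> f y = x\<^sub>0)"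
definition "z\<^sub>0 = (SOME z. z \<in> topspace Z \<and> proj z = x\<^sub>0)"

lemma y0: "y\<^sub>0 \<in> topspace Y" "f y\<^sub>0 = x\<^sub>0"
proof -
  have "\<exists>y. y \<in> topspace Y \<and> f y = x\<^sub>0" using x0 unfolding f_image[symmetric] by (elim imageE) blast
  then have "y\<^sub>0 \<in> topspace Y \<and> f y\<^sub>0 = x\<^sub>0" unfolding y\<^sub>0_def by (rule someI_ex)
  then show "y\<^sub>0 \<in> topspace Y" "f y\<^sub>0 = x\<^sub>0" by simp_all
qed

lemma z0: "z\<^sub>0 \<in> topspace Z" "proj z\<^sub>0 = x\<^sub>0"
proof -
  have "\<exists>z. z \<in> topspace Z \<and> proj z = x\<^sub>0" using x0 unfolding proj_onto[symmetric] by (elim imageE) blast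
  then have "z\<^sub>0 \<in> topspace Z \<and> proj z\<^sub>0 = x\<^sub>0" unfolding z\<^sub>0_def by (rule someI_ex)
  then show "z\<^sub>0 \<in> topspace Z" "proj z\<^sub>0 = x\<^sub>0" by simp_all
qed

definition lift_to :: "('y \<times> 'y) set \<Rightarrow> (('i \<Rightarrow> 'c) \<Rightarrow> 'y set) \<Rightarrow> bool" where
  "lift_to F u \<longleftrightarrow> continuous_map Z (Q F) u \<and> (\<forall>x\<in>topspace Z. quotient_projection f (u x) = proj x) \<and>
     u z\<^sub>0 = q F y\<^sub>0 \<and> u ` topspace Z = topspace (Q F)"

text \<open>
  The cover \<open>Y/N\<^bsub>F\<^esub>(G)\<close> is isomorphic to a coordinate of
  \<open>Z\<close>; a deck transformation moves the image of the basepoint to the required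
  place.
\<close>

lemma lift_exists:
  assumes F: "F \<in> Inv" shows "\<exists>u. lift_to F u"
proof -
  interpret Q: normal_cover "Q F" X "quotient_projection f" by (rule Q_cover[OF F])
  obtain i h where i: "i \<in> I" and h: "homeomorphic_map (S i) (Q F) h"
    "\<And>y. y \<in> topspace (S i) \<Longrightarrow> quotient_projection f (h y) = p i y"
    by (rule Q.equivalent_cover_exists[OF all_covers]) (rule that)
  have hQ: "h c \<in> topspace (Q F)" if "c \<in> topspace (S i)" for c using homeomorphic_imp_surjective_map[OF h(1)] that by blast
  have "quotient_projection f (h (z\<^sub>0 i)) = x\<^sub>0"
    using h(2)[OF Z_coordinate[OF z0(1) i]] proj_coordinate[OF z0(1) i] z0(2) by simp
  moreover have "q F y\<^sub>0 \<in> topspace (Q F)" unfolding topspace_Q[OF F] using y0(1) by (rule imageI)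
  moreover have "quotient_projection f (q F y\<^sub>0) = x\<^sub>0" using projection_q[OF F y0(1)] y0(2) by simp
  ultimately obtain t where t: "over_homeomorphism (Q F) (quotient_projection f) t" "t (h (z\<^sub>0 i)) = q F y\<^sub>0"
    using Q.transitive[OF hQ[OF Z_coordinate[OF z0(1) i]], of "q F y\<^sub>0"] by auto
  have tQ: "homeomorphic_map (Q F) (Q F) t" using t(1) by (simp add: over_homeomorphism_def)
  have "continuous_map Z (Q F) (t \<circ> (h \<circ> (\<lambda>x. x i)))"
    using continuous_map_compose[OF continuous_map_compose[OF Z_projection[OF i] homeomorphic_imp_continuous_map[OF h(1)]]
      homeomorphic_imp_continuous_map[OF tQ]] .
  moreover have "quotient_projection f (t (h (x i))) = proj x" if x: "x \<in> topspace Z" for x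
    using t(1) hQ[OF Z_coordinate[OF x i]] h(2)[OF Z_coordinate[OF x i]] proj_coordinate[OF x i]
    by (simp add: over_homeomorphism_def)
  moreover have "(t \<circ> (h \<circ> (\<lambda>x. x i))) ` topspace Z = topspace (Q F)"
  proof -
    have "(\<lambda>x. x i) ` topspace Z = topspace (S i)"
    proof (rule equalityI; rule subsetI)
      fix c assume "c \<in> topspace (S i)"
      then obtain x where "x \<in> topspace Z" "x i = c" by (rule Z_projection_onto[OF i])
      then show "c \<in> (\<lambda>x. x i) ` topspace Z" by blast
    qed (use Z_coordinate[OF _ i] in blast)
    then show ?thesis
      unfolding image_comp[symmetric] using homeomorphic_imp_surjective_map[OF h(1)] homeomorphic_imp_surjective_map[OF tQ] by simp
  qed
  ultimately have "lift_to F (t \<circ> (h \<circ> (\<lambda>x. x i)))" unfolding lift_to_def using t(2) by simp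
  then show ?thesis by blast
qed

definition "lift F = (SOME u. lift_to F u)"

lemma lift:
  assumes F: "F \<in> Inv"
  shows "continuous_map Z (Q F) (lift F)" "x \<in> topspace Z \<Longrightarrow> quotient_projection f (lift F x) = proj x"
    "lift F z\<^sub>0 = q F y\<^sub>0" "lift F ` topspace Z = topspace (Q F)"
proof -
  have "lift_to F (lift F)" unfolding lift_def using lift_exists[OF F] by (rule someI_ex)
  then show "continuous_map Z (Q F) (lift F)" "x \<in> topspace Z \<Longrightarrow> quotient_projection f (lift F x) = proj x"
    "lift F z\<^sub>0 = q F y\<^sub>0" "lift F ` topspace Z = topspace (Q F)" unfolding lift_to_def by simp_all
qed

text \<open>
  The map \<open>Y/N\<^bsub>F\<^esub>(G) \<rightarrow> Y/N\<^bsub>F'\<^esub>(G)\<close>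
  induced by the identity of \<open>Y\<close> takes the lift to the first cover to a lift to
  the second one with the same value at the basepoint.
\<close>

lemma lift_compatible:
  assumes F: "F \<in> Inv" and F': "F' \<in> Inv" and sub: "F \<subseteq> F'"
    and x: "x \<in> topspace Z" and y: "y \<in> topspace Y" and eq: "lift F x = q F y"
  shows "lift F' x = q F' y"
proof -
  interpret Q: normal_cover "Q F" X "quotient_projection f" by (rule Q_cover[OF F])
  interpret Q': normal_cover "Q F'" X "quotient_projection f" by (rule Q_cover[OF F'])
  \<comment> \<open>The map \<open>Y/N\<^bsub>F\<^esub>(G) \<rightarrow> Y/N\<^bsub>F'\<^esub>(G)\<close>, independent of the chosen representative.\<close>
  define c where "c A = q F' (SOME a. a \<in> A)" for A
  have cq: "c (q F z) = q F' z" if z: "z \<in> topspace Y" for z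
  proof -
    have "(SOME a. a \<in> q F z) \<in> q F z" using orbit_subgroup_self[OF subgroup_N z] by (rule someI)
    then obtain n where n: "n \<in> N F" "(SOME a. a \<in> q F z) = \<phi> n z" unfolding mem_orbit_subgroup by blast
    then have "n \<in> N F'" using N_mono[OF sub] by blast
    then show ?thesis unfolding c_def n(2) by (rule orbit_subgroup_act[OF subgroup_N _ z])
  qed
  have "quotient_map Y (Q F) (q F)"
    using T1_Spaces.continuous_imp_quotient_map[OF q_continuous[OF F] compact Q.Hausdorff] topspace_Q[OF F] by simp
  moreover have "continuous_map Y (Q F') (c \<circ> q F)"
    using q_continuous[OF F'] by (rule continuous_map_eq) (simp add: cq)
  ultimately have cc: "continuous_map (Q F) (Q F') c" by (rule continuous_compose_quotient_map)
  have rY: "\<exists>a\<in>topspace Y. lift F w = q F a" if "w \<in> topspace Z" for w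
    using lift(4)[OF F] topspace_Q[OF F] that by blast
  have "lift F' x = (c \<circ> lift F) x"
  proof (rule Q'.unique_lift[OF connected_Z lift(1)[OF F'] continuous_map_compose[OF lift(1)[OF F] cc] _ z0(1) _ x])
    show "lift F' z\<^sub>0 = (c \<circ> lift F) z\<^sub>0" using lift(3)[OF F] lift(3)[OF F'] cq[OF y0(1)] by simp
    fix w assume w: "w \<in> topspace Z"
    obtain a where a: "a \<in> topspace Y" "lift F w = q F a" using rY[OF w] by blast
    have "quotient_projection f (c (lift F w)) = f a" using a cq projection_q[OF F' a(1)] by simp
    also have "\<dots> = proj w" using a projection_q[OF F a(1)] lift(2)[OF F w] by simp
    finally show "quotient_projection f (lift F' w) = quotient_projection f ((c \<circ> lift F) w)" using lift(2)[OF F' w] by simp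
  qed
  then show ?thesis using eq cq[OF y] by simp
qed

lemma Inv_nonempty: "Inv \<noteq> {}"
proof -
  obtain F where "F \<in> Inv" by (rule Inv_prodiscrete[OF diag_nhds_total])
  then show ?thesis by blast
qed

text \<open>
  The orbits \<open>lift F x\<close>, as subsets of \<open>Y\<close>, are closed and
  decrease with \<open>F\<close>; compactness gives a common point, and it is unique since
  the quotients separate points.
\<close>

lemma limit_exists:
  assumes x: "x \<in> topspace Z" shows "\<exists>!y. y \<in> topspace Y \<and> (\<forall>F\<in>Inv. lift F x = q F y)"
proof (rule ex_ex1I)
  show "y = z" if "y \<in> topspace Y \<and> (\<forall>F\<in>Inv. lift F x = q F y)" "z \<in> topspace Y \<and> (\<forall>F\<in>Inv. lift F x = q F z)" for y z
    using q_separate[of y z] that by simp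
  let ?K = "\<lambda>F. {y \<in> topspace Y. lift F x = q F y}"
  have K: "closedin Y (?K F)" "?K F \<noteq> {}" if F: "F \<in> Inv" for F
  proof -
    have "lift F x \<in> q F ` topspace Y" using lift(4)[OF F] topspace_Q[OF F] x by blast
    then obtain a where a: "a \<in> topspace Y" "lift F x = q F a" by blast
    have sub: "q F a \<subseteq> topspace Y" using closedin_subset[OF N_orbit_closed[OF F a(1)]] .
    have "?K F = q F a"
    proof (rule equalityI; rule subsetI)
      fix y assume "y \<in> ?K F"
      then show "y \<in> q F a" using a(2) orbit_subgroup_self[OF subgroup_N, of y F] by simp
    next
      fix y assume y: "y \<in> q F a"
      then obtain n where n: "n \<in> N F" "y = \<phi> n a" unfolding mem_orbit_subgroup by blast
      then show "y \<in> ?K F" using y sub a(2) orbit_subgroup_act[OF subgroup_N n(1) a(1)] by auto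
    qed
    then show "closedin Y (?K F)" "?K F \<noteq> {}" using N_orbit_closed[OF F a(1)] a by auto
  qed
  have dir: "\<exists>H\<in>Inv. ?K H \<subseteq> ?K F \<and> ?K H \<subseteq> ?K F'" if F: "F \<in> Inv" and F': "F' \<in> Inv" for F F'
  proof (intro bexI[OF _ Inv_Int[OF F F']] conjI subsetI)
    fix y assume "y \<in> ?K (F \<inter> F')"
    then have y: "y \<in> topspace Y" "lift (F \<inter> F') x = q (F \<inter> F') y" by simp_all
    show "y \<in> ?K F" using y(1) lift_compatible[OF Inv_Int[OF F F'] F _ x y] by simp
    show "y \<in> ?K F'" using y(1) lift_compatible[OF Inv_Int[OF F F'] F' _ x y] by simp
  qed
  obtain y where "y \<in> topspace Y" "\<And>F. F \<in> Inv \<Longrightarrow> y \<in> ?K F"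
    by (rule compact_directed_Inter[OF compact Inv_nonempty K dir]) (assumption | rule that)+
  then show "\<exists>y. y \<in> topspace Y \<and> (\<forall>F\<in>Inv. lift F x = q F y)" by (intro exI[of _ y]) simp
qed

definition "limit x = (THE y. y \<in> topspace Y \<and> (\<forall>F\<in>Inv. lift F x = q F y))"

lemma limit:
  assumes "x \<in> topspace Z" shows "limit x \<in> topspace Y" "F \<in> Inv \<Longrightarrow> lift F x = q F (limit x)"
  using theI'[OF limit_exists[OF assms]] unfolding limit_def[symmetric] by simp_all

lemma limit_eqI: "x \<in> topspace Z \<Longrightarrow> y \<in> topspace Y \<Longrightarrow> (\<And>F. F \<in> Inv \<Longrightarrow> lift F x = q F y) \<Longrightarrow> limit x = y"
  using limit q_separate[of "limit x" y] by simp

lemma limit_over: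
  assumes x: "x \<in> topspace Z" shows "f (limit x) = proj x"
proof -
  obtain F where F: "F \<in> Inv" using Inv_nonempty by blast
  show ?thesis using lift(2)[OF F x] limit(2)[OF x F] projection_q[OF F limit(1)[OF x]] by simp
qed

text \<open>
  If \<open>lift F x\<close> and \<open>lift F y\<close> are close, they contain close
  points of \<open>Y\<close>; and each of these orbits is small because
  \<open>N\<^bsub>F\<^esub>(G)\<close> moves all points only a little.
\<close>

lemma limit_continuous: "continuous_map Z Y limit"
proof -
  have "{(x, y) \<in> topspace Z \<times> topspace Z. (limit x, limit y) \<in> E} \<in> diag_nhds Z" if E: "E \<in> diag_nhds Y" for E
  proof -
    obtain H where H: "H \<in> diag_nhds Y" "H O H O H \<subseteq> E" using diag_nhds_third[OF compact metrizable E] by blast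
    obtain F where F: "F \<in> Inv" "F \<subseteq> H" "N F \<subseteq> U_set (compact_uniformity Y) G \<phi> H" by (rule Inv_prodiscrete[OF H(1)])
    interpret Q: prodiscrete_quotient_normal Y G \<phi> X f "N F" by (rule N_quotient[OF F(1)])
    define W where "W = map_prod (q F) (q F) ` F"
    have "W \<in> diag_nhds (Q F)"
      unfolding Q.UQ_diag_nhds[symmetric] unfolding W_def Q.UQ_eq image_uniformity_def by (rule imageI[OF Inv_D(1)[OF F(1)]])
    then have "{(x, y) \<in> topspace Z \<times> topspace Z. (lift F x, lift F y) \<in> W} \<in> diag_nhds Z"
      by (rule preimage_diag_nhds[OF lift(1)[OF F(1)]])
    then show ?thesis
    proof (rule diag_nhds_mono)
      have near: "(y, a) \<in> H" if y: "y \<in> topspace Y" and a: "a \<in> topspace Y" and eq: "q F y = q F a" for y a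
      proof -
        obtain n where "n \<in> N F" "a = \<phi> n y" using orbit_subgroup_eq_iff[OF subgroup_N y a] eq by blast
        then show ?thesis using F(3) y unfolding U_set_def carrier_uniformity by blast
      qed
      show "{(x, y) \<in> topspace Z \<times> topspace Z. (lift F x, lift F y) \<in> W} \<subseteq> {(x, y) \<in> topspace Z \<times> topspace Z. (limit x, limit y) \<in> E}"
      proof (rule subsetI)
        fix w assume "w \<in> {(x, y) \<in> topspace Z \<times> topspace Z. (lift F x, lift F y) \<in> W}"
        then obtain x y where w: "w = (x, y)" and xy: "x \<in> topspace Z" "y \<in> topspace Z" "(lift F x, lift F y) \<in> W" by auto
        obtain a b where ab: "(a, b) \<in> F" "lift F x = q F a" "lift F y = q F b" using xy(3) unfolding W_def by auto
        have abY: "a \<in> topspace Y" "b \<in> topspace Y" using diag_nhds_D(1)[OF H(1)] ab(1) F(2) by auto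
        have "(limit x, a) \<in> H" using near[OF limit(1)[OF xy(1)] abY(1)] limit(2)[OF xy(1) F(1)] ab(2) by simp
        moreover have "(a, b) \<in> H" using ab(1) F(2) by blast
        moreover have "(b, limit y) \<in> H" using near[OF abY(2) limit(1)[OF xy(2)]] limit(2)[OF xy(2) F(1)] ab(3) by simp
        ultimately have "(limit x, limit y) \<in> E" using H(2) by blast
        then show "w \<in> {(x, y) \<in> topspace Z \<times> topspace Z. (limit x, limit y) \<in> E}" using w xy by simp
      qed
      show "sym {(x, y) \<in> topspace Z \<times> topspace Z. (limit x, limit y) \<in> E}"
        using diag_nhds_D(2)[OF E] by (auto simp: sym_def)
    qed auto
  qed
  then have "Defs.uniformly_continuous_map (diag_nhds Z) (diag_nhds Y) limit"
    unfolding Defs.uniformly_continuous_map_def ucarrier_diag_nhds using limit(1) by auto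
  then have "continuous_map (utopology (diag_nhds Z)) (utopology (diag_nhds Y)) limit"
    by (rule uniformly_continuous_imp_continuous_map[OF uniform_structure_diag_nhds[OF compact_Z metrizable_Z] uniform_structure_diag_nhds[OF compact metrizable]])
  then show ?thesis by (simp add: utopology_diag_nhds[OF compact metrizable] utopology_diag_nhds[OF compact_Z metrizable_Z])
qed

text \<open>
  The preimages of a point under the lifts are closed, nonempty and decrease with
  \<open>F\<close>.
\<close>

lemma limit_onto:
  assumes y: "y \<in> topspace Y" obtains x where "x \<in> topspace Z" "limit x = y"
proof -
  let ?K = "\<lambda>F. {x \<in> topspace Z. lift F x = q F y}"
  have K: "closedin Z (?K F)" "?K F \<noteq> {}" if F: "F \<in> Inv" for F
  proof -
    interpret Q: normal_cover "Q F" X "quotient_projection f" by (rule Q_cover[OF F])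
    have qy: "q F y \<in> topspace (Q F)" unfolding topspace_Q[OF F] using y by (rule imageI)
    then have "closedin (Q F) {q F y}" using Q.Hausdorff by (simp add: closedin_Hausdorff_singleton)
    then have "closedin Z {x \<in> topspace Z. lift F x \<in> {q F y}}" by (rule closedin_continuous_map_preimage[OF lift(1)[OF F]])
    then show "closedin Z (?K F)" by simp
    have "q F y \<in> lift F ` topspace Z" unfolding lift(4)[OF F] by (rule qy)
    then obtain x where "q F y = lift F x" "x \<in> topspace Z" by (rule imageE)
    then show "?K F \<noteq> {}" by force
  qed
  have dir: "\<exists>H\<in>Inv. ?K H \<subseteq> ?K F \<and> ?K H \<subseteq> ?K F'" if F: "F \<in> Inv" and F': "F' \<in> Inv" for F F'
  proof (intro bexI[OF _ Inv_Int[OF F F']] conjI subsetI)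
    fix x assume "x \<in> ?K (F \<inter> F')"
    then have x: "x \<in> topspace Z" "lift (F \<inter> F') x = q (F \<inter> F') y" by simp_all
    show "x \<in> ?K F" using x(1) lift_compatible[OF Inv_Int[OF F F'] F _ x(1) y x(2)] by simp
    show "x \<in> ?K F'" using x(1) lift_compatible[OF Inv_Int[OF F F'] F' _ x(1) y x(2)] by simp
  qed
  obtain x where x: "x \<in> topspace Z" "\<And>F. F \<in> Inv \<Longrightarrow> x \<in> ?K F"
    by (rule compact_directed_Inter[OF compact_Z Inv_nonempty K dir]) (assumption | rule that)+
  then have "limit x = y" using limit_eqI[OF x(1) y] by simp
  then show thesis using that x(1) by blast
qed

end


context universally_covered
begin

text \<open>
  The homomorphism of deck groups accompanying the map from the universal cover to
  \<open>Y\<close>.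
\<close>

definition "\<theta> g = (THE k. k \<in> carrier G \<and> (\<forall>x\<in>topspace Z. limit (\<Psi> g x) = \<phi> k (limit x)))"

lemma theta_ex1:
  assumes g: "g \<in> carrier \<Gamma>"
  shows "\<exists>!k. k \<in> carrier G \<and> (\<forall>x\<in>topspace Z. limit (\<Psi> g x) = \<phi> k (limit x))"
proof (rule ex_ex1I)
  have gz: "\<Psi> g z\<^sub>0 \<in> topspace Z" using \<Psi>_closed[OF g z0(1)] .
  have "f (limit z\<^sub>0) = f (limit (\<Psi> g z\<^sub>0))"
    using limit_over[OF z0(1)] limit_over[OF gz] proj_fibre[OF z0(1) gz] g by auto
  then obtain k where k: "k \<in> carrier G" "limit (\<Psi> g z\<^sub>0) = \<phi> k (limit z\<^sub>0)" using f_fibre[OF limit(1)[OF z0(1)] limit(1)[OF gz]] by blast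
  have "(limit \<circ> \<Psi> g) x = (\<phi> k \<circ> limit) x" if x: "x \<in> topspace Z" for x
  proof (rule unique_lift_Y[OF continuous_map_compose[OF \<Psi>_continuous[OF g] limit_continuous]
        continuous_map_compose[OF limit_continuous act_continuous[OF k(1)]] _ z0(1) _ x])
    show "(limit \<circ> \<Psi> g) z\<^sub>0 = (\<phi> k \<circ> limit) z\<^sub>0" using k(2) by simp
    fix w assume w: "w \<in> topspace Z"
    have gw: "\<Psi> g w \<in> topspace Z" using \<Psi>_closed[OF g w] .
    have "proj w = proj (\<Psi> g w)" using proj_fibre[OF w gw] g by blast
    then show "f ((limit \<circ> \<Psi> g) w) = f ((\<phi> k \<circ> limit) w)"
      using limit_over[OF w] limit_over[OF gw] f_act[OF k(1) limit(1)[OF w]] by simp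
  qed
  then show "\<exists>k. k \<in> carrier G \<and> (\<forall>x\<in>topspace Z. limit (\<Psi> g x) = \<phi> k (limit x))" using k(1) by auto
next
  fix k l assume "k \<in> carrier G \<and> (\<forall>x\<in>topspace Z. limit (\<Psi> g x) = \<phi> k (limit x))"
    "l \<in> carrier G \<and> (\<forall>x\<in>topspace Z. limit (\<Psi> g x) = \<phi> l (limit x))"
  then have kl: "k \<in> carrier G" "l \<in> carrier G" "\<phi> k (limit z\<^sub>0) = \<phi> l (limit z\<^sub>0)" using z0(1) by auto
  then show "k = l" using free_eq[OF kl(1,2) limit(1)[OF z0(1)]] by blast
qed

lemma theta: "g \<in> carrier \<Gamma> \<Longrightarrow> \<theta> g \<in> carrier G"
  "g \<in> carrier \<Gamma> \<Longrightarrow> x \<in> topspace Z \<Longrightarrow> limit (\<Psi> g x) = \<phi> (\<theta> g) (limit x)"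
  using theI'[OF theta_ex1[of g]] unfolding \<theta>_def[symmetric] by blast+

lemma theta_eqI:
  assumes "g \<in> carrier \<Gamma>" "k \<in> carrier G" "x \<in> topspace Z" "limit (\<Psi> g x) = \<phi> k (limit x)" shows "\<theta> g = k"
  using free_eq[OF theta(1)[OF assms(1)] assms(2) limit(1)[OF assms(3)]] theta(2)[OF assms(1,3)] assms(4) by simp

lemma theta_hom: "group_hom \<Gamma> G \<theta>"
proof (intro group_hom.intro group_hom_axioms.intro homI group_\<Gamma> is_group)
  interpret a: faithful_action \<Gamma> "topspace Z" \<Psi> by (rule faithful_\<Psi>)
  show "\<theta> g \<in> carrier G" if "g \<in> carrier \<Gamma>" for g using theta(1)[OF that] .
  fix g h assume g: "g \<in> carrier \<Gamma>" and h: "h \<in> carrier \<Gamma>"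
  have hz: "\<Psi> h z\<^sub>0 \<in> topspace Z" using \<Psi>_closed[OF h z0(1)] .
  show "\<theta> (g \<otimes>\<^bsub>\<Gamma>\<^esub> h) = \<theta> g \<otimes> \<theta> h"
    using theta(2)[OF g hz] theta(2)[OF h z0(1)] composition_rule[OF limit(1)[OF z0(1)] theta(1)[OF g] theta(1)[OF h]]
      a.composition_rule[OF z0(1) g h] monoid.m_closed[OF group.is_monoid[OF group_\<Gamma>] g h]
      monoid.m_closed[OF group.is_monoid[OF is_group] theta(1)[OF g] theta(1)[OF h]]
    by (intro theta_eqI[OF _ _ z0(1)]) simp_all
qed

text \<open>
  For \<open>k\<close> in \<open>G\<close>, a point of the universal cover above \<open>k
  y\<close> lies in the same fibre as a point above \<open>y\<close>, so an element of the
  profinite group joins the two; its image is \<open>k\<close>.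
\<close>

lemma theta_onto: "\<theta> ` carrier \<Gamma> = carrier G"
proof (rule equalityI; rule subsetI)
  fix k assume k: "k \<in> carrier G"
  note P0 = limit(1)[OF z0(1)]
  obtain x where x: "x \<in> topspace Z" "limit x = \<phi> k (limit z\<^sub>0)" by (rule limit_onto[OF act_closed[OF k P0]])
  have "proj z\<^sub>0 = proj x" using limit_over[OF z0(1)] limit_over[OF x(1)] x(2) f_act[OF k P0] by simp
  then obtain g where g: "g \<in> carrier \<Gamma>" "x = \<Psi> g z\<^sub>0" using proj_fibre[OF z0(1) x(1)] by blast
  have "\<theta> g = k" using theta_eqI[OF g(1) k z0(1)] x(2) g(2) by simp
  then show "k \<in> \<theta> ` carrier \<Gamma>" using g(1) by blast
qed (use theta(1) in blast)

definition "K = kernel \<Gamma> G \<theta>"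

lemma K_normal: "K \<lhd> \<Gamma>"
  unfolding K_def by (rule group_hom.normal_kernel[OF theta_hom])

lemma mem_K: "g \<in> carrier \<Gamma> \<Longrightarrow> x \<in> topspace Z \<Longrightarrow> g \<in> K \<longleftrightarrow> limit (\<Psi> g x) = limit x"
  using theta_eqI[of g \<one> x] theta(2)[of g x] act_one[OF limit(1)[of x]] monoid.one_closed[OF group.is_monoid[OF is_group]]
  by (auto simp: K_def kernel_def)

lemma K_closed: "closedin PT K"
proof -
  have "continuous_map PT Y (limit \<circ> (\<lambda>g. \<Psi> g z\<^sub>0))"
    using continuous_map_compose[OF orbit_map_continuous[OF z0(1)] limit_continuous] .
  moreover have "closedin Y {limit z\<^sub>0}"
    using metrizable_imp_Hausdorff_space[OF metrizable] limit(1)[OF z0(1)] by (simp add: closedin_Hausdorff_singleton)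
  ultimately have "closedin PT {g \<in> topspace PT. (limit \<circ> (\<lambda>g. \<Psi> g z\<^sub>0)) g \<in> {limit z\<^sub>0}}" by (rule closedin_continuous_map_preimage)
  moreover have "{g \<in> topspace PT. (limit \<circ> (\<lambda>g. \<Psi> g z\<^sub>0)) g \<in> {limit z\<^sub>0}} = K"
    using mem_K[OF _ z0(1)] unfolding topspace_PT by (auto simp: K_def kernel_def)
  ultimately show ?thesis by simp
qed

text \<open>
  Two points of \<open>Z\<close> with the same image in \<open>Y\<close> lie above the same point
  of \<open>X\<close>, so an element of the profinite group joins them; its image in
  \<open>G\<close> fixes a point and is trivial by freeness.
\<close>

lemma limit_eq_iff:
  assumes x: "x \<in> topspace Z" and y: "y \<in> topspace Z"
  shows "limit x = limit y \<longleftrightarrow> (\<exists>k\<in>K. y = \<Psi> k x)"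
proof
  assume eq: "limit x = limit y"
  then have "proj x = proj y" using limit_over[OF x] limit_over[OF y] by simp
  then obtain g where g: "g \<in> carrier \<Gamma>" "y = \<Psi> g x" using proj_fibre[OF x y] by blast
  then show "\<exists>k\<in>K. y = \<Psi> k x" using mem_K[OF g(1) x] eq by auto
next
  assume "\<exists>k\<in>K. y = \<Psi> k x"
  then obtain k where k: "k \<in> K" "y = \<Psi> k x" by blast
  have "k \<in> carrier \<Gamma>" using k(1) by (simp add: K_def kernel_def)
  then show "limit x = limit y" using mem_K[of k x] k x by simp
qed

text \<open>
  The map onto \<open>Y\<close> and the quotient by the kernel are quotient maps of the same
  compact space with the same fibres, which yields a homeomorphism; the isomorphism of
  groups is the inverse of the one induced on the quotient by the kernel.
\<close>

lemma equivalent_to_quotient: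
  "equivalent_quotients (compact_uniformity Y) G \<phi> f
     (universal_quotient_uniformity I C K) (universal_quotient_group I C K)
     (universal_quotient_action I C K) (universal_quotient_projection I C)"
proof -
  interpret K: prodiscrete_quotient_normal Z \<Gamma> \<Psi> X proj K
    by (rule closed_subgroup_quotient[OF K_normal K_closed])
  have uniformity_eq: "universal_quotient_uniformity I C K = K.UQ" by (simp add: universal_uniformity_def)
  have subK: "subgroup K \<Gamma>" using normal_imp_subgroup[OF K_normal] .
  define h where "h y = K.q (SOME x. x \<in> topspace Z \<and> limit x = y)" for y
  have qP: "K.q x = K.q y \<longleftrightarrow> limit x = limit y" if "x \<in> topspace Z" "y \<in> topspace Z" for x y
    using K.orbit_subgroup_eq_iff[OF subK that] limit_eq_iff[OF that] by simp
  have hP: "h (limit x) = K.q x" if x: "x \<in> topspace Z" for x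
  proof -
    have "\<exists>w. w \<in> topspace Z \<and> limit w = limit x" using x by blast
    then have "(SOME w. w \<in> topspace Z \<and> limit w = limit x) \<in> topspace Z \<and> limit (SOME w. w \<in> topspace Z \<and> limit w = limit x) = limit x"
      by (rule someI_ex)
    then show ?thesis unfolding h_def using qP x by blast
  qed
  have limit_image: "limit ` topspace Z = topspace Y"
  proof (rule equalityI; rule subsetI)
    fix y assume "y \<in> topspace Y"
    then obtain x where "x \<in> topspace Z" "limit x = y" by (rule limit_onto)
    then show "y \<in> limit ` topspace Z" by blast
  qed (use limit(1) in blast)
  have hom: "homeomorphic_map Y (utopology K.UQ) h"
  proof (rule continuous_imp_homeomorphic_map)
    have "quotient_map Z Y limit"
      using T1_Spaces.continuous_imp_quotient_map[OF limit_continuous compact_Z metrizable_imp_Hausdorff_space[OF metrizable] limit_image] .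
    moreover have "continuous_map Z (utopology K.UQ) (h \<circ> limit)"
      using K.continuous_q by (rule continuous_map_eq) (simp add: hP)
    ultimately show "continuous_map Y (utopology K.UQ) h" by (rule continuous_compose_quotient_map)
    show "compact_space Y" by (rule compact)
    show "Hausdorff_space (utopology K.UQ)" using metrizable_imp_Hausdorff_space[OF K.metrizable_UQ] .
    show "h ` topspace Y = topspace (utopology K.UQ)"
      unfolding limit_image[symmetric] K.topspace_UQ image_image using hP by (intro image_cong) simp_all
    show "inj_on h (topspace Y)"
      unfolding limit_image[symmetric]
    proof (rule inj_onI)
      fix y z assume "y \<in> limit ` topspace Z" "z \<in> limit ` topspace Z" "h y = h z"
      then obtain x w where "x \<in> topspace Z" "y = limit x" "w \<in> topspace Z" "z = limit w" "h (limit x) = h (limit w)" by blast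
      then show "y = z" using hP qP by simp
    qed
  qed
  have uh: "uniform_homeomorphism (compact_uniformity Y) K.UQ h"
    using uniform_homeomorphism_iff[OF compact metrizable K.compact_UQ K.metrizable_UQ] hom
    unfolding K.UQ_compact_uniformity[symmetric] by blast
  define j where "j = (\<lambda>c. the_elem (\<theta> ` c))"
  have j_iso: "j \<in> iso (\<Gamma> Mod K) G"
    unfolding j_def K_def by (rule group_hom.FactGroup_iso_set[OF theta_hom theta_onto])
  have j_coset: "j (K #>\<^bsub>\<Gamma>\<^esub> g) = \<theta> g" if g: "g \<in> carrier \<Gamma>" for g
  proof -
    have eq: "\<theta> (k \<otimes>\<^bsub>\<Gamma>\<^esub> g) = \<theta> g" if k: "k \<in> K" for k
    proof -
      have "k \<in> carrier \<Gamma>" "\<theta> k = \<one>" using k by (auto simp: K_def kernel_def)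
      then show ?thesis
        using group_hom.hom_mult[OF theta_hom, of k g] g theta(1)[OF g] monoid.l_one[OF group.is_monoid[OF is_group]] by simp
    qed
    have "\<theta> ` (K #>\<^bsub>\<Gamma>\<^esub> g) = (\<lambda>k. \<theta> (k \<otimes>\<^bsub>\<Gamma>\<^esub> g)) ` K" by (auto simp: r_coset_def)
    also have "\<dots> = (\<lambda>k. \<theta> g) ` K" using eq by (rule image_cong[OF refl])
    finally have "\<theta> ` (K #>\<^bsub>\<Gamma>\<^esub> g) = {\<theta> g}" using subgroup.one_closed[OF subK] by auto
    then show ?thesis by (simp add: j_def)
  qed
  define i where "i = inv_into (carrier (\<Gamma> Mod K)) j"
  have i_iso: "i \<in> iso G (\<Gamma> Mod K)"
    unfolding i_def by (rule group.iso_set_sym[OF normal.factorgroup_is_group[OF K_normal] j_iso])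
  have i_theta: "i (\<theta> g) = K #>\<^bsub>\<Gamma>\<^esub> g" if g: "g \<in> carrier \<Gamma>" for g
  proof -
    have "K #>\<^bsub>\<Gamma>\<^esub> g \<in> carrier (\<Gamma> Mod K)" unfolding K.carrier_Mod using g by (rule imageI)
    then show ?thesis
      unfolding i_def j_coset[OF g, symmetric] using j_iso by (intro inv_into_f_f) (auto simp: iso_def bij_betw_def)
  qed
  have equivariant: "h (\<phi> g y) = K.act_Q (i g) (h y)" if g: "g \<in> carrier G" and y: "y \<in> topspace Y" for g y
  proof -
    obtain x where x: "x \<in> topspace Z" "limit x = y" by (rule limit_onto[OF y])
    obtain k where k: "k \<in> carrier \<Gamma>" "\<theta> k = g" using g unfolding theta_onto[symmetric] by blast
    have "h (\<phi> g y) = h (limit (\<Psi> k x))" using theta(2)[OF k(1) x(1)] k(2) x(2) by simp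
    also have "\<dots> = K.q (\<Psi> k x)" using hP[OF \<Psi>_closed[OF k(1) x(1)]] .
    also have "\<dots> = K.act_Q (i g) (h y)" using K.act_Q_coset[OF k(1) x(1)] i_theta[OF k(1)] k(2) hP[OF x(1)] x(2) by simp
    finally show ?thesis .
  qed
  have over: "quotient_projection proj (h y) = f y" if y: "y \<in> topspace Y" for y
  proof -
    obtain x where x: "x \<in> topspace Z" "limit x = y" by (rule limit_onto[OF y])
    then show ?thesis using hP[OF x(1)] K.quotient_projection_orbit[OF x(1)] limit_over[OF x(1)] by simp
  qed
  show ?thesis
    unfolding equivalent_quotients_def uniformity_eq carrier_uniformity
    using uh i_iso equivariant over by blast
qed

end

theorem theorem3:
  fixes X :: "'x topology" and x\<^sub>0 :: 'x
    and I :: "'i set" and C :: "'i \<Rightarrow> ('c, 'd, 'x) pointed_cover"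
  assumes "continuum X"
    and "all_covers_by_continua X x\<^sub>0 I C"
  shows "(\<forall>(Y :: 'y topology) (G :: 'g monoid) \<phi> f.
            continuum Y \<and>
            generalized_regular_covering (compact_uniformity Y) G \<phi> (compact_uniformity X) f \<longrightarrow>
            (\<exists>K. K \<lhd> profinite_group I C \<and> closedin (profinite_topology I C) K \<and>
               equivalent_quotients (compact_uniformity Y) G \<phi> f
                 (universal_quotient_uniformity I C K) (universal_quotient_group I C K)
                 (universal_quotient_action I C K) (universal_quotient_projection I C))) \<and>
         (\<forall>K. K \<lhd> profinite_group I C \<and> closedin (profinite_topology I C) K \<longrightarrow>
            continuum (utopology (universal_quotient_uniformity I C K)) \<and>
            generalized_regular_covering
              (universal_quotient_uniformity I C K) (universal_quotient_group I C K)
              (universal_quotient_action I C K)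
              (compact_uniformity X) (universal_quotient_projection I C))"
proof (intro conjI allI impI)
  interpret U: cover_system X x\<^sub>0 I C using assms by unfold_locales
  {
    fix K assume K: "K \<lhd> profinite_group I C \<and> closedin (profinite_topology I C) K"
    interpret K: prodiscrete_quotient_normal U.Z U.\<Gamma> U.\<Psi> X U.proj K
      using U.closed_subgroup_quotient K by blast
    show "continuum (utopology (universal_quotient_uniformity I C K))"
      using K.quotient_continuum[OF U.connected_Z] by (simp add: universal_uniformity_def)
    show "generalized_regular_covering
              (universal_quotient_uniformity I C K) (universal_quotient_group I C K)
              (universal_quotient_action I C K)
              (compact_uniformity X) (universal_quotient_projection I C)"
      using K.quotient_generalized_regular_covering by (simp add: universal_uniformity_def)
  }
  fix Y :: "'y topology" and G :: "'g monoid" and \<phi> f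
  assume Y: "continuum Y \<and> generalized_regular_covering (compact_uniformity Y) G \<phi> (compact_uniformity X) f"
  have cY: "compact_space Y" "metrizable_space Y" "connected_space Y" and cX: "compact_space X" "metrizable_space X"
    using Y assms(1) by (simp_all add: continuum_def)
  have q: "isomorphic_quotient_map (compact_uniformity Y) G \<phi> (compact_uniformity X) f"
    and pd: "acts_prodiscretely (compact_uniformity Y) G \<phi>"
    using Y by (simp_all add: generalized_regular_covering_def)
  have "acts_isomorphically (compact_uniformity Y) G \<phi>" "f ` topspace Y = topspace X"
    using q unfolding isomorphic_quotient_map_def compact_uniformity_eq[OF cY(1,2)] compact_uniformity_eq[OF cX] ucarrier_diag_nhds
    by simp_all
  moreover have "topspace Y \<noteq> {}" using calculation(2) U.x0 by (metis empty_iff image_empty)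
  ultimately have "prodiscrete_quotient Y G \<phi> X f"
    using cY cX q pd by (simp add: prodiscrete_quotient_def prodiscrete_quotient_axioms_def isomorphic_action_def)
  then interpret V: universally_covered X x\<^sub>0 I C Y G \<phi> f
    using cY(3) U.cover_system_axioms by (simp add: universally_covered_def universally_covered_axioms_def)
  show "\<exists>K. K \<lhd> profinite_group I C \<and> closedin (profinite_topology I C) K \<and>
               equivalent_quotients (compact_uniformity Y) G \<phi> f
                 (universal_quotient_uniformity I C K) (universal_quotient_group I C K)
                 (universal_quotient_action I C K) (universal_quotient_projection I C)"
    using V.K_normal V.K_closed V.equivalent_to_quotient by blast
qed

end
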